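(* Let $\Omega\subset\mathbb{R}^2$ be an open regular hexagon and let $a\in C^2(\overline\Omega)$ satisfy $a(\mathbf{x})\ge a_0>0$ for all $\mathbf{x}\in\overline\Omega$, with $a_0$ a constant. For each mesh of the family of uniform partitions of $\overline\Omega$ into equilateral triangles described in the context, with $n=n(h)$ internal nodes, let $A_n(a)=\Theta_n(a)$ be the stiffness matrix and $P_n(a)$ the preconditioner defined in the context; these are Hermitian (real symmetric) positive definite $n\times n$ matrices. Then: (i) the sequence $\{P_n^{-1}(a)A_n(a)\}$ is properly clustered at $1$, i.e. for every $\varepsilon>0$ there is a constant $C_\varepsilon$, independent of $n$, such that for every $n$ the number of eigenvalues of $P_n^{-1}(a)A_n(a)$ (counted with multiplicity) not belonging to $(1-\varepsilon,1+\varepsilon)$ is at most $C_\varepsilon$; (ii) there are constants $0<d\le D<\infty$, independent of $n$, such that for every $n$ all the eigenvalues of $P_n^{-1}(a)A_n(a)$ belong to $[d,D]$.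
   Context: Mesh: $\Omega$ is an open regular hexagon of side length $L$. For each integer $m\ge 1$, $\mathcal{T}_h$ is the partition of $\overline\Omega$ into congruent equilateral triangles of side $h=L/m$ obtained by dividing each side of the hexagon into $m$ equal parts and drawing all the lines through the division points parallel to the sides. An internal node is a vertex of the mesh lying in $\Omega$; $n=n(h)$ is the number of internal nodes. Finite elements: $V_h$ is the space of continuous functions on $\overline\Omega$ that are affine on each triangle of $\mathcal{T}_h$ and vanish on $\partial\Omega$. For each internal node $i$, $\varphi_i\in V_h$ is the function equal to $1$ at node $i$ and $0$ at all other nodes. Matrices: for a coefficient function $a$, $$(\Theta_n(a))_{i,j}=\int_\Omega a\,\nabla\varphi_j\cdot\nabla\varphi_i ,\qquad A_n(a)=\Theta_n(a),\quad i,j=1,\dots,n,$$ and $A_n(1)$ is the case $a\equiv1$. Let $\mathrm{diag}(X)$ be the diagonal matrix with the same main diagonal as $X$. Define $$D_n(a)=\mathrm{diag}(A_n(a))\,\mathrm{diag}(A_n(1))^{-1},\qquad P_n(a)=D_n^{1/2}(a)\,A_n(1)\,D_n^{1/2}(a).$$ $C^2(\overline\Omega)$ denotes functions all of whose partial derivatives of order at most $2$ exist in $\Omega$ and extend continuously to $\overline\Omega$. *)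

theory Defs
  imports "HOL-Analysis.Analysis" "Jordan_Normal_Form.Spectral_Radius"
begin

text \<open>
  A regular hexagon in the plane is given by its vertices, listed cyclically; the
  listing is periodic, so that \<open>v (k + 1)\<close> is the neighbour of \<open>v k\<close> also for \<open>k = 5\<close>.
  Centre, orientation and side length are arbitrary.
\<close>

definition regular_hexagon :: "(nat \<Rightarrow> real^2) \<Rightarrow> bool" where
  "regular_hexagon v \<longleftrightarrow> (\<exists>c \<theta> L. L > 0 \<and>
     (\<forall>k. v k = c + L *\<^sub>R vector [cos (\<theta> + real k * pi / 3), sin (\<theta> + real k * pi / 3)]))"

definition hex_domain :: "(nat \<Rightarrow> real^2) \<Rightarrow> (real^2) set" where
  "hex_domain v = interior (convex hull (v ` {..<6}))"

text \<open>
  The mesh with parameter \<open>m\<close>: each side is divided into \<open>m\<close> equal parts (the end points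
  of a side count as division points), and all lines through division points parallel to
  sides are drawn. The mesh consists of the closed cells cut out of the hexagon by these
  lines.
\<close>

definition division_points :: "(nat \<Rightarrow> real^2) \<Rightarrow> nat \<Rightarrow> (real^2) set" where
  "division_points v m =
     {v k + (real j / real m) *\<^sub>R (v (k + 1) - v k) | k j. k < 6 \<and> j \<le> m}"

definition mesh_lines :: "(nat \<Rightarrow> real^2) \<Rightarrow> nat \<Rightarrow> (real^2) set set" where
  "mesh_lines v m =
     {range (\<lambda>t::real. q + t *\<^sub>R (v (k + 1) - v k)) | q k. q \<in> division_points v m \<and> k < 6}"

definition mesh :: "(nat \<Rightarrow> real^2) \<Rightarrow> nat \<Rightarrow> (real^2) set set" where
  "mesh v m = closure ` components (hex_domain v - \<Union>(mesh_lines v m))"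

definition mesh_nodes :: "(nat \<Rightarrow> real^2) \<Rightarrow> nat \<Rightarrow> (real^2) set" where
  "mesh_nodes v m = {x. \<exists>T \<in> mesh v m. x extreme_point_of T}"

definition internal_nodes :: "(nat \<Rightarrow> real^2) \<Rightarrow> nat \<Rightarrow> (real^2) set" where
  "internal_nodes v m = mesh_nodes v m \<inter> hex_domain v"

text \<open>
  A function on the closed hexagon is represented by its extension by zero to the whole
  plane, which makes the basis functions below unique as total functions.
\<close>

definition fe_space :: "(nat \<Rightarrow> real^2) \<Rightarrow> nat \<Rightarrow> (real^2 \<Rightarrow> real) set" where
  "fe_space v m = {f.
     continuous_on (closure (hex_domain v)) f \<and>
     (\<forall>T \<in> mesh v m. \<exists>b c. \<forall>x \<in> T. f x = inner b x + c) \<and>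
     (\<forall>x \<in> frontier (hex_domain v). f x = 0) \<and>
     (\<forall>x. x \<notin> closure (hex_domain v) \<longrightarrow> f x = 0)}"

definition hat :: "(nat \<Rightarrow> real^2) \<Rightarrow> nat \<Rightarrow> real^2 \<Rightarrow> (real^2 \<Rightarrow> real)" where
  "hat v m p = (THE f. f \<in> fe_space v m \<and> f p = 1 \<and> (\<forall>q \<in> mesh_nodes v m - {p}. f q = 0))"

definition has_partial_derivative ::
    "(real^2 \<Rightarrow> real) \<Rightarrow> 2 \<Rightarrow> real \<Rightarrow> real^2 \<Rightarrow> bool" where
  "has_partial_derivative f k d x \<longleftrightarrow>
     ((\<lambda>t. f (x + t *\<^sub>R axis k 1)) has_real_derivative d) (at 0)"

text \<open>
  \<open>G k\<close> and \<open>H j k\<close> are the continuous extensions to the closure of the first and second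
  partial derivatives; the derivatives themselves are required only on the open set \<open>S\<close>.
\<close>

definition C2_closure :: "(real^2) set \<Rightarrow> (real^2 \<Rightarrow> real) \<Rightarrow> bool" where
  "C2_closure S f \<longleftrightarrow> continuous_on (closure S) f \<and>
     (\<exists>(G :: 2 \<Rightarrow> real^2 \<Rightarrow> real) (H :: 2 \<Rightarrow> 2 \<Rightarrow> real^2 \<Rightarrow> real).
        (\<forall>k. continuous_on (closure S) (G k) \<and>
             (\<forall>x \<in> S. has_partial_derivative f k (G k x) x)) \<and>
        (\<forall>j k. continuous_on (closure S) (H j k) \<and>
               (\<forall>x \<in> S. has_partial_derivative (G k) j (H j k x) x)))"

text \<open>
  The value is unspecified where a partial derivative does not exist; for the basis
  functions this can only happen on the (negligible) union of the mesh lines.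
\<close>

definition grad :: "(real^2 \<Rightarrow> real) \<Rightarrow> real^2 \<Rightarrow> real^2" where
  "grad f x = (\<chi> k. SOME d. has_partial_derivative f k d x)"

text \<open>
  Below, \<open>\<nu>\<close> is an enumeration \<open>\<nu> 0, \<dots>, \<nu> (n - 1)\<close> of the internal nodes; matrix indices
  start at \<open>0\<close>.
\<close>

definition stiffness_matrix ::
    "(nat \<Rightarrow> real^2) \<Rightarrow> nat \<Rightarrow> (nat \<Rightarrow> real^2) \<Rightarrow> (real^2 \<Rightarrow> real) \<Rightarrow> real Matrix.mat" where
  "stiffness_matrix v m \<nu> a =
     (let n = card (internal_nodes v m) in
      Matrix.mat n n (\<lambda>(i, j).
        LINT x:hex_domain v|lebesgue.
          a x * inner (grad (hat v m (\<nu> j)) x) (grad (hat v m (\<nu> i)) x)))"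

definition diag_part :: "real Matrix.mat \<Rightarrow> real Matrix.mat" where
  "diag_part X = mat_diag (dim_row X) (\<lambda>i. X $$ (i, i))"

text \<open>The square root of a diagonal matrix with nonnegative diagonal.\<close>

definition diag_sqrt :: "real Matrix.mat \<Rightarrow> real Matrix.mat" where
  "diag_sqrt X = mat_diag (dim_row X) (\<lambda>i. sqrt (X $$ (i, i)))"

definition scaling_matrix ::
    "(nat \<Rightarrow> real^2) \<Rightarrow> nat \<Rightarrow> (nat \<Rightarrow> real^2) \<Rightarrow> (real^2 \<Rightarrow> real) \<Rightarrow> real Matrix.mat" where
  "scaling_matrix v m \<nu> a =
     diag_part (stiffness_matrix v m \<nu> a) *
     the (mat_inverse (diag_part (stiffness_matrix v m \<nu> (\<lambda>_. 1))))"

definition preconditioner ::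
    "(nat \<Rightarrow> real^2) \<Rightarrow> nat \<Rightarrow> (nat \<Rightarrow> real^2) \<Rightarrow> (real^2 \<Rightarrow> real) \<Rightarrow> real Matrix.mat" where
  "preconditioner v m \<nu> a =
     diag_sqrt (scaling_matrix v m \<nu> a) *
     stiffness_matrix v m \<nu> (\<lambda>_. 1) *
     diag_sqrt (scaling_matrix v m \<nu> a)"

definition sym_pos_def :: "nat \<Rightarrow> real Matrix.mat \<Rightarrow> bool" where
  "sym_pos_def n X \<longleftrightarrow> X \<in> carrier_mat n n \<and> transpose_mat X = X \<and>
     (\<forall>u \<in> carrier_vec n. u \<noteq> 0\<^sub>v n \<longrightarrow> scalar_prod u (X *\<^sub>v u) > 0)"

text \<open>
  The preconditioned matrix is not symmetric, so its eigenvalues are taken over the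
  complex numbers; that they are real is part of what is claimed about them.
\<close>

definition preconditioned_matrix ::
    "(nat \<Rightarrow> real^2) \<Rightarrow> nat \<Rightarrow> (nat \<Rightarrow> real^2) \<Rightarrow> (real^2 \<Rightarrow> real) \<Rightarrow> complex Matrix.mat" where
  "preconditioned_matrix v m \<nu> a =
     map_mat complex_of_real
       (the (mat_inverse (preconditioner v m \<nu> a)) * stiffness_matrix v m \<nu> a)"

text \<open>The number of eigenvalues outside \<open>S\<close>, counted with algebraic multiplicity.\<close>

definition eigenvalues_outside :: "complex Matrix.mat \<Rightarrow> complex set \<Rightarrow> nat" where
  "eigenvalues_outside X S = (\<Sum>z \<in> spectrum X - S. order z (char_poly X))"

end

theory Submission
  imports Defs
begin

text \<open>
  In lattice coordinates the basis functions are \<open>max 0 (1 - N (x - p))\<close> with \<open>N\<close> the norm whose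
  unit ball is the hexagon. Hence \<open>A\<^sub>n(a)\<close> is a weighted Laplacian on the triangular lattice: up to a
  common factor, its diagonal entries are six times the averages of \<open>a\<close> over the stars of the nodes,
  and its entries for an edge are minus the averages of \<open>a\<close> over the intersections of two stars.
  These intersections are centrally symmetric, so for \<open>C\<^sup>2\<close> coefficients each average equals the
  geometric mean of the two star averages up to \<open>O(h\<^sup>2)\<close>. Thus \<open>E = A\<^sub>n(a) - P\<^sub>n(a)\<close> has zero diagonal,
  at most six nonzero entries per row, and entries of relative size \<open>O(h\<^sup>2)\<close>.

  The quadratic supersolution \<open>m\<^sup>2 - \<bar>x\<bar>\<^sup>2\<close> bounds the smallest eigenvalue of \<open>A\<^sub>n(1)\<close> below by
  a multiple of \<open>m\<^sup>-\<^sup>2\<close>, which controls the Rayleigh quotients and gives (ii). For (i), the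
  supersolution \<open>ln (5 m\<^sup>2 / (\<bar>x - y\<bar>\<^sup>2 + 1))\<close> dominates the discrete Green function, so that the Frobenius
  norm of \<open>P\<^sub>n(a)\<^sup>-\<^sup>1\<close> is \<open>O(m\<^sup>2)\<close> and that of \<open>P\<^sub>n(a)\<^sup>-\<^sup>1 E\<close> is bounded. The sum of \<open>(\<lambda> - 1)\<^sup>2\<close> over the
  eigenvalues is the trace of \<open>(P\<^sub>n(a)\<^sup>-\<^sup>1 E)\<^sup>2\<close>, which is at most the squared Frobenius norm.
\<close>

section \<open>Eigenvalues of real matrix pencils\<close>

text \<open>The difficulty lies in the count (i). The bound on the smallest eigenvalue controls P^-1
  E only in operator norm; with about m^2 eigenvalues its Frobenius norm could then still grow like
  m. Dimension two helps: the Green function has only a logarithmic singularity, so each column of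
  P^-1 has square sum O(m^2), and the O(m^2) columns together give O(m^4) in place of the O(m^6)
  that the smallest eigenvalue alone would yield. This balances exactly the factor m^-2 in the
  entries of E. An upper bound on the Green function is enough for this, which is why a comparison
  principle with an explicit supersolution appears. The scaling by D has to reproduce A to second
  order: an error of first order in h would spoil the same balance. First-order terms cancel because
  an edge average, the midpoint value and the mean of the two end values agree up to O(h^2). The
  preconditioned matrix is not symmetric. Its eigenvalues are real because they are Rayleigh
  quotients of a symmetric pencil, and only therefore is the trace of the square a sum of
  nonnegative terms.\<close>

lemma sum_diag_mult_commute:
  fixes A B :: "'a::comm_semiring_0 Matrix.mat"
  assumes "A \<in> carrier_mat n n" "B \<in> carrier_mat n n"
  shows "(\<Sum>i<n. (A * B) $$ (i,i)) = (\<Sum>i<n. (B * A) $$ (i,i))"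
proof -
  have "(\<Sum>i<n. (A * B) $$ (i,i)) = (\<Sum>i<n. \<Sum>j<n. A $$ (i,j) * B $$ (j,i))"
    using assms by (auto simp: scalar_prod_def atLeast0LessThan intro!: sum.cong)
  also have "\<dots> = (\<Sum>j<n. \<Sum>i<n. B $$ (j,i) * A $$ (i,j))"
    by (subst sum.swap) (simp add: mult.commute)
  also have "\<dots> = (\<Sum>i<n. (B * A) $$ (i,i))"
    using assms by (auto simp: scalar_prod_def atLeast0LessThan intro!: sum.cong)
  finally show ?thesis .
qed

lemma upper_triangular_square_diag:
  fixes T :: "'a::comm_ring_1 Matrix.mat"
  assumes "T \<in> carrier_mat n n" "upper_triangular T" "i < n"
  shows "(T * T) $$ (i,i) = (T $$ (i,i))\<^sup>2"
proof -
  have "(T * T) $$ (i,i) = (\<Sum>j<n. T $$ (i,j) * T $$ (j,i))"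
    using assms by (auto simp: scalar_prod_def atLeast0LessThan intro!: sum.cong)
  also have "\<dots> = (\<Sum>j<n. if j = i then (T $$ (i,i))\<^sup>2 else 0)"
  proof (intro sum.cong refl)
    fix j assume "j \<in> {..<n}"
    then consider "j < i" | "j = i" | "i < j" "j < n" by force
    then show "T $$ (i,j) * T $$ (j,i) = (if j = i then (T $$ (i,i))\<^sup>2 else 0)"
      using assms by cases (auto simp: upper_triangular_def power2_eq_square)
  qed
  also have "\<dots> = (T $$ (i,i))\<^sup>2" using assms by simp
  finally show ?thesis .
qed

text \<open>\<open>X\<close> may fail to be diagonalisable, so the Schur form is used:
  \<open>X - 1\<^sub>m n\<close> is similar to a triangular matrix with diagonal entries
  \<open>e - 1\<close>, squaring a triangular matrix squares its diagonal, and the trace is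
  invariant under similarity.\<close>

lemma sum_roots_shift_square:
  fixes X :: "complex Matrix.mat"
  assumes X: "X \<in> carrier_mat n n" and cp: "char_poly X = (\<Prod>e\<leftarrow>es. [:- e, 1:])"
  shows "(\<Sum>e\<leftarrow>es. (e - 1)\<^sup>2) = (\<Sum>i<n. ((X - 1\<^sub>m n) * (X - 1\<^sub>m n)) $$ (i,i))"
proof -
  obtain B P Q where dec: "schur_decomposition X es = (B, P, Q)"
    by (cases "schur_decomposition X es")
  from schur_decomposition[OF X cp dec]
  have sim: "similar_mat_wit X B P Q" and ut: "upper_triangular B" and diag: "diag_mat B = es"
    by auto
  from similar_mat_witD2[OF X sim] have PQ: "P * Q = 1\<^sub>m n" "Q * P = 1\<^sub>m n" "X = P * B * Q"
    and car: "B \<in> carrier_mat n n" "P \<in> carrier_mat n n" "Q \<in> carrier_mat n n" by auto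
  define T where "T = B - 1\<^sub>m n"
  have T: "T \<in> carrier_mat n n" using car by (auto simp: T_def)
  have utT: "upper_triangular T" using ut car by (auto simp: T_def upper_triangular_def)
  have Y: "X - 1\<^sub>m n = P * T * Q"
    using car PQ
    by (simp add: T_def mult_minus_distrib_mat[of _ n n] minus_mult_distrib_mat[of _ n n])
  have "P * T * Q * (P * T * Q) = P * (T * (Q * P) * T * Q)"
    using car T by (simp add: assoc_mult_mat[of _ n n _ n _ n])
  also have "\<dots> = P * (T * T * Q)" using car T PQ by simp
  finally have YY: "(X - 1\<^sub>m n) * (X - 1\<^sub>m n) = P * (T * T * Q)" using Y by simp
  have "(\<Sum>i<n. ((X - 1\<^sub>m n) * (X - 1\<^sub>m n)) $$ (i,i)) = (\<Sum>i<n. (T * T * Q * P) $$ (i,i))"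
    unfolding YY by (rule sum_diag_mult_commute) (use car T in auto)
  also have "T * T * Q * P = T * T"
    using car T PQ by (simp add: assoc_mult_mat[of _ n n _ n _ n])
  also have "(\<Sum>i<n. (T * T) $$ (i,i)) = (\<Sum>i<n. (B $$ (i,i) - 1)\<^sup>2)"
  proof (intro sum.cong refl)
    fix i assume "i \<in> {..<n}"
    then show "(T * T) $$ (i,i) = (B $$ (i,i) - 1)\<^sup>2"
      using car by (subst upper_triangular_square_diag[OF T utT]) (auto simp: T_def)
  qed
  also have "\<dots> = (\<Sum>e\<leftarrow>es. (e - 1)\<^sup>2)"
    using car unfolding diag[symmetric]
    by (auto simp: diag_mat_def interv_sum_list_conv_sum_set_nat comp_def atLeast0LessThan)
  finally show ?thesis ..
qed

text \<open>Translates algebraic multiplicity into occurrences in a list of roots, so that sums over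
  the spectrum weighted by \<open>order\<close> become sums over the list.\<close>

lemma order_prod_linear_factors:
  "order z (\<Prod>e\<leftarrow>es. [:- e, 1:]) = count_list es (z::complex)"
proof (induction es)
  case (Cons e es)
  have "(\<Prod>e\<leftarrow>es. [:- e, 1:]) \<noteq> (0 :: complex poly)" by (auto simp: prod_list_zero_iff)
  then have nz: "[:- e, 1:] * (\<Prod>e\<leftarrow>es. [:- e, 1:]) \<noteq> 0" by (intro no_zero_divisors) auto
  have "order z ([:- e, 1:] * (\<Prod>e\<leftarrow>es. [:- e, 1:])) = order z [:- e, 1:] + count_list es z"
    unfolding order_mult[OF nz] Cons.IH ..
  moreover have "order z [:- e, 1:] = (if e = z then 1 else 0)"
    by (metis order_linear' minus_minus)
  ultimately show ?case by (simp del: mult_pCons_left)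
qed (simp add: order_1_eq_0)

text \<open>A Chebyshev count: every eigenvalue outside the interval contributes at least
  \<epsilon>^2 to the sum of the squares of e - 1, and that sum is the trace of the square of
  \<open>X - 1\<^sub>m n\<close>. Realness of the spectrum is essential here, since the squares of
  non-real numbers could cancel.\<close>

lemma eigenvalues_outside_le:
  fixes X :: "complex Matrix.mat" and M :: "nat \<Rightarrow> nat \<Rightarrow> real"
  assumes X: "X \<in> carrier_mat n n"
    and real: "spectrum X \<subseteq> \<real>"
    and M: "\<And>i j. i < n \<Longrightarrow> j < n \<Longrightarrow> (X - 1\<^sub>m n) $$ (i,j) = complex_of_real (M i j)"
    and "\<epsilon> > 0"
  shows "real (eigenvalues_outside X (complex_of_real ` {1 - \<epsilon><..<1 + \<epsilon>})) * \<epsilon>\<^sup>2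
           \<le> (\<Sum>i<n. \<Sum>j<n. (M i j)\<^sup>2)"
proof -
  define S where "S = complex_of_real ` {1 - \<epsilon><..<1 + \<epsilon>}"
  from char_poly_factorized[OF X] obtain es
    where cp: "char_poly X = (\<Prod>e\<leftarrow>es. [:- e, 1:])" by blast
  have spec: "spectrum X = set es"
    using eigenvalue_root_char_poly[OF X] unfolding spectrum_def cp
    by (auto simp: poly_prod_list prod_list_zero_iff)
  have "real (eigenvalues_outside X S) * \<epsilon>\<^sup>2 = (\<Sum>z\<in>set es - S. real (count_list es z) * \<epsilon>\<^sup>2)"
    by (simp add: eigenvalues_outside_def spec cp order_prod_linear_factors sum_distrib_right)
  also have "\<dots> \<le> (\<Sum>z\<in>set es - S. real (count_list es z) * (Re z - 1)\<^sup>2)"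
  proof (intro sum_mono mult_left_mono)
    fix z assume z: "z \<in> set es - S"
    then have "z \<in> \<real>" using real spec by auto
    then have "z = complex_of_real (Re z)" by (simp add: complex_is_Real_iff complex_eq_iff)
    with z have "Re z \<notin> {1 - \<epsilon><..<1 + \<epsilon>}" unfolding S_def by (metis DiffD2 imageI)
    then have "\<epsilon> \<le> \<bar>Re z - 1\<bar>" by auto
    then show "\<epsilon>\<^sup>2 \<le> (Re z - 1)\<^sup>2" using \<open>\<epsilon> > 0\<close> by (metis abs_le_square_iff abs_of_pos)
  qed simp
  also have "\<dots> \<le> (\<Sum>z\<in>set es. real (count_list es z) * (Re z - 1)\<^sup>2)"
    by (intro sum_mono2) auto
  also have "\<dots> = (\<Sum>e\<leftarrow>es. (Re e - 1)\<^sup>2)"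
  proof (induction es)
    case (Cons e es)
    have "(\<Sum>z\<in>set (e # es). real (count_list (e # es) z) * (Re z - 1)\<^sup>2)
        = (\<Sum>z\<in>insert e (set es). real (count_list es z) * (Re z - 1)\<^sup>2
             + (if z = e then (Re z - 1)\<^sup>2 else 0))"
      by (intro sum.cong) (auto simp: algebra_simps)
    also have "\<dots> = (\<Sum>z\<in>insert e (set es). real (count_list es z) * (Re z - 1)\<^sup>2) + (Re e - 1)\<^sup>2"
      by (simp add: sum.distrib)
    also have "(\<Sum>z\<in>insert e (set es). real (count_list es z) * (Re z - 1)\<^sup>2)
        = (\<Sum>z\<in>set es. real (count_list es z) * (Re z - 1)\<^sup>2)"
      by (rule sum.mono_neutral_right) (auto simp: count_list_0_iff)
    finally show ?case using Cons by simp
  qed simp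
  also have "\<dots> = Re (\<Sum>e\<leftarrow>es. (e - 1)\<^sup>2)"
  proof -
    have "set es \<subseteq> \<real>" using real spec by simp
    then show ?thesis by (induction es) (auto simp: power2_eq_square complex_is_Real_iff)
  qed
  also have "\<dots> = (\<Sum>i<n. \<Sum>j<n. M i j * M j i)"
  proof -
    have "((X - 1\<^sub>m n) * (X - 1\<^sub>m n)) $$ (i,i) = complex_of_real (\<Sum>j<n. M i j * M j i)"
      if "i < n" for i
    proof -
      have "((X - 1\<^sub>m n) * (X - 1\<^sub>m n)) $$ (i,i)
          = (\<Sum>j<n. (X - 1\<^sub>m n) $$ (i,j) * (X - 1\<^sub>m n) $$ (j,i))"
        using X that
        by (auto simp: scalar_prod_def atLeast0LessThan simp del: index_minus_mat(1) intro!: sum.cong)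
      also have "\<dots> = (\<Sum>j<n. complex_of_real (M i j) * complex_of_real (M j i))"
        using that by (intro sum.cong refl) (simp add: M del: index_minus_mat(1))
      finally show ?thesis by simp
    qed
    then show ?thesis unfolding sum_roots_shift_square[OF X cp] by simp
  qed
  \<comment> \<open>The trace of a square pairs each entry with its transpose; the
    arithmetic-geometric inequality bounds it by the squared Frobenius norm although
    \<open>M\<close> is not symmetric.\<close>
  also have "\<dots> \<le> (\<Sum>i<n. \<Sum>j<n. ((M i j)\<^sup>2 + (M j i)\<^sup>2) / 2)"
  proof (intro sum_mono)
    fix i j
    have "0 \<le> (M i j - M j i)\<^sup>2" by simp
    then show "M i j * M j i \<le> ((M i j)\<^sup>2 + (M j i)\<^sup>2) / 2" by (simp add: power2_diff)
  qed
  also have "\<dots> = ((\<Sum>i<n. \<Sum>j<n. (M i j)\<^sup>2) + (\<Sum>i<n. \<Sum>j<n. (M j i)\<^sup>2)) / 2"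
    by (simp add: sum.distrib sum_divide_distrib add_divide_distrib)
  also have "(\<Sum>i<n. \<Sum>j<n. (M j i)\<^sup>2) = (\<Sum>i<n. \<Sum>j<n. (M i j)\<^sup>2)"
    by (rule sum.swap)
  finally show ?thesis by (simp add: S_def)
qed

lemma quadratic_form_sum:
  fixes K :: "real Matrix.mat"
  assumes "K \<in> carrier_mat n n" "u \<in> carrier_vec n"
  shows "scalar_prod u (K *\<^sub>v u) = (\<Sum>i<n. \<Sum>j<n. K $$ (i,j) * (vec_index u i * vec_index u j))"
  using assms
  by (auto simp: scalar_prod_def atLeast0LessThan sum_distrib_left ac_simps intro!: sum.cong)

lemma sym_pos_def_imp_inverse:
  assumes "sym_pos_def n P"
  obtains H where "mat_inverse P = Some H" "H \<in> carrier_mat n n" "H * P = 1\<^sub>m n" "P * H = 1\<^sub>m n"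
proof -
  have P: "P \<in> carrier_mat n n" using assms by (simp add: sym_pos_def_def)
  have "det P \<noteq> 0"
  proof
    assume "det P = 0"
    then obtain u where u: "u \<in> carrier_vec n" "u \<noteq> 0\<^sub>v n" "P *\<^sub>v u = 0\<^sub>v n"
      using det_0_iff_vec_prod_zero[OF P] by blast
    then have "scalar_prod u (P *\<^sub>v u) > 0" using assms unfolding sym_pos_def_def by blast
    then show False using u by simp
  qed
  then have "P \<in> Units (ring_mat TYPE(real) n n)" by (rule det_non_zero_imp_unit[OF P])
  then obtain H where "mat_inverse P = Some H"
    using mat_inverse(1)[OF P, where b = n] by (cases "mat_inverse P") auto
  then show thesis using mat_inverse(2)[OF P] that by blast
qed

text \<open>The products of real with imaginary parts of \<open>u\<close> enter only the imaginary
  part of the sum, where they cancel by the symmetry of \<open>K\<close>. Thus bounds on real forms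
  apply to complex eigenvectors.\<close>

lemma scalar_prod_of_real_conj:
  fixes K :: "real Matrix.mat" and u :: "complex Matrix.vec"
  assumes K: "K \<in> carrier_mat n n" "transpose_mat K = K" and u: "u \<in> carrier_vec n"
  shows "(\<Sum>i<n. cnj (vec_index u i) * vec_index (map_mat complex_of_real K *\<^sub>v u) i)
     = complex_of_real (scalar_prod (map_vec Re u) (K *\<^sub>v map_vec Re u)
                      + scalar_prod (map_vec Im u) (K *\<^sub>v map_vec Im u))"
proof -
  have sym: "K $$ (i,j) = K $$ (j,i)" if "i < n" "j < n" for i j
    using K that by (metis carrier_matD index_transpose_mat(1))
  have "(\<Sum>i<n. cnj (vec_index u i) * vec_index (map_mat complex_of_real K *\<^sub>v u) i)
      = (\<Sum>i<n. \<Sum>j<n. complex_of_real (K $$ (i,j)) * (cnj (vec_index u i) * vec_index u j))"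
    using K u by (auto simp: scalar_prod_def atLeast0LessThan sum_distrib_left ac_simps intro!: sum.cong)
  also have "\<dots> = complex_of_real (\<Sum>i<n. \<Sum>j<n. K $$ (i,j)
      * (Re (vec_index u i) * Re (vec_index u j) + Im (vec_index u i) * Im (vec_index u j)))"
    (is "?l = complex_of_real ?r")
  proof (rule complex_eqI)
    have "Im ?l = (\<Sum>i<n. \<Sum>j<n. K $$ (i,j) * (Re (vec_index u i) * Im (vec_index u j)))
        - (\<Sum>i<n. \<Sum>j<n. K $$ (i,j) * (Im (vec_index u i) * Re (vec_index u j)))"
      by (simp add: sum_subtractf[symmetric] algebra_simps)
    also have "(\<Sum>i<n. \<Sum>j<n. K $$ (i,j) * (Im (vec_index u i) * Re (vec_index u j)))
        = (\<Sum>i<n. \<Sum>j<n. K $$ (i,j) * (Re (vec_index u i) * Im (vec_index u j)))"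
      by (subst sum.swap) (auto simp: sym mult.commute intro!: sum.cong)
    finally show "Im ?l = Im (complex_of_real ?r)" by simp
  qed (simp add: algebra_simps)
  also have "?r = scalar_prod (map_vec Re u) (K *\<^sub>v map_vec Re u)
                + scalar_prod (map_vec Im u) (K *\<^sub>v map_vec Im u)"
    using K u by (simp add: quadratic_form_sum[of _ n] sum.distrib distrib_left)
  finally show ?thesis .
qed

text \<open>An eigenvector of \<open>H * A\<close> satisfies A u = z P u. Pairing with the conjugate
  of \<open>u\<close> makes both sides real quadratic forms, so \<open>z\<close> is a quotient of
  two real numbers confined by the form bounds: realness and location come out together.\<close>

lemma spectrum_generalized_Rayleigh:
  fixes A P H :: "real Matrix.mat"
  assumes A: "A \<in> carrier_mat n n" "transpose_mat A = A" and P: "sym_pos_def n P"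
    and H: "H \<in> carrier_mat n n" "P * H = 1\<^sub>m n"
    and lower: "\<And>u. u \<in> carrier_vec n \<Longrightarrow> d * scalar_prod u (P *\<^sub>v u) \<le> scalar_prod u (A *\<^sub>v u)"
    and upper: "\<And>u. u \<in> carrier_vec n \<Longrightarrow> scalar_prod u (A *\<^sub>v u) \<le> D * scalar_prod u (P *\<^sub>v u)"
  shows "spectrum (map_mat complex_of_real (H * A)) \<subseteq> complex_of_real ` {d..D}"
proof
  fix z assume "z \<in> spectrum (map_mat complex_of_real (H * A))"
  moreover have dim: "dim_row (map_mat complex_of_real (H * A)) = n" using H by simp
  ultimately obtain u where u: "u \<in> carrier_vec n" "u \<noteq> 0\<^sub>v n"
    and ev: "map_mat complex_of_real (H * A) *\<^sub>v u = z \<cdot>\<^sub>v u"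
    unfolding spectrum_def eigenvalue_def eigenvector_def mem_Collect_eq dim by blast
  have Pc: "P \<in> carrier_mat n n" and Pt: "transpose_mat P = P"
    and Ppos: "\<And>u. u \<in> carrier_vec n \<Longrightarrow> u \<noteq> 0\<^sub>v n \<Longrightarrow> scalar_prod u (P *\<^sub>v u) > 0"
    using P by (auto simp: sym_pos_def_def)
  let ?c = "map_mat complex_of_real"
  have HA: "H * A \<in> carrier_mat n n" using H A by simp
  have "P * (H * A) = A"
    using assoc_mult_mat[OF Pc H(1) A(1)] H(2) left_mult_one_mat[OF A(1)] by simp
  then have "?c A = ?c P * ?c (H * A)"
    using of_real_hom.mat_hom_mult[OF Pc HA] by simp
  then have "?c A *\<^sub>v u = ?c P *\<^sub>v (?c (H * A) *\<^sub>v u)"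
    using assoc_mult_mat_vec[of "?c P" n n "?c (H * A)" n u] Pc HA u by simp
  also have "\<dots> = z \<cdot>\<^sub>v (?c P *\<^sub>v u)" unfolding ev using Pc u by (intro mult_mat_vec) auto
  finally have eq: "?c A *\<^sub>v u = z \<cdot>\<^sub>v (?c P *\<^sub>v u)" .
  define q where "q K = scalar_prod (map_vec Re u) (K *\<^sub>v map_vec Re u)
                      + scalar_prod (map_vec Im u) (K *\<^sub>v map_vec Im u)" for K :: "real Matrix.mat"
  have "complex_of_real (q A) = (\<Sum>i<n. cnj (vec_index u i) * vec_index (?c A *\<^sub>v u) i)"
    unfolding q_def by (rule scalar_prod_of_real_conj[symmetric]) (use A u in auto)
  also have "\<dots> = z * (\<Sum>i<n. cnj (vec_index u i) * vec_index (?c P *\<^sub>v u) i)"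
    unfolding eq sum_distrib_left using Pc by (intro sum.cong refl) (auto simp: ac_simps)
  also have "\<dots> = z * complex_of_real (q P)"
    unfolding q_def by (subst scalar_prod_of_real_conj) (use Pc Pt u in auto)
  finally have zq: "complex_of_real (q A) = z * complex_of_real (q P)" .
  have "map_vec Re u \<noteq> 0\<^sub>v n \<or> map_vec Im u \<noteq> 0\<^sub>v n"
  proof (rule ccontr)
    assume "\<not> ?thesis"
    then have "vec_index (map_vec Re u) i = 0" "vec_index (map_vec Im u) i = 0" if "i < n" for i
      using that by auto
    then have "u = 0\<^sub>v n" using u(1) by (intro eq_vecI) (auto simp: complex_eq_iff)
    then show False using u by simp
  qed
  moreover have "0 \<le> scalar_prod w (P *\<^sub>v w)" if "w \<in> carrier_vec n" for w
    using Ppos[OF that] Pc by (cases "w = 0\<^sub>v n") (auto simp: less_imp_le)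
  moreover have c: "map_vec Re u \<in> carrier_vec n" "map_vec Im u \<in> carrier_vec n" using u by auto
  ultimately have qP: "q P > 0"
    unfolding q_def using Ppos by (metis add_nonneg_pos add_pos_nonneg)
  from zq qP have z: "z = complex_of_real (q A / q P)" by (simp add: field_simps)
  have "d * q P \<le> q A" "q A \<le> D * q P"
    using lower[OF c(1)] lower[OF c(2)] upper[OF c(1)] upper[OF c(2)]
    by (simp_all add: q_def distrib_left)
  then have "q A / q P \<in> {d..D}" using qP by (simp add: field_simps)
  with z show "z \<in> complex_of_real ` {d..D}" by blast
qed

section \<open>The discrete Laplacian on the hexagonal lattice\<close>

text \<open>The supersolution \<open>w\<close> acts like a ground state: \<open>u x * u y\<close> is
  at most the mean of the two squares weighted by \<open>w y / w x\<close> and its reciprocal.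
  Multiplication by the nonpositive off-diagonal entries reverses this inequality, and after
  symmetrisation the squares collect into the row sums of \<open>K\<close> against
  \<open>w\<close>.\<close>

lemma Z_matrix_form_lower_bound:
  fixes K :: "'i \<Rightarrow> 'i \<Rightarrow> real"
  assumes sym: "\<And>x y. x \<in> I \<Longrightarrow> y \<in> I \<Longrightarrow> K x y = K y x"
    and off: "\<And>x y. x \<in> I \<Longrightarrow> y \<in> I \<Longrightarrow> x \<noteq> y \<Longrightarrow> K x y \<le> 0"
    and w: "\<And>x. x \<in> I \<Longrightarrow> w x > 0" "\<And>x. x \<in> I \<Longrightarrow> (\<Sum>y\<in>I. K x y * w y) \<ge> c * w x"
  shows "c * (\<Sum>x\<in>I. (u x)\<^sup>2) \<le> (\<Sum>x\<in>I. \<Sum>y\<in>I. K x y * (u x * u y))"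
proof -
  have "c * (\<Sum>x\<in>I. (u x)\<^sup>2) = (\<Sum>x\<in>I. (u x)\<^sup>2 / w x * (c * w x))"
    using w(1) by (simp add: sum_distrib_left less_imp_neq[symmetric] ac_simps)
  also have "\<dots> \<le> (\<Sum>x\<in>I. (u x)\<^sup>2 / w x * (\<Sum>y\<in>I. K x y * w y))"
    using w by (intro sum_mono mult_left_mono) (auto simp: less_imp_le)
  also have "\<dots> = (\<Sum>x\<in>I. \<Sum>y\<in>I. K x y * ((u x)\<^sup>2 * w y / w x))"
    by (simp add: sum_distrib_left sum_divide_distrib ac_simps)
  also have "\<dots> = ((\<Sum>x\<in>I. \<Sum>y\<in>I. K x y * ((u x)\<^sup>2 * w y / w x))
                + (\<Sum>x\<in>I. \<Sum>y\<in>I. K y x * ((u y)\<^sup>2 * w x / w y))) / 2"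
    by (subst (3) sum.swap) simp
  also have "\<dots> = (\<Sum>x\<in>I. \<Sum>y\<in>I. K x y * (((u x)\<^sup>2 * w y / w x + (u y)\<^sup>2 * w x / w y) / 2))"
    unfolding sum.distrib[symmetric] sum_divide_distrib
    by (intro sum.cong refl) (simp add: sym algebra_simps add_divide_distrib)
  also have "\<dots> \<le> (\<Sum>x\<in>I. \<Sum>y\<in>I. K x y * (u x * u y))"
  proof (intro sum_mono)
    fix x y assume xy: "x \<in> I" "y \<in> I"
    show "K x y * (((u x)\<^sup>2 * w y / w x + (u y)\<^sup>2 * w x / w y) / 2) \<le> K x y * (u x * u y)"
    proof (cases "x = y")
      case True
      then show ?thesis using w(1)[OF xy(1)] by (simp add: power2_eq_square)
    next
      case False
      have pos: "w x > 0" "w y > 0" using w(1) xy by auto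
      have "0 \<le> (u x * w y - u y * w x)\<^sup>2 / (w x * w y)" using pos by simp
      also have "\<dots> = (u x)\<^sup>2 * w y / w x + (u y)\<^sup>2 * w x / w y - 2 * (u x * u y)"
        using pos by (simp add: field_simps power2_eq_square)
      finally have "u x * u y \<le> ((u x)\<^sup>2 * w y / w x + (u y)\<^sup>2 * w x / w y) / 2" by simp
      then show ?thesis using off[OF xy False] by (rule mult_left_mono_neg)
    qed
  qed
  finally show ?thesis .
qed

text \<open>A discrete maximum principle. Testing against the negative part of \<open>u\<close>, the
  mixed terms have a sign because off-diagonal entries are nonpositive and the two parts have
  disjoint supports. The form at the negative part is then at most zero, and coercivity makes that
  part vanish.\<close>

lemma Z_matrix_comparison:
  fixes K :: "'i \<Rightarrow> 'i \<Rightarrow> real"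
  assumes fin: "finite I"
    and off: "\<And>x y. x \<in> I \<Longrightarrow> y \<in> I \<Longrightarrow> x \<noteq> y \<Longrightarrow> K x y \<le> 0"
    and form: "\<And>u. c * (\<Sum>x\<in>I. (u x)\<^sup>2) \<le> (\<Sum>x\<in>I. \<Sum>y\<in>I. K x y * (u x * u y))" and "c > 0"
    and u: "\<And>x. x \<in> I \<Longrightarrow> (\<Sum>y\<in>I. K x y * u y) \<ge> 0"
    and x: "x \<in> I"
  shows "u x \<ge> 0"
proof -
  define n where "n x = max 0 (- u x)" for x
  define p where "p x = max 0 (u x)" for x
 have up: "u x = p x - n x" "p x * n x = 0" "p x \<ge> 0" "n x \<ge> 0" for x
    by (auto simp: n_def p_def)
  have "0 \<le> (\<Sum>x\<in>I. n x * (\<Sum>y\<in>I. K x y * u y))"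
    by (intro sum_nonneg mult_nonneg_nonneg u up(4))
  also have "\<dots> = (\<Sum>x\<in>I. \<Sum>y\<in>I. K x y * (n x * p y)) - (\<Sum>x\<in>I. \<Sum>y\<in>I. K x y * (n x * n y))"
    unfolding sum_subtractf[symmetric] sum_distrib_left up(1)
    by (intro sum.cong refl) (simp add: algebra_simps)
  finally have "(\<Sum>x\<in>I. \<Sum>y\<in>I. K x y * (n x * n y)) \<le> (\<Sum>x\<in>I. \<Sum>y\<in>I. K x y * (n x * p y))"
    by simp
  also have "\<dots> \<le> 0"
  proof (intro sum_nonpos)
    fix x y assume "x \<in> I" "y \<in> I"
    moreover have "n x * p y \<ge> 0" "n x * p x = 0" using up(2-4) by (auto simp: mult.commute)
    ultimately show "K x y * (n x * p y) \<le> 0"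
      using off[of x y] by (cases "x = y") (auto intro: mult_nonpos_nonneg)
  qed
  finally have "c * (\<Sum>x\<in>I. (n x)\<^sup>2) \<le> 0" using form[of n] by linarith
  then have "(\<Sum>x\<in>I. (n x)\<^sup>2) \<le> 0" using \<open>c > 0\<close> by (simp add: mult_le_0_iff)
  then have "(\<Sum>x\<in>I. (n x)\<^sup>2) = 0" by (simp add: order_antisym sum_nonneg)
  then have "n x = 0" using fin x by (simp add: sum_nonneg_eq_0_iff)
  then show ?thesis by (simp add: n_def)
qed

section \<open>Lattice norms, neighbours and the Laplacian with zero boundary values\<close>

definition hexnorm :: "int \<times> int \<Rightarrow> int" where
  "hexnorm x = max \<bar>fst x\<bar> (max \<bar>snd x\<bar> \<bar>fst x + snd x\<bar>)"

definition hex_lattice :: "nat \<Rightarrow> (int \<times> int) set" where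
  "hex_lattice m = {x. hexnorm x < int m}"

definition hex_nbrs :: "(int \<times> int) set" where
  "hex_nbrs = {(1,0), (0,1), (-1,1), (-1,0), (0,-1), (1,-1)}"

text \<open>The squared Euclidean length in units of the mesh width: the two lattice directions
  enclose 60 degrees, so the mixed term has the coefficient 2 cos 60 = 1.\<close>

definition hexsq :: "int \<times> int \<Rightarrow> int" where
  "hexsq x = (fst x)\<^sup>2 + fst x * snd x + (snd x)\<^sup>2"

text \<open>Given on the whole lattice; summing only over \<open>hex_lattice m\<close> imposes zero
  boundary values.\<close>

definition hex_laplacian :: "int \<times> int \<Rightarrow> int \<times> int \<Rightarrow> real" where
  "hex_laplacian x y = (if x = y then 6 else if y - x \<in> hex_nbrs then -1 else 0)"

lemma hex_nbrs_uminus: "- d \<in> hex_nbrs \<longleftrightarrow> d \<in> hex_nbrs"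
  by (cases d) (auto simp: hex_nbrs_def)

lemma zero_notin_hex_nbrs: "0 \<notin> hex_nbrs"
  by (auto simp: hex_nbrs_def zero_prod_def)

lemma finite_hex_nbrs: "finite hex_nbrs" and card_hex_nbrs: "card hex_nbrs = 6"
  by (simp_all add: hex_nbrs_def)

lemma hexnorm_eq_1_iff: "hexnorm d = 1 \<longleftrightarrow> d \<in> hex_nbrs"
proof
  assume "hexnorm d = 1"
  then have "fst d \<in> {-1,0,1}" "snd d \<in> {-1,0,1}" by (auto simp: hexnorm_def max_def split: if_splits)
  then show "d \<in> hex_nbrs"
    using \<open>hexnorm d = 1\<close> by (cases d) (auto simp: hexnorm_def hex_nbrs_def)
qed (auto simp: hex_nbrs_def hexnorm_def)

lemma hexnorm_eq_0_iff: "hexnorm d = 0 \<longleftrightarrow> d = 0"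
  by (cases d) (auto simp: hexnorm_def zero_prod_def)

lemma hexnorm_nonneg: "hexnorm d \<ge> 0"
  by (auto simp: hexnorm_def)

lemma hexnorm_le_iff: "hexnorm x \<le> n \<longleftrightarrow> \<bar>fst x\<bar> \<le> n \<and> \<bar>snd x\<bar> \<le> n \<and> \<bar>fst x + snd x\<bar> \<le> n"
  by (auto simp: hexnorm_def)

lemma hexnorm_triangle: "hexnorm (x + y) \<le> hexnorm x + hexnorm y"
proof -
  have "\<bar>fst x\<bar> \<le> hexnorm x" "\<bar>snd x\<bar> \<le> hexnorm x" "\<bar>fst x + snd x\<bar> \<le> hexnorm x"
    "\<bar>fst y\<bar> \<le> hexnorm y" "\<bar>snd y\<bar> \<le> hexnorm y" "\<bar>fst y + snd y\<bar> \<le> hexnorm y"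
    using hexnorm_le_iff by blast+
  then show ?thesis unfolding hexnorm_le_iff fst_add snd_add by linarith
qed

lemma hexnorm_uminus: "hexnorm (- x) = hexnorm x"
proof -
  have "\<bar>- fst x + - snd x\<bar> = \<bar>fst x + snd x\<bar>" by linarith
  then show ?thesis by (simp only: hexnorm_def fst_uminus snd_uminus abs_minus_cancel)
qed

lemma hexnorm_nbr: "d \<in> hex_nbrs \<Longrightarrow> hexnorm (x + d) \<le> hexnorm x + 1"
  using hexnorm_triangle[of x d] by (simp add: hexnorm_eq_1_iff[symmetric])

lemma hex_lattice_subset: "hex_lattice m \<subseteq> {- int m..int m} \<times> {- int m..int m}"
  by (auto simp: hex_lattice_def hexnorm_def)

lemma finite_hex_lattice: "finite (hex_lattice m)"
  by (rule finite_subset[OF hex_lattice_subset]) auto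

lemma card_hex_lattice_le: "m \<ge> 1 \<Longrightarrow> real (card (hex_lattice m)) \<le> 9 * (real m)\<^sup>2"
proof -
  assume m: "m \<ge> 1"
  have "card (hex_lattice m) \<le> card ({- int m..int m} \<times> {- int m..int m})"
    by (rule card_mono[OF _ hex_lattice_subset]) auto
  also have "\<dots> = (2 * m + 1)\<^sup>2" 
  proof -
    have "nat (2 * int m + 1) = 2 * m + 1" by linarith
    then show ?thesis by (simp add: card_cartesian_product power2_eq_square)
  qed
  also have "\<dots> \<le> (3 * m)\<^sup>2" using m by (intro power_mono) auto
  finally have "real (card (hex_lattice m)) \<le> real ((3 * m)\<^sup>2)" by linarith
  then show ?thesis by (simp add: power_mult_distrib)
qed

lemma hexsq_nonneg: "hexsq x \<ge> 0"
proof -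
  have "4 * hexsq x = (2 * fst x + snd x)\<^sup>2 + 3 * (snd x)\<^sup>2"
    by (simp add: hexsq_def power2_eq_square algebra_simps)
  then show ?thesis by (smt (verit) zero_le_power2)
qed

text \<open>The hexagon lies in its circumscribed disc. Algebraically, \<open>hexsq\<close> equals
  (p + q)^2 - p q, q^2 + p (p + q) and p^2 + q (p + q), and one of these three products has the
  favourable sign.\<close>

lemma hexsq_le_hexnorm: "hexsq x \<le> (hexnorm x)\<^sup>2"
proof -
  obtain p q where x: "x = (p,q)" by (cases x)
  have n: "\<bar>p\<bar> \<le> hexnorm x" "\<bar>q\<bar> \<le> hexnorm x" "\<bar>p + q\<bar> \<le> hexnorm x"
    by (auto simp: hexnorm_def x)
  then have sq: "p\<^sup>2 \<le> (hexnorm x)\<^sup>2" "q\<^sup>2 \<le> (hexnorm x)\<^sup>2" "(p + q)\<^sup>2 \<le> (hexnorm x)\<^sup>2"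
    by (metis abs_le_square_iff abs_ge_zero order_trans abs_of_nonneg)+
  have "p * q \<ge> 0 \<or> p * (p + q) \<le> 0 \<or> q * (p + q) \<le> 0"
    by (smt (verit) mult_nonneg_nonneg mult_nonpos_nonpos mult_nonneg_nonpos mult_nonpos_nonneg)
  then show ?thesis
    using sq unfolding x hexsq_def by (auto simp: power2_eq_square algebra_simps)
qed

text \<open>Neighbours outside the hexagon are absent on the left and only lower the right-hand
  side. Supersolutions can therefore be checked with the Laplacian of the whole lattice, without
  cases at the boundary.\<close>

lemma hex_laplacian_ge:
  assumes x: "x \<in> hex_lattice m" and w: "\<And>d. d \<in> hex_nbrs \<Longrightarrow> w (x + d) \<ge> 0"
  shows "(\<Sum>y\<in>hex_lattice m. hex_laplacian x y * w y) \<ge> 6 * w x - (\<Sum>d\<in>hex_nbrs. w (x + d))"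
proof -
  let ?I = "hex_lattice m" and ?N = "(\<lambda>d. x + d) ` hex_nbrs"
  have xN: "x \<notin> ?N" using zero_notin_hex_nbrs by auto
  have "(\<Sum>y\<in>?I. hex_laplacian x y * w y)
      = (\<Sum>y\<in>?I. (if y = x then 6 * w x else 0) - (if y \<in> ?N then w y else 0))"
  proof (intro sum.cong refl)
    fix y
    have "y \<in> ?N \<longleftrightarrow> y - x \<in> hex_nbrs" by force
    then show "hex_laplacian x y * w y = (if y = x then 6 * w x else 0) - (if y \<in> ?N then w y else 0)"
      using zero_notin_hex_nbrs by (auto simp: hex_laplacian_def)
  qed
  also have "\<dots> = 6 * w x - (\<Sum>y\<in>?I \<inter> ?N. w y)"
    using x finite_hex_lattice by (simp add: sum_subtractf sum.inter_restrict)
  finally have eq: "(\<Sum>y\<in>?I. hex_laplacian x y * w y) = 6 * w x - (\<Sum>y\<in>?I \<inter> ?N. w y)" .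
  have "(\<Sum>y\<in>?I \<inter> ?N. w y) \<le> (\<Sum>y\<in>?N. w y)"
    using w by (intro sum_mono2) (auto simp: finite_hex_nbrs)
  also have "(\<Sum>y\<in>?N. w y) = (\<Sum>d\<in>hex_nbrs. w (x + d))"
    by (rule sum.reindex_cong[of "\<lambda>d. x + d"]) (auto simp: inj_on_def)
  finally show ?thesis unfolding eq by simp
qed

lemma hex_laplacian_sym: "hex_laplacian x y = hex_laplacian y x"
  using hex_nbrs_uminus[of "x - y"] by (auto simp: hex_laplacian_def)

lemma hex_laplacian_off_diag: "x \<noteq> y \<Longrightarrow> hex_laplacian x y \<le> 0"
  by (simp add: hex_laplacian_def)

lemma hex_laplacian_form_lower_bound:
  assumes m: "m \<ge> 1"
  shows "6 / (real m)\<^sup>2 * (\<Sum>x\<in>hex_lattice m. (u x)\<^sup>2)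
     \<le> (\<Sum>x\<in>hex_lattice m. \<Sum>y\<in>hex_lattice m. hex_laplacian x y * (u x * u y))"
proof (rule Z_matrix_form_lower_bound)
  let ?w = "\<lambda>x. real_of_int ((int m)\<^sup>2 - hexsq x)"
  fix x assume x: "x \<in> hex_lattice m"
  then have "hexnorm x < int m" by (simp add: hex_lattice_def)
  then have "(hexnorm x)\<^sup>2 < (int m)\<^sup>2" using hexnorm_nonneg by (intro power_strict_mono) auto
  then show "?w x > 0" using hexsq_le_hexnorm[of x] by linarith
  have "?w (x + d) \<ge> 0" if "d \<in> hex_nbrs" for d
  proof -
    have "hexnorm (x + d) \<le> int m" using hexnorm_nbr[OF that, of x] \<open>hexnorm x < int m\<close> by simp
    then have "(hexnorm (x + d))\<^sup>2 \<le> (int m)\<^sup>2" using hexnorm_nonneg by (intro power_mono) auto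
    then show ?thesis using hexsq_le_hexnorm[of "x + d"] by linarith
  qed
  from hex_laplacian_ge[of x m ?w, OF x this]
  have "(\<Sum>y\<in>hex_lattice m. hex_laplacian x y * ?w y) \<ge> 6 * ?w x - (\<Sum>d\<in>hex_nbrs. ?w (x + d))"
    by simp
  \<comment> \<open>Opposite directions cancel the linear terms, and each of the six directions adds
    \<open>hexsq d = 1\<close>; hence the same value 6 at every node.\<close>
  also have "6 * ?w x - (\<Sum>d\<in>hex_nbrs. ?w (x + d)) = 6"
    by (cases x) (simp add: hex_nbrs_def hexsq_def power2_eq_square algebra_simps)
  finally have "6 \<le> (\<Sum>y\<in>hex_lattice m. hex_laplacian x y * ?w y)" .
  moreover have "6 / (real m)\<^sup>2 * ?w x \<le> 6 / (real m)\<^sup>2 * (real m)\<^sup>2"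
    using hexsq_nonneg[of x] by (intro mult_left_mono) auto
  ultimately show "6 / (real m)\<^sup>2 * ?w x \<le> (\<Sum>y\<in>hex_lattice m. hex_laplacian x y * ?w y)"
    using m by simp
qed (rule hex_laplacian_sym, rule hex_laplacian_off_diag)


text \<open>The exponentiated form of the subharmonicity of ln (|x|^2 + 1) on the lattice: the
  factors of opposite neighbours are paired into (r + 2)^2 minus the square of a linear form. The
  added 1 removes the singularity and leaves a remainder in \<open>r\<close> with positive
  coefficients.\<close>

lemma hex_barrier_polynomial:
  fixes s t :: real
  defines "r \<equiv> s\<^sup>2 + s * t + t\<^sup>2"
  shows "(r + 1) ^ 6
    \<le> ((r + 2)\<^sup>2 - (2 * s + t)\<^sup>2) * ((r + 2)\<^sup>2 - (s + 2 * t)\<^sup>2) * ((r + 2)\<^sup>2 - (s - t)\<^sup>2)"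
proof -
  have r: "r \<ge> 0"
  proof -
    have "4 * r = (2 * s + t)\<^sup>2 + 3 * t\<^sup>2" by (simp add: r_def power2_eq_square algebra_simps)
    then show ?thesis by (smt (verit) zero_le_power2)
  qed
  \<comment> \<open>The discriminant formula in disguise: the cubic z^3 - r z + s t (s + t) has the
    roots s, t and -(s + t), the three linear forms are the differences of its roots, and the square
    of their product is 4 r^3 - 27 (s t (s + t))^2.\<close>
  have id: "((r + 2)\<^sup>2 - (2 * s + t)\<^sup>2) * ((r + 2)\<^sup>2 - (s + 2 * t)\<^sup>2) * ((r + 2)\<^sup>2 - (s - t)\<^sup>2)
    = ((r + 2)\<^sup>2 - r)\<^sup>2 * ((r + 2)\<^sup>2 - 4 * r) + 27 * (s * t * (s + t))\<^sup>2"
  proof -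
    have "(Y - (2 * s + t)\<^sup>2) * (Y - (s + 2 * t)\<^sup>2) * (Y - (s - t)\<^sup>2)
        = (Y - r)\<^sup>2 * (Y - 4 * r) + 27 * (s * t * (s + t))\<^sup>2" for Y
      unfolding r_def by (simp add: power2_eq_square algebra_simps)
    then show ?thesis .
  qed
  have "((r + 2)\<^sup>2 - r)\<^sup>2 * ((r + 2)\<^sup>2 - 4 * r)
    = (r + 1) ^ 6 + (6 * r ^ 4 + 28 * r ^ 3 + 69 * r\<^sup>2 + 90 * r + 63)"
    by (simp add: eval_nat_numeral algebra_simps)
  moreover have "6 * r ^ 4 + 28 * r ^ 3 + 69 * r\<^sup>2 + 90 * r + 63 \<ge> 0" using r by simp
  moreover have "27 * (s * t * (s + t))\<^sup>2 \<ge> 0" by simp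
  ultimately show ?thesis unfolding id by linarith
qed

text \<open>The logarithm of \<open>hex_barrier_polynomial\<close>. The model is the plane, where ln
  (|x|^2 + 1) has the positive Laplacian 4 / (|x|^2 + 1)^2.\<close>

lemma sum_ln_hexsq_nbrs_ge:
  "6 * ln (real_of_int (hexsq x) + 1) \<le> (\<Sum>d\<in>hex_nbrs. ln (real_of_int (hexsq (x + d)) + 1))"
proof -
  obtain p q where x: "x = (p, q)" by (cases x)
  define s t where "s = real_of_int p" and "t = real_of_int q"
  define r where "r = s\<^sup>2 + s * t + t\<^sup>2"
  have hx: "real_of_int (hexsq x) = r" by (simp add: x hexsq_def r_def s_def t_def)
  have pos: "real_of_int (hexsq y) + 1 > 0" for y using hexsq_nonneg[of y] by linarith
  have nb: "real_of_int (hexsq (x + (1,0))) + 1 = (r + 2) + (2 * s + t)"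
    "real_of_int (hexsq (x + (-1,0))) + 1 = (r + 2) - (2 * s + t)"
    "real_of_int (hexsq (x + (0,1))) + 1 = (r + 2) + (s + 2 * t)"
    "real_of_int (hexsq (x + (0,-1))) + 1 = (r + 2) - (s + 2 * t)"
    "real_of_int (hexsq (x + (1,-1))) + 1 = (r + 2) + (s - t)"
    "real_of_int (hexsq (x + (-1,1))) + 1 = (r + 2) - (s - t)"
    by (simp_all add: x hexsq_def r_def s_def t_def power2_eq_square algebra_simps)
  have "(r + 1) ^ 6
    \<le> ((r + 2)\<^sup>2 - (2 * s + t)\<^sup>2) * ((r + 2)\<^sup>2 - (s + 2 * t)\<^sup>2) * ((r + 2)\<^sup>2 - (s - t)\<^sup>2)"
    unfolding r_def by (rule hex_barrier_polynomial)
  also have "\<dots> = (\<Prod>d\<in>hex_nbrs. real_of_int (hexsq (x + d)) + 1)"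
    unfolding hex_nbrs_def by (simp add: nb[simplified] power2_eq_square algebra_simps)
  finally have le: "(r + 1) ^ 6 \<le> (\<Prod>d\<in>hex_nbrs. real_of_int (hexsq (x + d)) + 1)" .
  have "6 * ln (r + 1) = ln ((r + 1) ^ 6)" using pos[of x] by (simp add: ln_realpow hx)
  also have "\<dots> \<le> ln (\<Prod>d\<in>hex_nbrs. real_of_int (hexsq (x + d)) + 1)"
    using le pos[of x] by (simp add: hx prod_pos pos)
  also have "\<dots> = (\<Sum>d\<in>hex_nbrs. ln (real_of_int (hexsq (x + d)) + 1))"
    by (rule ln_prod) (use pos finite_hex_nbrs in \<open>auto simp: less_imp_neq[symmetric]\<close>)
  finally show ?thesis by (simp add: hx)
qed

text \<open>A regularised logarithmic fundamental solution with pole \<open>z\<close>. Two points of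
  the closed hexagon differ by at most 4 m^2 in \<open>hexsq\<close>, and the added 1 is at most
  m^2; the constant 5 m^2 thus keeps the barrier nonnegative up to the boundary nodes.\<close>

definition hex_barrier :: "nat \<Rightarrow> int \<times> int \<Rightarrow> int \<times> int \<Rightarrow> real" where
  "hex_barrier m z x = ln (5 * (real m)\<^sup>2) - ln (real_of_int (hexsq (x - z)) + 1)"

lemma hexsq_diff_le:
  assumes "m \<ge> 1" "hexnorm x \<le> int m" "hexnorm z \<le> int m"
  shows "real_of_int (hexsq (x - z)) + 1 \<le> 5 * (real m)\<^sup>2"
proof -
  have "hexnorm (x - z) \<le> 2 * int m"
    using hexnorm_triangle[of x "- z"] assms by (simp add: hexnorm_uminus)
  then have "(hexnorm (x - z))\<^sup>2 \<le> (2 * int m)\<^sup>2" using hexnorm_nonneg by (intro power_mono) auto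
  with hexsq_le_hexnorm[of "x - z"] have "hexsq (x - z) \<le> 4 * (int m)\<^sup>2" by simp
  then have "real_of_int (hexsq (x - z)) \<le> real_of_int (4 * (int m)\<^sup>2)" by linarith
  moreover have "(real m)\<^sup>2 \<ge> 1" using assms by simp
  ultimately show ?thesis by simp
qed

lemma hex_barrier_nonneg:
  assumes "m \<ge> 1" "hexnorm x \<le> int m" "hexnorm z \<le> int m"
  shows "hex_barrier m z x \<ge> 0"
proof -
  have "0 < real_of_int (hexsq (x - z)) + 1" using hexsq_nonneg[of "x - z"] by linarith
  then have "ln (real_of_int (hexsq (x - z)) + 1) \<le> ln (5 * (real m)\<^sup>2)"
    using hexsq_diff_le[OF assms] by (intro ln_mono)
  then show ?thesis by (simp add: hex_barrier_def)
qed

lemma hex_barrier_supersolution: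
  assumes m: "m \<ge> 1" and x: "x \<in> hex_lattice m" and z: "z \<in> hex_lattice m"
  shows "(\<Sum>y\<in>hex_lattice m. hex_laplacian x y * hex_barrier m z y) \<ge> (if x = z then 1 else 0)"
proof -
  have xz: "hexnorm x < int m" "hexnorm z < int m" using x z by (auto simp: hex_lattice_def)
  have "hex_barrier m z (x + d) \<ge> 0" if "d \<in> hex_nbrs" for d
    using hexnorm_nbr[OF that, of x] xz m by (intro hex_barrier_nonneg) auto
  then have "(\<Sum>y\<in>hex_lattice m. hex_laplacian x y * hex_barrier m z y)
      \<ge> 6 * hex_barrier m z x - (\<Sum>d\<in>hex_nbrs. hex_barrier m z (x + d))"
    by (rule hex_laplacian_ge[OF x])
  also have "6 * hex_barrier m z x - (\<Sum>d\<in>hex_nbrs. hex_barrier m z (x + d))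
    = (\<Sum>d\<in>hex_nbrs. ln (real_of_int (hexsq ((x - z) + d)) + 1)) - 6 * ln (real_of_int (hexsq (x - z)) + 1)"
    by (simp add: hex_barrier_def sum_subtractf card_hex_nbrs algebra_simps)
  finally have ge: "(\<Sum>d\<in>hex_nbrs. ln (real_of_int (hexsq ((x - z) + d)) + 1)) - 6 * ln (real_of_int (hexsq (x - z)) + 1)
     \<le> (\<Sum>y\<in>hex_lattice m. hex_laplacian x y * hex_barrier m z y)" .
  show ?thesis
  proof (cases "x = z")
    case True
    \<comment> \<open>At the pole all six neighbours have \<open>hexsq\<close> equal to 1 and the
      central logarithm vanishes; 6 ln 2 is at least 4, more than the unit source requires.\<close>
    have "(\<Sum>d\<in>hex_nbrs. ln (real_of_int (hexsq ((x - z) + d)) + 1)) - 6 * ln (real_of_int (hexsq (x - z)) + 1)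
        = 6 * ln 2"
      by (simp add: True hexsq_def hex_nbrs_def)
    then show ?thesis using ge True ln2_ge_two_thirds by simp
  next
    case False
    then show ?thesis using ge sum_ln_hexsq_nbrs_ge[of "x - z"] by simp
  qed
qed

section \<open>Square sums of the barrier\<close>

lemma sum_inverse_sqrt_le: "(\<Sum>k\<le>n. 1 / sqrt (real (k + 1))) \<le> 2 * sqrt (real (n + 1))"
proof (induction n)
  case (Suc n)
  define a b where "a = sqrt (real (n + 1))" and "b = sqrt (real (n + 2))"
  have ab: "a\<^sup>2 = real n + 1" "b\<^sup>2 = real n + 2" "a > 0" "b > 0" by (auto simp: a_def b_def)
  have "1 \<le> 2 * b * b - 2 * a * b"
  proof -
    have "0 \<le> (b - a)\<^sup>2" by simp
    then show ?thesis using ab by (simp add: power2_eq_square algebra_simps)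
  qed
  then have "1 / b \<le> 2 * b - 2 * a" using ab by (simp add: field_simps)
  then show ?case using Suc by (simp add: a_def b_def)
qed simp

text \<open>Trades the squared logarithm for a power. With y of order m^2 / |x|^2 the right-hand
  side is of order m / |x|, which still sums to O(m^2) over a planar region of diameter
  O(m).\<close>

lemma ln_squared_le:
  assumes "y \<ge> (1::real)"
  shows "(ln y)\<^sup>2 \<le> 16 * sqrt y"
proof -
  have "ln y = 4 * ln (sqrt (sqrt y))" using assms by (simp add: ln_sqrt)
  also have "\<dots> \<le> 4 * sqrt (sqrt y)" using assms by (intro mult_left_mono less_imp_le[OF ln_less_self]) auto
  finally have "(ln y)\<^sup>2 \<le> (4 * sqrt (sqrt y))\<^sup>2" using assms by (intro power_mono) auto
  then show ?thesis using assms by (simp add: power_mult_distrib)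
qed

lemma sum_int_inverse_sqrt_le:
  "(\<Sum>s\<in>{- int n..int n}. 1 / sqrt (real_of_int (1 + \<bar>s\<bar>))) \<le> 4 * sqrt (real (n + 1))"
proof -
  have "(\<Sum>s\<in>{- int n..int n}. 1 / sqrt (real_of_int (1 + \<bar>s\<bar>)))
     \<le> (\<Sum>s\<in>(int ` {..n}) \<union> ((\<lambda>k. - int k) ` {..n}). 1 / sqrt (real_of_int (1 + \<bar>s\<bar>)))"
  proof (rule sum_mono2)
    show "{- int n..int n} \<subseteq> int ` {..n} \<union> (\<lambda>k. - int k) ` {..n}"
    proof
      fix s assume "s \<in> {- int n..int n}"
      then have "(s = int (nat s) \<and> nat s \<le> n) \<or> (s = - int (nat (- s)) \<and> nat (- s) \<le> n)" by auto
      then show "s \<in> int ` {..n} \<union> (\<lambda>k. - int k) ` {..n}" by blast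
    qed
  qed auto
  also have "\<dots> \<le> (\<Sum>s\<in>int ` {..n}. 1 / sqrt (real_of_int (1 + \<bar>s\<bar>)))
               + (\<Sum>s\<in>(\<lambda>k. - int k) ` {..n}. 1 / sqrt (real_of_int (1 + \<bar>s\<bar>)))"
    by (subst sum_Un) (auto intro!: sum_nonneg)
  also have "\<dots> = (\<Sum>k\<le>n. 1 / sqrt (real (k + 1))) + (\<Sum>k\<le>n. 1 / sqrt (real (k + 1)))"
    by (subst (1 2) sum.reindex) (auto simp: inj_on_def add.commute)
  also have "\<dots> \<le> 4 * sqrt (real (n + 1))" using sum_inverse_sqrt_le[of n] by simp
  finally show ?thesis .
qed

text \<open>Replaces the radial weight by a product, so that the planar sum factors into two
  one-dimensional ones. The source is the identity 2 hexsq = s^2 + t^2 + (s + t)^2.\<close>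

lemma inverse_sqrt_hexsq_le:
  "1 / sqrt (real_of_int (hexsq (s, t)) + 1)
     \<le> sqrt 2 * (1 / sqrt (real_of_int (1 + \<bar>s\<bar>)) * (1 / sqrt (real_of_int (1 + \<bar>t\<bar>))))"
proof -
  define a b where "a = real_of_int \<bar>s\<bar>" and "b = real_of_int \<bar>t\<bar>"
  have ab: "a \<ge> 0" "b \<ge> 0" by (auto simp: a_def b_def)
  have "2 * (real_of_int (hexsq (s,t)) + 1) = a\<^sup>2 + b\<^sup>2 + (real_of_int (s + t))\<^sup>2 + 2"
    by (simp add: hexsq_def a_def b_def power2_eq_square algebra_simps)
  then have h: "2 * (real_of_int (hexsq (s,t)) + 1) \<ge> a\<^sup>2 + b\<^sup>2 + 2" by simp
  \<comment> \<open>Twice the difference of the two sides is (a - 1)^2 + (b - 1)^2 + (a -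
    b)^2.\<close>
  have "(1 + a) * (1 + b) \<le> a\<^sup>2 + b\<^sup>2 + 2"
  proof -
    have "0 \<le> (a - 1)\<^sup>2 + (b - 1)\<^sup>2 + (a - b)\<^sup>2" by simp
    then show ?thesis by (simp add: power2_eq_square algebra_simps)
  qed
  with h have le: "(1 + a) * (1 + b) \<le> 2 * (real_of_int (hexsq (s,t)) + 1)" by linarith
  then have "sqrt ((1 + a) * (1 + b)) \<le> sqrt 2 * sqrt (real_of_int (hexsq (s,t)) + 1)"
    by (metis real_sqrt_le_iff real_sqrt_mult)
  moreover have "sqrt ((1 + a) * (1 + b)) > 0" using ab by simp
  moreover have "sqrt (real_of_int (hexsq (s,t)) + 1) > 0" using hexsq_nonneg[of "(s,t)"] by simp
  ultimately have "1 / sqrt (real_of_int (hexsq (s, t)) + 1) \<le> sqrt 2 / sqrt ((1 + a) * (1 + b))"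
    by (simp add: field_simps)
  then show ?thesis by (simp add: a_def b_def real_sqrt_mult)
qed

lemma sum_hex_barrier_squared_le:
  assumes m: "m \<ge> 1" and z: "z \<in> hex_lattice m"
  shows "(\<Sum>x\<in>hex_lattice m. (hex_barrier m z x)\<^sup>2) \<le> 4000 * (real m)\<^sup>2"
proof -
  let ?J = "{- int (2 * m)..int (2 * m)}"
  let ?g = "\<lambda>s. 1 / sqrt (real_of_int (1 + \<bar>s\<bar>))"
  have "(\<Sum>x\<in>hex_lattice m. (hex_barrier m z x)\<^sup>2)
     \<le> (\<Sum>x\<in>hex_lattice m. 16 * (sqrt 5 * real m) * (sqrt 2 * (?g (fst (x - z)) * ?g (snd (x - z)))))"
  proof (intro sum_mono)
    fix x assume "x \<in> hex_lattice m"
    then have le: "real_of_int (hexsq (x - z)) + 1 \<le> 5 * (real m)\<^sup>2"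
      using z m by (intro hexsq_diff_le) (auto simp: hex_lattice_def)
    have pos: "real_of_int (hexsq (x - z)) + 1 > 0" using hexsq_nonneg[of "x - z"] by linarith
    have "hex_barrier m z x = ln (5 * (real m)\<^sup>2 / (real_of_int (hexsq (x - z)) + 1))"
      using pos m by (simp add: hex_barrier_def ln_div)
    then have "(hex_barrier m z x)\<^sup>2 \<le> 16 * sqrt (5 * (real m)\<^sup>2 / (real_of_int (hexsq (x - z)) + 1))"
      using ln_squared_le[of "5 * (real m)\<^sup>2 / (real_of_int (hexsq (x - z)) + 1)"] le pos by simp
    also have "\<dots> = 16 * (sqrt 5 * real m) * (1 / sqrt (real_of_int (hexsq (x - z)) + 1))"
      by (simp add: real_sqrt_divide real_sqrt_mult)
    also have "\<dots> \<le> 16 * (sqrt 5 * real m) * (sqrt 2 * (?g (fst (x - z)) * ?g (snd (x - z))))"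
      using inverse_sqrt_hexsq_le[of "fst (x - z)" "snd (x - z)"]
      by (intro mult_left_mono) (simp_all only: prod.collapse, simp_all)
    finally show "(hex_barrier m z x)\<^sup>2 \<le> \<dots>" .
  qed
  also have "\<dots> = 16 * (sqrt 5 * real m) * (sqrt 2 * (\<Sum>x\<in>hex_lattice m. ?g (fst (x - z)) * ?g (snd (x - z))))"
    by (simp add: sum_distrib_left)
  also have "(\<Sum>x\<in>hex_lattice m. ?g (fst (x - z)) * ?g (snd (x - z)))
      = (\<Sum>y\<in>(\<lambda>x. x - z) ` hex_lattice m. ?g (fst y) * ?g (snd y))"
    by (subst sum.reindex) (auto simp: inj_on_def)
  \<comment> \<open>The hexagon translated by one of its points lies in the square of half-side 2 m;
    the summands are nonnegative, so the larger range costs only a constant.\<close>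
  also have "\<dots> \<le> (\<Sum>y\<in>?J \<times> ?J. ?g (fst y) * ?g (snd y))"
  proof (rule sum_mono2)
    have zJ: "z \<in> {- int m..int m} \<times> {- int m..int m}" using z hex_lattice_subset by blast
    show "(\<lambda>x. x - z) ` hex_lattice m \<subseteq> ?J \<times> ?J"
    proof safe
      fix x y p q assume "(p, q) = (x, y) - z" "(x, y) \<in> hex_lattice m"
      then have "(x, y) \<in> {- int m..int m} \<times> {- int m..int m}" using hex_lattice_subset by blast
      with zJ \<open>(p, q) = (x, y) - z\<close> show "p \<in> ?J" "q \<in> ?J" by (cases z; auto)+
    qed
  qed auto
  also have "\<dots> = (\<Sum>s\<in>?J. ?g s) * (\<Sum>t\<in>?J. ?g t)"
    by (simp add: sum_product sum.cartesian_product case_prod_unfold)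
  also have "\<dots> \<le> (4 * sqrt (real (2 * m + 1))) * (4 * sqrt (real (2 * m + 1)))"
    by (intro mult_mono sum_int_inverse_sqrt_le sum_nonneg) auto
  also have "\<dots> = 16 * real (2 * m + 1)" by simp
  also have "\<dots> \<le> 48 * real m" using m by simp
  finally have "(\<Sum>x\<in>hex_lattice m. (hex_barrier m z x)\<^sup>2)
      \<le> 16 * (sqrt 5 * real m) * (sqrt 2 * (48 * real m))"
    by (simp add: mult_left_mono)
  also have "\<dots> = 768 * (sqrt 5 * sqrt 2) * (real m)\<^sup>2" by (simp add: power2_eq_square)
  \<comment> \<open>The collected factor is 16 * 48 * sqrt 10, and sqrt 10 is at most 4; the
    resulting 3072 is rounded up to 4000.\<close>
  also have "\<dots> \<le> 768 * 4 * (real m)\<^sup>2"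
  proof -
    have "sqrt 5 * sqrt 2 = sqrt (10::real)" by (simp add: real_sqrt_mult[symmetric])
    also have "\<dots> \<le> sqrt (4\<^sup>2)" by (subst real_sqrt_le_iff) simp
    finally show ?thesis by (intro mult_right_mono mult_left_mono) auto
  qed
  also have "\<dots> \<le> 4000 * (real m)\<^sup>2" by (intro mult_right_mono) auto
  finally show ?thesis .
qed

section \<open>Perturbations of the scaled lattice Laplacian\<close>

lemma sum_le_sum_indicator_card:
  fixes f :: "'a \<Rightarrow> real"
  assumes "finite I" "finite N" "b \<ge> 0" "inj_on g I"
    and "\<And>j. j \<in> I \<Longrightarrow> f j \<le> (if g j \<in> N then b else 0)"
  shows "(\<Sum>j\<in>I. f j) \<le> real (card N) * b"
proof -
  have "(\<Sum>j\<in>I. f j) \<le> (\<Sum>j\<in>I. if g j \<in> N then b else 0)" by (intro sum_mono assms)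
  also have "\<dots> = real (card {j \<in> I. g j \<in> N}) * b" using assms(1) by (simp add: sum.inter_filter[symmetric])
  also have "\<dots> \<le> real (card N) * b"
  proof -
    have "card (g ` {j \<in> I. g j \<in> N}) = card {j \<in> I. g j \<in> N}"
      by (intro card_image inj_on_subset[OF assms(4)]) auto
    moreover have "card (g ` {j \<in> I. g j \<in> N}) \<le> card N" by (intro card_mono assms(2)) auto
    ultimately show ?thesis using assms(3) by (intro mult_right_mono) auto
  qed
  finally show ?thesis .
qed

lemma index_mult_mat_sum:
  fixes A B :: "'a::semiring_0 Matrix.mat"
  assumes "A \<in> carrier_mat n n" "B \<in> carrier_mat n n" "i < n" "j < n"
  shows "(A * B) $$ (i,j) = (\<Sum>k<n. A $$ (i,k) * B $$ (k,j))"
  using assms by (auto simp: scalar_prod_def atLeast0LessThan intro!: sum.cong)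

text \<open>The Schur test: the arithmetic-geometric inequality separates \<open>u i\<close> from
  \<open>u j\<close>, after which one half is summed over columns and the other over rows.\<close>

lemma abs_quadratic_form_le:
  fixes E :: "nat \<Rightarrow> nat \<Rightarrow> real"
  assumes row: "\<And>i. i < n \<Longrightarrow> (\<Sum>j<n. \<bar>E i j\<bar>) \<le> r" and col: "\<And>j. j < n \<Longrightarrow> (\<Sum>i<n. \<bar>E i j\<bar>) \<le> r"
  shows "\<bar>\<Sum>i<n. \<Sum>j<n. E i j * (u i * u j)\<bar> \<le> r * (\<Sum>i<n. (u i)\<^sup>2)"
proof -
  have "\<bar>\<Sum>i<n. \<Sum>j<n. E i j * (u i * u j)\<bar> \<le> (\<Sum>i<n. \<Sum>j<n. \<bar>E i j\<bar> * (((u i)\<^sup>2 + (u j)\<^sup>2) / 2))"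
  proof (intro order.trans[OF sum_abs] sum_mono)
    fix i j
    have "\<bar>u i * u j\<bar> \<le> ((u i)\<^sup>2 + (u j)\<^sup>2) / 2"
      using sum_squares_bound[of "\<bar>u i\<bar>" "\<bar>u j\<bar>"] by (simp add: abs_mult)
    then show "\<bar>E i j * (u i * u j)\<bar> \<le> \<bar>E i j\<bar> * (((u i)\<^sup>2 + (u j)\<^sup>2) / 2)"
      unfolding abs_mult[of "E i j"] by (intro mult_left_mono) auto
  qed
  also have "\<dots> = ((\<Sum>i<n. \<Sum>j<n. \<bar>E i j\<bar> * (u i)\<^sup>2) + (\<Sum>i<n. \<Sum>j<n. \<bar>E i j\<bar> * (u j)\<^sup>2)) / 2"
    by (simp add: sum.distrib sum_divide_distrib distrib_left add_divide_distrib)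
  also have "(\<Sum>i<n. \<Sum>j<n. \<bar>E i j\<bar> * (u j)\<^sup>2) = (\<Sum>j<n. (\<Sum>i<n. \<bar>E i j\<bar>) * (u j)\<^sup>2)"
    by (subst sum.swap) (simp add: sum_distrib_right)
  also have "\<dots> \<le> (\<Sum>j<n. r * (u j)\<^sup>2)" using col by (intro sum_mono mult_right_mono) auto
  also have "(\<Sum>i<n. \<Sum>j<n. \<bar>E i j\<bar> * (u i)\<^sup>2) = (\<Sum>i<n. (\<Sum>j<n. \<bar>E i j\<bar>) * (u i)\<^sup>2)"
    by (simp add: sum_distrib_right)
  also have "\<dots> \<le> (\<Sum>i<n. r * (u i)\<^sup>2)" using row by (intro sum_mono mult_right_mono) auto
  finally show ?thesis unfolding sum_distrib_left[symmetric] by simp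
qed

text \<open>The estimate of the Frobenius norm of a product by Frobenius norm times operator norm,
  with absolute row and column sums in place of the latter. Cauchy-Schwarz with the weight |E k j|
  split into two square roots yields one factor \<open>r\<close> from the columns and, after
  exchanging the sums, another from the rows.\<close>

lemma sum_squares_matrix_mult_le:
  fixes H E :: "nat \<Rightarrow> nat \<Rightarrow> real"
  assumes row: "\<And>i. i < n \<Longrightarrow> (\<Sum>j<n. \<bar>E i j\<bar>) \<le> r" and col: "\<And>j. j < n \<Longrightarrow> (\<Sum>i<n. \<bar>E i j\<bar>) \<le> r"
    and "r \<ge> 0"
  shows "(\<Sum>i<n. \<Sum>j<n. (\<Sum>k<n. H i k * E k j)\<^sup>2) \<le> r\<^sup>2 * (\<Sum>i<n. \<Sum>k<n. (H i k)\<^sup>2)"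
proof -
  have "(\<Sum>j<n. (\<Sum>k<n. H i k * E k j)\<^sup>2) \<le> r\<^sup>2 * (\<Sum>k<n. (H i k)\<^sup>2)" for i
  proof -
    have "(\<Sum>k<n. H i k * E k j)\<^sup>2 \<le> r * (\<Sum>k<n. (H i k)\<^sup>2 * \<bar>E k j\<bar>)" if "j < n" for j
    proof -
      have "\<bar>\<Sum>k<n. H i k * E k j\<bar> \<le> (\<Sum>k<n. sqrt \<bar>E k j\<bar> * (\<bar>H i k\<bar> * sqrt \<bar>E k j\<bar>))"
        by (rule order.trans[OF sum_abs]) (simp add: abs_mult mult.commute mult.left_commute flip: real_sqrt_mult)
      then have "\<bar>\<Sum>k<n. H i k * E k j\<bar>\<^sup>2 \<le> (\<Sum>k<n. sqrt \<bar>E k j\<bar> * (\<bar>H i k\<bar> * sqrt \<bar>E k j\<bar>))\<^sup>2"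
        by (intro power_mono) auto
      also have "\<dots> \<le> (\<Sum>k<n. (sqrt \<bar>E k j\<bar>)\<^sup>2) * (\<Sum>k<n. (\<bar>H i k\<bar> * sqrt \<bar>E k j\<bar>)\<^sup>2)"
        by (rule Cauchy_Schwarz_ineq_sum)
      also have "\<dots> = (\<Sum>k<n. \<bar>E k j\<bar>) * (\<Sum>k<n. (H i k)\<^sup>2 * \<bar>E k j\<bar>)" by (simp add: power_mult_distrib)
      also have "\<dots> \<le> r * (\<Sum>k<n. (H i k)\<^sup>2 * \<bar>E k j\<bar>)"
        using col[OF that] by (intro mult_right_mono sum_nonneg) auto
      finally show ?thesis by simp
    qed
    then have "(\<Sum>j<n. (\<Sum>k<n. H i k * E k j)\<^sup>2) \<le> (\<Sum>j<n. r * (\<Sum>k<n. (H i k)\<^sup>2 * \<bar>E k j\<bar>))"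
      by (intro sum_mono) auto
    also have "\<dots> = r * (\<Sum>k<n. (H i k)\<^sup>2 * (\<Sum>j<n. \<bar>E k j\<bar>))"
      unfolding sum_distrib_left[symmetric] by (subst sum.swap) (simp add: sum_distrib_left)
    also have "\<dots> \<le> r * (\<Sum>k<n. (H i k)\<^sup>2 * r)"
      using row \<open>r \<ge> 0\<close> by (intro mult_left_mono sum_mono) auto
    also have "\<dots> = r\<^sup>2 * (\<Sum>k<n. (H i k)\<^sup>2)"
      unfolding sum_distrib_right[symmetric] by (simp add: power2_eq_square)
    finally show ?thesis .
  qed
  then have "(\<Sum>i<n. \<Sum>j<n. (\<Sum>k<n. H i k * E k j)\<^sup>2) \<le> (\<Sum>i<n. r\<^sup>2 * (\<Sum>k<n. (H i k)\<^sup>2))"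
    by (intro sum_mono)
  then show ?thesis by (simp add: sum_distrib_left)
qed

text \<open>The interface between discretisation and linear algebra. \<open>z\<close> is the lattice
  position of a matrix index, \<kappa> the common factor of the entries, \<alpha> the diagonal of
  the scaling, and \<open>E\<close> the consistency estimate for A - P relative to \<kappa>. Only
  \<open>a0\<close> and \<open>K\<close> may survive in the final bounds, because they are to be the
  same for all meshes.\<close>

locale scaled_hex_laplacian =
  fixes m n :: nat and z :: "nat \<Rightarrow> int \<times> int" and \<kappa> a0 K :: real and \<alpha> :: "nat \<Rightarrow> real"
    and A1 A P :: "real Matrix.mat"
  assumes m: "m \<ge> 1" and z: "bij_betw z {..<n} (hex_lattice m)"
    and \<kappa>: "\<kappa> > 0" and a0: "a0 > 0" and K: "K \<ge> 0" and \<alpha>: "\<And>i. i < n \<Longrightarrow> \<alpha> i \<ge> a0"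
    and A1: "A1 \<in> carrier_mat n n" "\<And>i j. i < n \<Longrightarrow> j < n \<Longrightarrow> A1 $$ (i,j) = \<kappa> * hex_laplacian (z i) (z j)"
    and A: "A \<in> carrier_mat n n" "\<And>i j. i < n \<Longrightarrow> j < n \<Longrightarrow> A $$ (i,j) = A $$ (j,i)"
    and form: "\<And>u. u \<in> carrier_vec n \<Longrightarrow> a0 * scalar_prod u (A1 *\<^sub>v u) \<le> scalar_prod u (A *\<^sub>v u)"
    and P: "P \<in> carrier_mat n n" "\<And>i j. i < n \<Longrightarrow> j < n \<Longrightarrow> P $$ (i,j) = sqrt (\<alpha> i) * A1 $$ (i,j) * sqrt (\<alpha> j)"
    and E: "\<And>i j. i < n \<Longrightarrow> j < n \<Longrightarrow>
      \<bar>A $$ (i,j) - P $$ (i,j)\<bar> \<le> (if z j - z i \<in> hex_nbrs then \<kappa> * K / (real m)\<^sup>2 else 0)"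
begin

lemma inj_z: "inj_on z {..<n}" using z by (rule bij_betw_imp_inj_on)

lemma z_in: "i < n \<Longrightarrow> z i \<in> hex_lattice m" using z by (auto simp: bij_betw_def)

lemma laplacian_form: "6 / (real m)\<^sup>2 * (\<Sum>i<n. (u i)\<^sup>2) \<le> (\<Sum>i<n. \<Sum>j<n. hex_laplacian (z i) (z j) * (u i * u j))"
proof -
  define w where "w x = u (the_inv_into {..<n} z x)" for x
  have w: "w (z i) = u i" if "i < n" for i
    using the_inv_into_f_f[OF inj_z] that by (simp add: w_def)
  have re: "(\<Sum>x\<in>hex_lattice m. f x) = (\<Sum>i<n. f (z i))" for f :: "int \<times> int \<Rightarrow> real"
    by (rule sum.reindex_bij_betw[OF z, symmetric])
  show ?thesis using hex_laplacian_form_lower_bound[OF m, of w] unfolding re by (simp add: w)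
qed

lemma A1_form: "u \<in> carrier_vec n \<Longrightarrow> 6 * \<kappa> / (real m)\<^sup>2 * (\<Sum>i<n. (vec_index u i)\<^sup>2) \<le> scalar_prod u (A1 *\<^sub>v u)"
proof -
  assume u: "u \<in> carrier_vec n"
  have "scalar_prod u (A1 *\<^sub>v u) = \<kappa> * (\<Sum>i<n. \<Sum>j<n. hex_laplacian (z i) (z j) * (vec_index u i * vec_index u j))"
    unfolding quadratic_form_sum[OF A1(1) u] sum_distrib_left by (intro sum.cong refl) (simp add: A1(2))
  moreover have "\<kappa> * (6 / (real m)\<^sup>2 * (\<Sum>i<n. (vec_index u i)\<^sup>2)) \<le> \<dots>"
    using laplacian_form[of "vec_index u"] \<kappa> by (intro mult_left_mono) auto
  ultimately show ?thesis by (simp add: ac_simps)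
qed

lemma A_form: "u \<in> carrier_vec n \<Longrightarrow> 6 * \<kappa> * a0 / (real m)\<^sup>2 * (\<Sum>i<n. (vec_index u i)\<^sup>2) \<le> scalar_prod u (A *\<^sub>v u)"
proof -
  assume u: "u \<in> carrier_vec n"
  have "a0 * (6 * \<kappa> / (real m)\<^sup>2 * (\<Sum>i<n. (vec_index u i)\<^sup>2)) \<le> a0 * scalar_prod u (A1 *\<^sub>v u)"
    using A1_form[OF u] a0 by (intro mult_left_mono) auto
  also have "\<dots> \<le> scalar_prod u (A *\<^sub>v u)" by (rule form[OF u])
  finally show ?thesis by (simp add: ac_simps)
qed

text \<open>The form of \<open>P\<close> at \<open>u\<close> is that of \<open>A1\<close> at
  \<open>w\<close>, with sqrt \<alpha> absorbed into the vector; as \<alpha> is at least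
  \<open>a0\<close>, \<open>P\<close> inherits the same lower bound as \<open>A\<close>.\<close>

lemma P_form: "u \<in> carrier_vec n \<Longrightarrow> 6 * \<kappa> * a0 / (real m)\<^sup>2 * (\<Sum>i<n. (vec_index u i)\<^sup>2) \<le> scalar_prod u (P *\<^sub>v u)"
proof -
  assume u: "u \<in> carrier_vec n"
  define w where "w = Matrix.vec n (\<lambda>i. sqrt (\<alpha> i) * vec_index u i)"
  have w: "w \<in> carrier_vec n" by (simp add: w_def)
  have "6 * \<kappa> * a0 / (real m)\<^sup>2 * (\<Sum>i<n. (vec_index u i)\<^sup>2) = 6 * \<kappa> / (real m)\<^sup>2 * (\<Sum>i<n. a0 * (vec_index u i)\<^sup>2)"
    by (simp add: sum_distrib_left ac_simps)
  also have "\<dots> \<le> 6 * \<kappa> / (real m)\<^sup>2 * (\<Sum>i<n. (vec_index w i)\<^sup>2)"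
  proof (intro mult_left_mono sum_mono)
    fix i assume "i \<in> {..<n}"
    then have "(vec_index w i)\<^sup>2 = \<alpha> i * (vec_index u i)\<^sup>2" "\<alpha> i \<ge> a0"
      using \<alpha>[of i] a0 by (simp_all add: w_def power_mult_distrib)
    then show "a0 * (vec_index u i)\<^sup>2 \<le> (vec_index w i)\<^sup>2" by (simp add: mult_right_mono)
  qed (use \<kappa> in simp)
  also have "\<dots> \<le> scalar_prod w (A1 *\<^sub>v w)" by (rule A1_form[OF w])
  also have "\<dots> = scalar_prod u (P *\<^sub>v u)"
    unfolding quadratic_form_sum[OF A1(1) w] quadratic_form_sum[OF P(1) u]
    by (intro sum.cong refl) (simp add: P(2) w_def)
  finally show ?thesis .
qed

lemma sum_squares_pos:
  assumes "u \<in> carrier_vec n" "u \<noteq> 0\<^sub>v n"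
  shows "(\<Sum>i<n. (vec_index u i :: real)\<^sup>2) > 0"
proof -
  obtain i where "i < n" "vec_index u i \<noteq> 0" using assms by (metis carrier_vecD eq_vecI index_zero_vec)
  then show ?thesis by (intro sum_pos2[of _ i]) auto
qed

lemma spd_A: "sym_pos_def n A" and spd_P: "sym_pos_def n P"
proof -
  have c: "6 * \<kappa> * a0 / (real m)\<^sup>2 > 0" using \<kappa> a0 m by simp
  have "transpose_mat A = A" using A by (intro eq_matI) auto
  moreover have "transpose_mat P = P"
    using P A1 hex_laplacian_sym by (intro eq_matI) (auto simp: mult.commute mult.left_commute)
  moreover have "scalar_prod u (A *\<^sub>v u) > 0" "scalar_prod u (P *\<^sub>v u) > 0"
    if "u \<in> carrier_vec n" "u \<noteq> 0\<^sub>v n" for u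
    using mult_pos_pos[OF c sum_squares_pos[OF that]] A_form[OF that(1)] P_form[OF that(1)] by linarith+
  ultimately show "sym_pos_def n A" "sym_pos_def n P" using A P unfolding sym_pos_def_def by blast+
qed

lemma E_row: "i < n \<Longrightarrow> (\<Sum>j<n. \<bar>A $$ (i,j) - P $$ (i,j)\<bar>) \<le> 6 * (\<kappa> * K / (real m)\<^sup>2)"
proof -
  assume i: "i < n"
  have "(\<Sum>j<n. \<bar>A $$ (i,j) - P $$ (i,j)\<bar>) \<le> real (card hex_nbrs) * (\<kappa> * K / (real m)\<^sup>2)"
    by (rule sum_le_sum_indicator_card[where g = "\<lambda>j. z j - z i"])
       (use finite_hex_nbrs \<kappa> K i E inj_z in \<open>auto simp: inj_on_def\<close>)
  then show ?thesis by (simp add: card_hex_nbrs)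
qed

lemma P_sym: "i < n \<Longrightarrow> j < n \<Longrightarrow> P $$ (i,j) = P $$ (j,i)"
  by (simp add: P(2) A1(2) hex_laplacian_sym[of "z i"] ac_simps)

lemma E_col: "j < n \<Longrightarrow> (\<Sum>i<n. \<bar>A $$ (i,j) - P $$ (i,j)\<bar>) \<le> 6 * (\<kappa> * K / (real m)\<^sup>2)"
proof -
  assume j: "j < n"
  have "(\<Sum>i<n. \<bar>A $$ (i,j) - P $$ (i,j)\<bar>) = (\<Sum>i<n. \<bar>A $$ (j,i) - P $$ (j,i)\<bar>)"
    using j by (intro sum.cong refl) (simp add: A(2)[of _ j] P_sym[of _ j])
  then show ?thesis using E_row[OF j] by simp
qed

text \<open>The right-hand side is written as \<open>K / a0\<close> times the common lower bound of
  \<open>A_form\<close> and \<open>P_form\<close>, so that the perturbation is bounded relative to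
  either form.\<close>

lemma E_form:
  assumes u: "u \<in> carrier_vec n"
  shows "\<bar>scalar_prod u (A *\<^sub>v u) - scalar_prod u (P *\<^sub>v u)\<bar>
     \<le> K / a0 * (6 * \<kappa> * a0 / (real m)\<^sup>2 * (\<Sum>i<n. (vec_index u i)\<^sup>2))"
proof -
  have "scalar_prod u (A *\<^sub>v u) - scalar_prod u (P *\<^sub>v u)
     = (\<Sum>i<n. \<Sum>j<n. (A $$ (i,j) - P $$ (i,j)) * (vec_index u i * vec_index u j))"
    unfolding quadratic_form_sum[OF A(1) u] quadratic_form_sum[OF P(1) u] sum_subtractf[symmetric]
    by (simp only: left_diff_distrib)
  also have "\<bar>\<dots>\<bar> \<le> 6 * (\<kappa> * K / (real m)\<^sup>2) * (\<Sum>i<n. (vec_index u i)\<^sup>2)"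
    by (rule abs_quadratic_form_le) (use E_row E_col in auto)
  also have "\<dots> = K / a0 * (6 * \<kappa> * a0 / (real m)\<^sup>2 * (\<Sum>i<n. (vec_index u i)\<^sup>2))"
    using a0 by simp
  finally show ?thesis .
qed

text \<open>The perturbation is absorbed into the form of \<open>P\<close> for the upper bound and
  into that of \<open>A\<close> for the lower one. Using \<open>P\<close> in both would give the
  lower factor 1 - K / a0, which can be negative; the reciprocal is always positive.\<close>

lemma Rayleigh_bounds:
  assumes u: "u \<in> carrier_vec n"
  shows "scalar_prod u (A *\<^sub>v u) \<le> (1 + K / a0) * scalar_prod u (P *\<^sub>v u)"
    and "1 / (1 + K / a0) * scalar_prod u (P *\<^sub>v u) \<le> scalar_prod u (A *\<^sub>v u)"
proof -
  define s where "s = 6 * \<kappa> * a0 / (real m)\<^sup>2 * (\<Sum>i<n. (vec_index u i)\<^sup>2)"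
  have K0: "K / a0 \<ge> 0" using K a0 by simp
  have e: "\<bar>scalar_prod u (A *\<^sub>v u) - scalar_prod u (P *\<^sub>v u)\<bar> \<le> K / a0 * s"
    using E_form[OF u] by (simp add: s_def)
  have "K / a0 * s \<le> K / a0 * scalar_prod u (P *\<^sub>v u)" "K / a0 * s \<le> K / a0 * scalar_prod u (A *\<^sub>v u)"
    using P_form[OF u] A_form[OF u] K0 unfolding s_def by (intro mult_left_mono; simp)+
  with e have "scalar_prod u (A *\<^sub>v u) \<le> scalar_prod u (P *\<^sub>v u) + K / a0 * scalar_prod u (P *\<^sub>v u)"
    "scalar_prod u (P *\<^sub>v u) \<le> scalar_prod u (A *\<^sub>v u) + K / a0 * scalar_prod u (A *\<^sub>v u)" by linarith+
  then have *: "scalar_prod u (A *\<^sub>v u) \<le> (1 + K / a0) * scalar_prod u (P *\<^sub>v u)"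
    "scalar_prod u (P *\<^sub>v u) \<le> (1 + K / a0) * scalar_prod u (A *\<^sub>v u)" by (simp_all only: distrib_right mult_1)
  then show "scalar_prod u (A *\<^sub>v u) \<le> (1 + K / a0) * scalar_prod u (P *\<^sub>v u)" by blast
  have "1 + K / a0 > 0" using K0 by linarith
  then show "1 / (1 + K / a0) * scalar_prod u (P *\<^sub>v u) \<le> scalar_prod u (A *\<^sub>v u)"
    using *(2) by (simp add: pos_divide_le_eq mult.commute)
qed

lemma spectrum_subset:
  assumes "mat_inverse P = Some H"
  shows "spectrum (map_mat complex_of_real (H * A)) \<subseteq> complex_of_real ` {1 / (1 + K / a0)..1 + K / a0}"
proof (rule spectrum_generalized_Rayleigh)
  show "H \<in> carrier_mat n n" "P * H = 1\<^sub>m n" using mat_inverse(2)[OF P(1) assms] by auto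
  show "transpose_mat A = A" using spd_A by (simp add: sym_pos_def_def)
qed (use A P spd_P Rayleigh_bounds in auto)

text \<open>Column \<open>j\<close> of the inverse, scaled by sqrt \<alpha>, solves the lattice
  Laplace equation with a point source of strength 1 / (\<kappa> sqrt (\<alpha> j)) at
  \<open>z j\<close>. It is therefore caught between zero and the barrier multiplied by the same
  strength, and the coefficient survives only through its lower bound \<open>a0\<close>.\<close>

lemma inverse_entry_bounds:
  assumes H: "H \<in> carrier_mat n n" "P * H = 1\<^sub>m n" and ij: "i < n" "j < n"
  shows "0 \<le> H $$ (i,j)" "H $$ (i,j) \<le> hex_barrier m (z j) (z i) / (\<kappa> * a0)"
proof -
  let ?L = "\<lambda>i k. hex_laplacian (z i) (z k)"
  define g where "g k = sqrt (\<alpha> k) * H $$ (k,j)" for k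
  have \<alpha>p: "\<alpha> k > 0" "sqrt (\<alpha> k) > 0" if "k < n" for k using \<alpha>[OF that] a0 by auto
  have Lg: "(\<Sum>k<n. ?L l k * g k) = (if l = j then 1 / (\<kappa> * sqrt (\<alpha> j)) else 0)" if "l < n" for l
  proof -
    have "(P * H) $$ (l,j) = (\<Sum>k<n. P $$ (l,k) * H $$ (k,j))"
      by (rule index_mult_mat_sum[OF P(1) H(1) that ij(2)])
    also have "\<dots> = \<kappa> * sqrt (\<alpha> l) * (\<Sum>k<n. ?L l k * g k)"
      unfolding sum_distrib_left using that by (intro sum.cong refl) (simp add: P(2) A1(2) g_def)
    finally have "\<kappa> * sqrt (\<alpha> l) * (\<Sum>k<n. ?L l k * g k) = (if l = j then 1 else 0)"
      using that ij by (simp add: H(2))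
    then show ?thesis using \<alpha>p[OF that] \<kappa> by (auto simp: field_simps split: if_splits)
  qed
  \<comment> \<open>The maximum principle in matrix indices, used below once for the column itself
    and once for the barrier minus the column.\<close>
  have cmp: "u i \<ge> 0" if "\<And>l. l < n \<Longrightarrow> (\<Sum>k<n. ?L l k * u k) \<ge> 0" for u
    by (rule Z_matrix_comparison[of "{..<n}" ?L "6 / (real m)\<^sup>2"])
       (use that ij m laplacian_form inj_z in \<open>auto intro!: hex_laplacian_off_diag dest: inj_onD\<close>)
  have "g i \<ge> 0" by (rule cmp) (use Lg \<kappa> \<alpha>p ij in \<open>auto intro!: mult_nonneg_nonneg less_imp_le\<close>)
  then show "0 \<le> H $$ (i,j)" using \<alpha>p[OF ij(1)] by (simp add: g_def zero_le_mult_iff)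
  define W where "W k = hex_barrier m (z j) (z k)" for k
  have "W i / (\<kappa> * sqrt (\<alpha> j)) - g i \<ge> 0"
  proof (rule cmp[of "\<lambda>k. W k / (\<kappa> * sqrt (\<alpha> j)) - g k"])
    fix l assume l: "l < n"
    have "(\<Sum>k<n. ?L l k * W k) = (\<Sum>y\<in>hex_lattice m. hex_laplacian (z l) y * hex_barrier m (z j) y)"
      unfolding W_def by (rule sum.reindex_bij_betw[OF z])
    also have "\<dots> \<ge> (if z l = z j then 1 else 0)"
      by (rule hex_barrier_supersolution[OF m z_in[OF l] z_in[OF ij(2)]])
    finally have "(\<Sum>k<n. ?L l k * W k) \<ge> (if l = j then 1 else 0)" by (auto split: if_splits)
    then have "(\<Sum>k<n. ?L l k * W k) / (\<kappa> * sqrt (\<alpha> j)) \<ge> (if l = j then 1 else 0) / (\<kappa> * sqrt (\<alpha> j))"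
      using \<kappa> \<alpha>p[OF ij(2)] by (intro divide_right_mono) auto
    moreover have "(\<Sum>k<n. ?L l k * (W k / (\<kappa> * sqrt (\<alpha> j)) - g k))
        = (\<Sum>k<n. ?L l k * W k) / (\<kappa> * sqrt (\<alpha> j)) - (\<Sum>k<n. ?L l k * g k)"
      by (simp add: sum_subtractf right_diff_distrib sum_divide_distrib)
    ultimately show "(\<Sum>k<n. ?L l k * (W k / (\<kappa> * sqrt (\<alpha> j)) - g k)) \<ge> 0"
      unfolding Lg[OF l] by (auto split: if_splits)
  qed
  then have "sqrt (\<alpha> i) * H $$ (i,j) \<le> W i / (\<kappa> * sqrt (\<alpha> j))" by (simp add: g_def)
  then have "H $$ (i,j) \<le> W i / (\<kappa> * (sqrt (\<alpha> i) * sqrt (\<alpha> j)))"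
    using \<alpha>p[OF ij(1)] \<alpha>p[OF ij(2)] \<kappa> by (simp add: field_simps)
  also have "\<dots> \<le> W i / (\<kappa> * a0)"
  proof (rule divide_left_mono)
    have "sqrt a0 * sqrt a0 \<le> sqrt (\<alpha> i) * sqrt (\<alpha> j)"
      using \<alpha>[OF ij(1)] \<alpha>[OF ij(2)] \<alpha>p(2)[OF ij(1)] a0 by (intro mult_mono) auto
    then show "\<kappa> * a0 \<le> \<kappa> * (sqrt (\<alpha> i) * sqrt (\<alpha> j))" using a0 \<kappa> by simp
    show "W i \<ge> 0"
      unfolding W_def using z_in[OF ij(1)] z_in[OF ij(2)] m by (intro hex_barrier_nonneg) (auto simp: hex_lattice_def)
  qed (use a0 \<kappa> \<alpha>p ij in auto)
  finally show "H $$ (i,j) \<le> hex_barrier m (z j) (z i) / (\<kappa> * a0)" by (simp add: W_def)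
qed

lemma card_n: "real n \<le> 9 * (real m)\<^sup>2"
  using card_hex_lattice_le[OF m] bij_betw_same_card[OF z] by simp

text \<open>There are at most 9 m^2 columns, and each has a barrier with square sum at most 4000
  m^2.\<close>

lemma inverse_Frobenius_bound:
  assumes H: "H \<in> carrier_mat n n" "P * H = 1\<^sub>m n"
  shows "(\<Sum>i<n. \<Sum>j<n. (H $$ (i,j))\<^sup>2) \<le> 36000 * (real m) ^ 4 / (\<kappa> * a0)\<^sup>2"
proof -
  have "(\<Sum>i<n. \<Sum>j<n. (H $$ (i,j))\<^sup>2) \<le> (\<Sum>i<n. \<Sum>j<n. (hex_barrier m (z j) (z i))\<^sup>2 / (\<kappa> * a0)\<^sup>2)"
  proof (intro sum_mono)
    fix i j assume "i \<in> {..<n}" "j \<in> {..<n}"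
    then have "(H $$ (i,j))\<^sup>2 \<le> (hex_barrier m (z j) (z i) / (\<kappa> * a0))\<^sup>2"
      using inverse_entry_bounds[OF H] by (intro power_mono) auto
    then show "(H $$ (i,j))\<^sup>2 \<le> (hex_barrier m (z j) (z i))\<^sup>2 / (\<kappa> * a0)\<^sup>2" by (simp only: power_divide)
  qed
  also have "\<dots> = (\<Sum>j<n. (\<Sum>i<n. (hex_barrier m (z j) (z i))\<^sup>2)) / (\<kappa> * a0)\<^sup>2"
    by (subst sum.swap) (simp add: sum_divide_distrib)
  also have "\<dots> \<le> (\<Sum>j<n. 4000 * (real m)\<^sup>2) / (\<kappa> * a0)\<^sup>2"
  proof (intro divide_right_mono sum_mono)
    fix j assume "j \<in> {..<n}"
    have "(\<Sum>i<n. (hex_barrier m (z j) (z i))\<^sup>2) = (\<Sum>x\<in>hex_lattice m. (hex_barrier m (z j) x)\<^sup>2)"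
      by (rule sum.reindex_bij_betw[OF z])
    then show "(\<Sum>i<n. (hex_barrier m (z j) (z i))\<^sup>2) \<le> 4000 * (real m)\<^sup>2"
      using sum_hex_barrier_squared_le[OF m z_in] \<open>j \<in> {..<n}\<close> by simp
  qed simp
  also have "(\<Sum>j<n. 4000 * (real m)\<^sup>2) = 4000 * (real m)\<^sup>2 * real n" by simp
  also have "4000 * (real m)\<^sup>2 * real n / (\<kappa> * a0)\<^sup>2 \<le> 4000 * (real m)\<^sup>2 * (9 * (real m)\<^sup>2) / (\<kappa> * a0)\<^sup>2"
    using card_n by (intro divide_right_mono mult_left_mono) auto
  also have "\<dots> = 36000 * (real m) ^ 4 / (\<kappa> * a0)\<^sup>2" by (simp add: power2_eq_square power4_eq_xxxx)
  finally show ?thesis .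
qed

lemma eigenvalues_outside_bound:
  assumes inv: "mat_inverse P = Some H" and "\<epsilon> > 0"
  shows "real (eigenvalues_outside (map_mat complex_of_real (H * A)) (complex_of_real ` {1 - \<epsilon><..<1 + \<epsilon>})) * \<epsilon>\<^sup>2
     \<le> 1296000 * K\<^sup>2 / a0\<^sup>2"
proof -
  have H: "H \<in> carrier_mat n n" "P * H = 1\<^sub>m n" "H * P = 1\<^sub>m n" using mat_inverse(2)[OF P(1) inv] by auto
  define e where "e i j = A $$ (i,j) - P $$ (i,j)" for i j
  define M where "M i j = (\<Sum>k<n. H $$ (i,k) * e k j)" for i j
  have X: "map_mat complex_of_real (H * A) \<in> carrier_mat n n" using H A by simp
  have "real (eigenvalues_outside (map_mat complex_of_real (H * A)) (complex_of_real ` {1 - \<epsilon><..<1 + \<epsilon>})) * \<epsilon>\<^sup>2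
     \<le> (\<Sum>i<n. \<Sum>j<n. (M i j)\<^sup>2)"
  proof (rule eigenvalues_outside_le[OF X _ _ \<open>\<epsilon> > 0\<close>])
    show "spectrum (map_mat complex_of_real (H * A)) \<subseteq> \<real>" using spectrum_subset[OF inv] by auto
    fix i j assume ij: "i < n" "j < n"
    have "M i j = (\<Sum>k<n. H $$ (i,k) * A $$ (k,j)) - (\<Sum>k<n. H $$ (i,k) * P $$ (k,j))"
      by (simp add: M_def e_def right_diff_distrib sum_subtractf)
    also have "(\<Sum>k<n. H $$ (i,k) * A $$ (k,j)) = (H * A) $$ (i,j)"
      by (rule index_mult_mat_sum[OF H(1) A(1) ij, symmetric])
    also have "(\<Sum>k<n. H $$ (i,k) * P $$ (k,j)) = (H * P) $$ (i,j)"
      by (rule index_mult_mat_sum[OF H(1) P(1) ij, symmetric])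
    finally show "(map_mat complex_of_real (H * A) - 1\<^sub>m n) $$ (i, j) = complex_of_real (M i j)"
      using H A ij by (simp add: H(3))
  qed
  also have "\<dots> \<le> (6 * (\<kappa> * K / (real m)\<^sup>2))\<^sup>2 * (\<Sum>i<n. \<Sum>k<n. (H $$ (i,k))\<^sup>2)"
    unfolding M_def e_def by (rule sum_squares_matrix_mult_le) (use E_row E_col \<kappa> K in auto)
  also have "\<dots> \<le> (6 * (\<kappa> * K / (real m)\<^sup>2))\<^sup>2 * (36000 * (real m) ^ 4 / (\<kappa> * a0)\<^sup>2)"
    by (intro mult_left_mono inverse_Frobenius_bound H) auto
  \<comment> \<open>The constant is 36 * 36000. The powers of \<open>m\<close> and \<kappa> cancel,
    which is what makes the count independent of the mesh.\<close>
  also have "\<dots> = 1296000 * K\<^sup>2 / a0\<^sup>2"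
    using \<kappa> a0 m by (simp add: power_mult_distrib power_divide power2_eq_square power4_eq_xxxx)
  finally show ?thesis .
qed

end

section \<open>Twice continuously differentiable functions and symmetric means\<close>

lemma has_partial_derivative_line:
  assumes "has_partial_derivative f k d (p + t *\<^sub>R axis k 1)"
  shows "((\<lambda>s. f (p + s *\<^sub>R axis k 1)) has_real_derivative d) (at t)"
proof -
  have "((\<lambda>s. f (p + (s + t) *\<^sub>R axis k 1)) has_real_derivative d) (at 0)"
    using assms unfolding has_partial_derivative_def by (simp add: scaleR_add_left add.assoc add.commute add.left_commute)
  then show ?thesis using DERIV_shift[of "\<lambda>s. f (p + s *\<^sub>R axis k 1)" d 0 t] by simp
qed

lemma partial_increment_bound:
  fixes f :: "real^2 \<Rightarrow> real"
  assumes d: "\<And>t. t \<in> closed_segment 0 h \<Longrightarrow> has_partial_derivative f k (G (p + t *\<^sub>R axis k 1)) (p + t *\<^sub>R axis k 1)"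
    and B: "\<And>t. t \<in> closed_segment 0 h \<Longrightarrow> \<bar>G (p + t *\<^sub>R axis k 1) - g\<bar> \<le> B"
  shows "\<bar>f (p + h *\<^sub>R axis k 1) - f p - g * h\<bar> \<le> B * \<bar>h\<bar>"
proof -
  let ?\<phi> = "\<lambda>t. f (p + t *\<^sub>R axis k 1) - g * t"
  have "norm (?\<phi> h - ?\<phi> 0) \<le> B * norm (h - 0)"
  proof (rule field_differentiable_bound[of "closed_segment 0 h" ?\<phi> "\<lambda>t. G (p + t *\<^sub>R axis k 1) - g"])
    fix t assume t: "t \<in> closed_segment 0 h"
    have "((\<lambda>t. f (p + t *\<^sub>R axis k 1)) has_real_derivative G (p + t *\<^sub>R axis k 1)) (at t)"
      by (rule has_partial_derivative_line[OF d[OF t]])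
    then have "(?\<phi> has_real_derivative G (p + t *\<^sub>R axis k 1) - g) (at t)"
      by (auto intro!: derivative_eq_intros)
    then show "(?\<phi> has_real_derivative G (p + t *\<^sub>R axis k 1) - g) (at t within closed_segment 0 h)"
      by (rule has_field_derivative_at_within)
    show "norm (G (p + t *\<^sub>R axis k 1) - g) \<le> B" using B[OF t] by simp
  qed auto
  then show ?thesis by simp
qed

text \<open>The increment runs along two axis-parallel segments, so that each part involves a single
  partial derivative.\<close>

lemma has_derivative_from_partials:
  fixes f :: "real^2 \<Rightarrow> real"
  assumes S: "open S" and x: "x \<in> S"
    and d: "\<And>k y. y \<in> S \<Longrightarrow> has_partial_derivative f k (G k y) y"
    and cont: "\<And>k. continuous_on S (G k)"
  shows "(f has_derivative (\<lambda>y. G 1 x * vec_nth y 1 + G 2 x * vec_nth y 2)) (at x)"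
  unfolding has_derivative_at_alt
proof (intro conjI allI impI)
  show "bounded_linear (\<lambda>y. G 1 x * vec_nth y 1 + G 2 x * vec_nth y 2)"
    by (intro bounded_linear_add bounded_linear_const_mult bounded_linear_vec_nth)
  fix e :: real assume e: "0 < e"
  obtain r where r: "r > 0" "ball x r \<subseteq> S" using S x by (meson open_contains_ball_eq)
  have "\<exists>s>0. \<forall>y. dist y x < s \<longrightarrow> \<bar>G k y - G k x\<bar> < e / 2" for k
  proof -
    have "isCont (G k) x" using cont[of k] S x by (simp add: continuous_on_eq_continuous_at)
    then show ?thesis using e unfolding continuous_at_eps_delta dist_real_def by (meson half_gt_zero)
  qed
  then obtain s1 s2 where s: "s1 > 0" "\<And>y. dist y x < s1 \<Longrightarrow> \<bar>G 1 y - G 1 x\<bar> < e / 2"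
    "s2 > 0" "\<And>y. dist y x < s2 \<Longrightarrow> \<bar>G 2 y - G 2 x\<bar> < e / 2" by meson
  show "\<exists>d>0. \<forall>y. norm (y - x) < d \<longrightarrow>
      norm (f y - f x - (G 1 x * vec_nth (y - x) 1 + G 2 x * vec_nth (y - x) 2)) \<le> e * norm (y - x)"
  \<comment> \<open>The half leaves room for both segments, whose total length is at most twice
    \<open>norm (y - x)\<close>.\<close>
  proof (intro exI[of _ "min r (min s1 s2) / 2"] conjI allI impI)
    fix y assume y: "norm (y - x) < min r (min s1 s2) / 2"
    define h1 h2 where "h1 = vec_nth (y - x) 1" and "h2 = vec_nth (y - x) 2"
    define p where "p = x + h1 *\<^sub>R axis 1 1"
    have h: "\<bar>h1\<bar> \<le> norm (y - x)" "\<bar>h2\<bar> \<le> norm (y - x)"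
      unfolding h1_def h2_def by (rule component_le_norm_cart)+
    have yp: "y = p + h2 *\<^sub>R axis 2 1"
      by (simp add: p_def h1_def h2_def Finite_Cartesian_Product.vec_eq_iff forall_2 axis_def)
    have seg: "\<bar>t\<bar> \<le> \<bar>h\<bar>" if "t \<in> closed_segment 0 h" for t h :: real
      using that by (auto simp: closed_segment_eq_real_ivl split: if_splits)
    have near1: "dist (x + t *\<^sub>R axis 1 1) x < min r (min s1 s2)" if "t \<in> closed_segment 0 h1" for t
    proof -
      have "dist (x + t *\<^sub>R axis 1 1) x = \<bar>t\<bar>" by (simp add: dist_norm norm_axis_1)
      then show ?thesis using seg[OF that] h(1) y norm_ge_zero[of "y - x"] by linarith
    qed
    have near2: "dist (p + t *\<^sub>R axis 2 1) x < min r (min s1 s2)" if "t \<in> closed_segment 0 h2" for t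
    proof -
      have "dist (p + t *\<^sub>R axis 2 1) x = norm (h1 *\<^sub>R axis 1 1 + t *\<^sub>R axis (2::2) (1::real))"
        by (simp add: p_def dist_norm algebra_simps)
      also have "\<dots> \<le> \<bar>h1\<bar> + \<bar>t\<bar>" by (rule order.trans[OF norm_triangle_ineq]) (simp add: norm_axis_1)
      finally show ?thesis using seg[OF that] h y by linarith
    qed
    have S1: "x + t *\<^sub>R axis 1 1 \<in> S" if "t \<in> closed_segment 0 h1" for t
      using near1[OF that] r(2) by (auto simp: dist_commute)
    have S2: "p + t *\<^sub>R axis 2 1 \<in> S" if "t \<in> closed_segment 0 h2" for t
      using near2[OF that] r(2) by (auto simp: dist_commute)
    have "\<bar>f (x + h1 *\<^sub>R axis 1 1) - f x - G 1 x * h1\<bar> \<le> e / 2 * \<bar>h1\<bar>"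
    proof (rule partial_increment_bound)
      fix t assume t: "t \<in> closed_segment 0 h1"
      show "has_partial_derivative f 1 (G 1 (x + t *\<^sub>R axis 1 1)) (x + t *\<^sub>R axis 1 1)" by (rule d[OF S1[OF t]])
      show "\<bar>G 1 (x + t *\<^sub>R axis 1 1) - G 1 x\<bar> \<le> e / 2" using near1[OF t] by (intro less_imp_le s(2)) simp
    qed
    moreover have "\<bar>f (p + h2 *\<^sub>R axis 2 1) - f p - G 2 x * h2\<bar> \<le> e / 2 * \<bar>h2\<bar>"
    proof (rule partial_increment_bound)
      fix t assume t: "t \<in> closed_segment 0 h2"
      show "has_partial_derivative f 2 (G 2 (p + t *\<^sub>R axis 2 1)) (p + t *\<^sub>R axis 2 1)" by (rule d[OF S2[OF t]])
      show "\<bar>G 2 (p + t *\<^sub>R axis 2 1) - G 2 x\<bar> \<le> e / 2" using near2[OF t] by (intro less_imp_le s(4)) simp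
    qed
    moreover have "e / 2 * \<bar>h1\<bar> \<le> e / 2 * norm (y - x)" "e / 2 * \<bar>h2\<bar> \<le> e / 2 * norm (y - x)"
      using h e by (intro mult_left_mono; simp)+
    ultimately show "norm (f y - f x - (G 1 x * vec_nth (y - x) 1 + G 2 x * vec_nth (y - x) 2)) \<le> e * norm (y - x)"
      unfolding yp[symmetric] p_def[symmetric] h1_def[symmetric] h2_def[symmetric] real_norm_def by linarith
  qed (use r s in simp)
qed

text \<open>Serves twice: for the coefficient itself, and for its first partial derivatives with the
  second ones in the role of \<open>G\<close>.\<close>

lemma partials_Lipschitz:
  fixes f :: "real^2 \<Rightarrow> real"
  assumes S: "open S" "convex S"
    and d: "\<And>k y. y \<in> S \<Longrightarrow> has_partial_derivative f k (G k y) y"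
    and cont: "\<And>k. continuous_on S (G k)" and B: "\<And>k y. y \<in> S \<Longrightarrow> \<bar>G k y\<bar> \<le> B"
    and xy: "x \<in> S" "y \<in> S"
  shows "\<bar>f x - f y\<bar> \<le> 2 * B * norm (x - y)"
proof -
  have "norm (f x - f y) \<le> 2 * B * norm (x - y)"
  proof (rule differentiable_bound[OF S(2) _ _ xy, where f' = "\<lambda>w y. G 1 w * vec_nth y 1 + G 2 w * vec_nth y 2"])
    fix w assume w: "w \<in> S"
    show "(f has_derivative (\<lambda>y. G 1 w * vec_nth y 1 + G 2 w * vec_nth y 2)) (at w within S)"
      by (rule has_derivative_at_withinI, rule has_derivative_from_partials[OF S(1) w d cont])
    show "onorm (\<lambda>y::real^2. G 1 w * vec_nth y 1 + G 2 w * vec_nth y 2) \<le> 2 * B"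
    proof (rule onorm_le)
      fix h :: "real^2"
      have "\<bar>G 1 w * vec_nth h 1\<bar> \<le> B * norm h" "\<bar>G 2 w * vec_nth h 2\<bar> \<le> B * norm h"
        unfolding abs_mult using B[OF w] by (intro mult_mono component_le_norm_cart; force)+
      then show "norm (G 1 w * vec_nth h 1 + G 2 w * vec_nth h 2) \<le> 2 * B * norm h"
        unfolding real_norm_def by linarith
    qed
  qed
  then show ?thesis by simp
qed

text \<open>The derivative of t -> f (x + t y) + f (x - t y) consists of differences of the gradient
  between points at distance 2 t |y|. A Lipschitz gradient makes it O(|y|^2) on the unit interval,
  and the mean value inequality does the rest.\<close>

lemma second_difference_bound:
  fixes f :: "real^2 \<Rightarrow> real"
  assumes S: "open S" "convex S"
    and d: "\<And>k y. y \<in> S \<Longrightarrow> has_partial_derivative f k (G k y) y"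
    and cont: "\<And>k. continuous_on S (G k)"
    and L: "\<And>k x y. x \<in> S \<Longrightarrow> y \<in> S \<Longrightarrow> \<bar>G k x - G k y\<bar> \<le> L * norm (x - y)" "L \<ge> 0"
    and xy: "x + y \<in> S" "x - y \<in> S"
  shows "\<bar>f (x + y) + f (x - y) - 2 * f x\<bar> \<le> 4 * L * (norm y)\<^sup>2"
proof -
  let ?\<phi> = "\<lambda>t. f (x + t *\<^sub>R y) + f (x - t *\<^sub>R y)"
  have in_S: "x + t *\<^sub>R y \<in> S \<and> x - t *\<^sub>R y \<in> S" if "t \<in> {0..1}" for t
  proof -
    have "((1 + t) / 2) *\<^sub>R (x + y) + ((1 - t) / 2) *\<^sub>R (x - y) \<in> S"
      "((1 - t) / 2) *\<^sub>R (x + y) + ((1 + t) / 2) *\<^sub>R (x - y) \<in> S"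
      using that by (intro convexD[OF S(2) xy]; simp add: field_simps)+
    moreover have "((1 + t) / 2) *\<^sub>R (x + y) + ((1 - t) / 2) *\<^sub>R (x - y) = x + t *\<^sub>R y"
      "((1 - t) / 2) *\<^sub>R (x + y) + ((1 + t) / 2) *\<^sub>R (x - y) = x - t *\<^sub>R y"
      by (simp_all add: Finite_Cartesian_Product.vec_eq_iff field_simps)
    ultimately show ?thesis by simp
  qed
  have "norm (?\<phi> 1 - ?\<phi> 0) \<le> 4 * L * (norm y)\<^sup>2 * norm (1 - 0 :: real)"
  proof (rule field_differentiable_bound[of "{0..1}" ?\<phi> "\<lambda>t. (G 1 (x + t *\<^sub>R y) - G 1 (x - t *\<^sub>R y)) * vec_nth y 1
      + (G 2 (x + t *\<^sub>R y) - G 2 (x - t *\<^sub>R y)) * vec_nth y 2"])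
    fix t :: real assume t: "t \<in> {0..1}"
    have D: "(f has_derivative (\<lambda>u. G 1 w * vec_nth u 1 + G 2 w * vec_nth u 2)) (at w)" if "w \<in> S" for w
      by (rule has_derivative_from_partials[OF S(1) that d cont])
    have "((\<lambda>t. f (x + t *\<^sub>R y)) has_derivative (\<lambda>s. G 1 (x + t *\<^sub>R y) * vec_nth (s *\<^sub>R y) 1 + G 2 (x + t *\<^sub>R y) * vec_nth (s *\<^sub>R y) 2)) (at t)"
      by (rule has_derivative_compose[of "\<lambda>t. x + t *\<^sub>R y" "\<lambda>s. s *\<^sub>R y" t UNIV f, OF _ D])
         (use in_S[OF t] in \<open>auto intro!: derivative_eq_intros\<close>)
    moreover have "((\<lambda>t. f (x - t *\<^sub>R y)) has_derivative (\<lambda>s. G 1 (x - t *\<^sub>R y) * vec_nth (- (s *\<^sub>R y)) 1 + G 2 (x - t *\<^sub>R y) * vec_nth (- (s *\<^sub>R y)) 2)) (at t)"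
      by (rule has_derivative_compose[of "\<lambda>t. x - t *\<^sub>R y" "\<lambda>s. - (s *\<^sub>R y)" t UNIV f, OF _ D])
         (use in_S[OF t] in \<open>auto intro!: derivative_eq_intros\<close>)
    ultimately have "(?\<phi> has_derivative (\<lambda>s. (G 1 (x + t *\<^sub>R y) * vec_nth (s *\<^sub>R y) 1 + G 2 (x + t *\<^sub>R y) * vec_nth (s *\<^sub>R y) 2)
        + (G 1 (x - t *\<^sub>R y) * vec_nth (- (s *\<^sub>R y)) 1 + G 2 (x - t *\<^sub>R y) * vec_nth (- (s *\<^sub>R y)) 2))) (at t)"
      by (rule has_derivative_add)
    then have "(?\<phi> has_real_derivative (G 1 (x + t *\<^sub>R y) - G 1 (x - t *\<^sub>R y)) * vec_nth y 1
      + (G 2 (x + t *\<^sub>R y) - G 2 (x - t *\<^sub>R y)) * vec_nth y 2) (at t)"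
      unfolding has_field_derivative_def by (rule has_derivative_eq_rhs) (simp add: fun_eq_iff algebra_simps)
    then show "(?\<phi> has_real_derivative (G 1 (x + t *\<^sub>R y) - G 1 (x - t *\<^sub>R y)) * vec_nth y 1
      + (G 2 (x + t *\<^sub>R y) - G 2 (x - t *\<^sub>R y)) * vec_nth y 2) (at t within {0..1})"
      by (rule has_field_derivative_at_within)
    have "\<bar>(G k (x + t *\<^sub>R y) - G k (x - t *\<^sub>R y)) * vec_nth y k\<bar> \<le> 2 * L * (norm y)\<^sup>2" for k
    proof -
      have "x + t *\<^sub>R y - (x - t *\<^sub>R y) = (2 * t) *\<^sub>R y" by (simp add: Finite_Cartesian_Product.vec_eq_iff)
      then have "norm (x + t *\<^sub>R y - (x - t *\<^sub>R y)) = 2 * t * norm y" using t by simp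
      then have "\<bar>G k (x + t *\<^sub>R y) - G k (x - t *\<^sub>R y)\<bar> \<le> L * (2 * t * norm y)"
        using L(1)[of "x + t *\<^sub>R y" "x - t *\<^sub>R y" k] in_S[OF t] by simp
      also have "\<dots> \<le> L * (2 * 1 * norm y)" using t L(2) by (intro mult_left_mono mult_right_mono) auto
      finally have "\<bar>G k (x + t *\<^sub>R y) - G k (x - t *\<^sub>R y)\<bar> \<le> 2 * L * norm y" by simp
      then have "\<bar>G k (x + t *\<^sub>R y) - G k (x - t *\<^sub>R y)\<bar> * \<bar>vec_nth y k\<bar> \<le> (2 * L * norm y) * norm y"
        using L(2) by (intro mult_mono component_le_norm_cart) auto
      then show ?thesis by (simp add: abs_mult power2_eq_square)
    qed
    from this[of 1] this[of 2]
    show "norm ((G 1 (x + t *\<^sub>R y) - G 1 (x - t *\<^sub>R y)) * vec_nth y 1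
      + (G 2 (x + t *\<^sub>R y) - G 2 (x - t *\<^sub>R y)) * vec_nth y 2) \<le> 4 * L * (norm y)\<^sup>2"
      unfolding real_norm_def by linarith
  qed auto
  then show ?thesis by simp
qed

text \<open>Compactness of the closure turns the continuous extensions of the derivatives into
  uniform bounds, and convexity turns these into Lipschitz bounds. The resulting constant depends on
  the coefficient and the hexagon alone, never on a mesh.\<close>

lemma C2_closure_bounds:
  assumes S: "open S" "convex S" "bounded S" and f: "C2_closure S f"
  obtains M where "M \<ge> 0" "\<And>x y. x \<in> S \<Longrightarrow> y \<in> S \<Longrightarrow> \<bar>f x - f y\<bar> \<le> M * norm (x - y)"
    "\<And>x y. x + y \<in> S \<Longrightarrow> x - y \<in> S \<Longrightarrow> \<bar>f (x + y) + f (x - y) - 2 * f x\<bar> \<le> M * (norm y)\<^sup>2"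
proof -
  obtain G :: "2 \<Rightarrow> real^2 \<Rightarrow> real" and H :: "2 \<Rightarrow> 2 \<Rightarrow> real^2 \<Rightarrow> real" where
    G: "\<And>k. continuous_on (closure S) (G k)" "\<And>k x. x \<in> S \<Longrightarrow> has_partial_derivative f k (G k x) x"
    and H: "\<And>j k. continuous_on (closure S) (H j k)" "\<And>j k x. x \<in> S \<Longrightarrow> has_partial_derivative (G k) j (H j k x) x"
    using f unfolding C2_closure_def by blast
  have comp: "compact (closure S)" using S(3) by (simp add: compact_closure)
  have bd: "\<exists>B. \<forall>x\<in>S. \<bar>g x\<bar> \<le> B" if "continuous_on (closure S) g" for g :: "real^2 \<Rightarrow> real"
  proof -
    have "bounded (g ` closure S)" by (intro compact_imp_bounded compact_continuous_image that comp)
    then obtain B where "\<forall>x\<in>closure S. \<bar>g x\<bar> \<le> B" unfolding bounded_iff by auto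
    then show ?thesis using closure_subset by blast
  qed
  obtain BG where BG: "\<And>k x. x \<in> S \<Longrightarrow> \<bar>G k x\<bar> \<le> BG k" using bd[OF G(1)] by metis
  obtain BH where BH: "\<And>j k x. x \<in> S \<Longrightarrow> \<bar>H j k x\<bar> \<le> BH j k" using bd[OF H(1)] by metis
  define B where "B = (\<Sum>k\<in>UNIV. \<bar>BG k\<bar>) + (\<Sum>k\<in>UNIV. \<Sum>j\<in>UNIV. \<bar>BH j k\<bar>)"
  have "\<bar>BG k\<bar> \<le> (\<Sum>k\<in>UNIV. \<bar>BG k\<bar>)" for k by (rule member_le_sum) auto
  moreover have "\<bar>BH j k\<bar> \<le> (\<Sum>k\<in>UNIV. \<Sum>j\<in>UNIV. \<bar>BH j k\<bar>)" for j k
  proof -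
    have "\<bar>BH j k\<bar> \<le> (\<Sum>j\<in>UNIV. \<bar>BH j k\<bar>)" by (rule member_le_sum) auto
    also have "\<dots> \<le> (\<Sum>k\<in>UNIV. \<Sum>j\<in>UNIV. \<bar>BH j k\<bar>)" by (rule member_le_sum) (auto intro: sum_nonneg)
    finally show ?thesis .
  qed
  moreover have nn: "0 \<le> (\<Sum>k\<in>UNIV. \<bar>BG k\<bar>)" "0 \<le> (\<Sum>k\<in>UNIV. \<Sum>j\<in>UNIV. \<bar>BH j k\<bar>)" by (auto intro: sum_nonneg)
  ultimately have "BG k \<le> B" "BH j k \<le> B" for j k unfolding B_def by (smt (verit))+
  then have B: "\<And>k x. x \<in> S \<Longrightarrow> \<bar>G k x\<bar> \<le> B" "\<And>j k x. x \<in> S \<Longrightarrow> \<bar>H j k x\<bar> \<le> B"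
    using BG BH order.trans by blast+
  have B0: "B \<ge> 0" using nn by (simp add: B_def)
  have cG: "continuous_on S (G k)" for k by (rule continuous_on_subset[OF G(1) closure_subset])
  have cH: "continuous_on S (H j k)" for j k by (rule continuous_on_subset[OF H(1) closure_subset])
  have LG: "\<bar>G k x - G k y\<bar> \<le> 2 * B * norm (x - y)" if "x \<in> S" "y \<in> S" for k x y
    by (rule partials_Lipschitz[OF S(1,2) H(2) cH B(2) that])
  show thesis
  \<comment> \<open>The first partials have the Lipschitz constant 2 B, which enters
    \<open>second_difference_bound\<close> with the factor 4.\<close>
  proof (rule that[of "8 * B"])
    fix x y assume xy: "x \<in> S" "y \<in> S"
    have "\<bar>f x - f y\<bar> \<le> 2 * B * norm (x - y)" by (rule partials_Lipschitz[OF S(1,2) G(2) cG B(1) xy])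
    also have "\<dots> \<le> 8 * B * norm (x - y)" using B0 by (intro mult_right_mono) auto
    finally show "\<bar>f x - f y\<bar> \<le> 8 * B * norm (x - y)" .
  next
    fix x y assume xy: "x + y \<in> S" "x - y \<in> S"
    have "\<bar>f (x + y) + f (x - y) - 2 * f x\<bar> \<le> 4 * (2 * B) * (norm y)\<^sup>2"
      by (rule second_difference_bound[OF S(1,2) G(2) cG LG _ xy]) (use B0 in auto)
    then show "\<bar>f (x + y) + f (x - y) - 2 * f x\<bar> \<le> 8 * B * (norm y)\<^sup>2" by simp
  qed (use B0 in simp)
qed

section \<open>Averages over centrally symmetric sets\<close>

lemma integral_point_reflection:
  fixes g :: "'a::euclidean_space \<Rightarrow> real"
  assumes "g \<in> borel_measurable borel"
  shows "(\<integral>x. g (w - x) \<partial>lborel) = (\<integral>x. g x \<partial>lborel)"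
proof -
  have "(lborel :: 'a measure) = distr lborel borel (\<lambda>x. w + (-1) *\<^sub>R x)"
    using lborel_affine[of "-1" w] by (simp add: density_1)
  then have "(\<integral>x. g x \<partial>lborel) = (\<integral>x. g x \<partial>distr lborel borel (\<lambda>x. w + (-1) *\<^sub>R x))" by simp
  also have "\<dots> = (\<integral>x. g (w - x) \<partial>lborel)"
    using assms by (subst integral_distr) auto
  finally show ?thesis ..
qed

text \<open>Point reflection in \<open>w\<close> preserves \<open>D\<close> and Lebesgue measure, so
  twice the integral of \<open>f\<close> is the integral of \<open>f\<close> plus its reflection.
  First-order terms cancel in that sum, and the error is governed by second differences
  alone.\<close>

lemma symmetric_mean_approx:
  fixes f :: "'a::euclidean_space \<Rightarrow> real"
  assumes D: "open D" "D \<in> lmeasurable" and sym: "\<And>x. x \<in> D \<Longrightarrow> 2 *\<^sub>R w - x \<in> D"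
    and cont: "continuous_on D f" and int: "set_integrable lebesgue D f"
    and K: "\<And>x. x \<in> D \<Longrightarrow> \<bar>f x + f (2 *\<^sub>R w - x) - 2 * f w\<bar> \<le> K"
  shows "\<bar>(LINT x:D|lebesgue. f x) - measure lebesgue D * f w\<bar> \<le> measure lebesgue D * (K / 2)"
proof -
  define g where "g x = indicator D x *\<^sub>R f x" for x
  have gm: "g \<in> borel_measurable borel"
    unfolding g_def by (rule borel_measurable_continuous_on_indicator) (use D cont in auto)
  have leb: "(\<integral>x. k x \<partial>lebesgue) = (\<integral>x. k x \<partial>lborel)" if "k \<in> borel_measurable borel" for k :: "'a \<Rightarrow> real"
    using that by (intro integral_completion) simp
  have gi: "integrable lborel g" using int gm unfolding set_integrable_def g_def[symmetric]
    by (simp add: integrable_completion)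
  have rm: "(\<lambda>x. g (2 *\<^sub>R w - x)) \<in> borel_measurable borel" using gm by measurable
  have gir: "integrable lborel (\<lambda>x. g (2 *\<^sub>R w - x))"
  proof -
    have "(lborel :: 'a measure) = distr lborel borel (\<lambda>x. 2 *\<^sub>R w + (-1) *\<^sub>R x)"
      using lborel_affine[of "-1" "2 *\<^sub>R w"] by (simp add: density_1)
    then have "integrable (distr lborel borel (\<lambda>x. 2 *\<^sub>R w + (-1) *\<^sub>R x)) g" using gi by simp
    then show ?thesis using gm by (subst (asm) integrable_distr_eq) auto
  qed
  have Dm: "measure lborel D = measure lebesgue D" using D(1) by (simp add: measure_completion)
  have Di: "integrable lborel (indicator D :: 'a \<Rightarrow> real)"
    using D by (auto simp: lmeasurable_iff_integrable integrable_completion)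
  have Dint: "(\<integral>x. indicator D x \<partial>lborel) = measure lebesgue D" using Dm by simp
  define I where "I = (LINT x:D|lebesgue. f x)"
  have I: "I = (\<integral>x. g x \<partial>lborel)" unfolding I_def set_lebesgue_integral_def g_def[symmetric] by (rule leb[OF gm])
  have symD: "indicator D (2 *\<^sub>R w - x) = (indicator D x :: real)" for x
    using sym[of x] sym[of "2 *\<^sub>R w - x"] by (auto simp: indicator_def)
  have "2 * I - 2 * (measure lebesgue D * f w) = (\<integral>x. g x + g (2 *\<^sub>R w - x) - 2 * f w * indicator D x \<partial>lborel)"
    using gi gir Di by (simp add: I integral_point_reflection[OF gm] Dm)
  also have "\<bar>\<dots>\<bar> \<le> (\<integral>x. K * indicator D x \<partial>lborel)"
  proof (rule integral_abs_bound_integral)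
    show "integrable lborel (\<lambda>x. g x + g (2 *\<^sub>R w - x) - 2 * f w * indicator D x)" "integrable lborel (\<lambda>x. K * indicator D x)"
      using gi gir Di by (auto intro!: Bochner_Integration.integrable_diff Bochner_Integration.integrable_add integrable_mult_right)
    fix x
    show "\<bar>g x + g (2 *\<^sub>R w - x) - 2 * f w * indicator D x\<bar> \<le> K * indicator D x"
      using K[of x] unfolding g_def symD by (simp add: indicator_def)
  qed
  also have "\<dots> = K * measure lebesgue D" by (simp add: Dm)
  finally have "\<bar>2 * I - 2 * (measure lebesgue D * f w)\<bar> \<le> K * measure lebesgue D" .
  moreover have "K * measure lebesgue D = 2 * (measure lebesgue D * (K / 2))" by simp
  ultimately show ?thesis unfolding I_def[symmetric] abs_le_iff by linarith
qed

section \<open>Affine geometry of the hexagon and its mesh\<close>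

text \<open>A point of the closed set is approached along the segment to \<open>z\<close>, on which
  every functional is a convex combination of a nonpositive and a negative value. Applied to the
  hexagon and to the mesh triangles.\<close>

lemma closure_strict_affine_sublevel:
  fixes F :: "('a::euclidean_space \<Rightarrow> real) set"
  assumes aff: "\<And>f. f \<in> F \<Longrightarrow> \<exists>b \<beta>. \<forall>x. f x = inner b x + \<beta>"
    and z: "\<And>f. f \<in> F \<Longrightarrow> f z < 0"
  shows "closure {x. \<forall>f\<in>F. f x < 0} = {x. \<forall>f\<in>F. f x \<le> 0}"
proof
  have "closed {x. f x \<le> 0}" if f: "f \<in> F" for f
  proof -
    obtain b \<beta> where "f x = inner b x + \<beta>" for x using aff[OF f] by blast
    then have "f = (\<lambda>x. inner b x + \<beta>)" by blast
    then show ?thesis by (auto intro!: closed_Collect_le continuous_intros)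
  qed
  then have "closed (\<Inter>f\<in>F. {x. f x \<le> 0})" by blast
  moreover have "(\<Inter>f\<in>F. {x. f x \<le> 0}) = {x. \<forall>f\<in>F. f x \<le> 0}" by blast
  ultimately show "closure {x. \<forall>f\<in>F. f x < 0} \<subseteq> {x. \<forall>f\<in>F. f x \<le> 0}"
    by (intro closure_minimal) (auto simp: less_imp_le)
next
  show "{x. \<forall>f\<in>F. f x \<le> 0} \<subseteq> closure {x. \<forall>f\<in>F. f x < 0}"
  proof
    fix x assume x: "x \<in> {x. \<forall>f\<in>F. f x \<le> 0}"
    define g where "g n = x + (1 / real (Suc n)) *\<^sub>R (z - x)" for n
    have "g n \<in> {x. \<forall>f\<in>F. f x < 0}" for n
    proof safe
      fix f assume f: "f \<in> F"
      obtain b \<beta> where b: "f y = inner b y + \<beta>" for y using aff[OF f] by blast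
      define t where "t = 1 / real (Suc n)"
      have t: "0 < t" "t \<le> 1" by (auto simp: t_def)
      have gn: "g n = x + t *\<^sub>R (z - x)" by (simp add: g_def t_def)
      have "f (g n) = (1 - t) * f x + t * f z"
        unfolding b gn by (simp add: inner_add_right inner_diff_right algebra_simps)
      also have "\<dots> < 0"
        using t x f z[OF f] by (intro add_nonpos_neg mult_nonneg_nonpos mult_pos_neg) auto
      finally show "f (g n) < 0" .
    qed
    moreover have "g \<longlonglongrightarrow> x + 0 *\<^sub>R (z - x)"
      unfolding g_def by (intro tendsto_intros LIMSEQ_Suc[OF lim_1_over_n])
    ultimately show "x \<in> closure {x. \<forall>f\<in>F. f x < 0}"
      unfolding closure_sequential by (intro exI[of _ g]) auto
  qed
qed

lemma open_strict_sublevel: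
  fixes F :: "('a::euclidean_space \<Rightarrow> real) set"
  assumes "finite F" and aff: "\<And>f. f \<in> F \<Longrightarrow> \<exists>b \<beta>. \<forall>x. f x = inner b x + \<beta>"
  shows "open {x. \<forall>f\<in>F. f x < 0}"
proof -
  have "open {x. f x < 0}" if f: "f \<in> F" for f
  proof -
    obtain b \<beta> where "f x = inner b x + \<beta>" for x using aff[OF f] by blast
    then have "f = (\<lambda>x. inner b x + \<beta>)" by blast
    then show ?thesis by (auto intro!: open_Collect_less continuous_intros)
  qed
  then have "open (\<Inter>f\<in>F. {x. f x < 0})" using \<open>finite F\<close> by blast
  moreover have "(\<Inter>f\<in>F. {x. f x < 0}) = {x. \<forall>f\<in>F. f x < 0}" by blast
  ultimately show ?thesis by simp
qed

lemma convex_strict_sublevel: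
  fixes F :: "('a::euclidean_space \<Rightarrow> real) set"
  assumes aff: "\<And>f. f \<in> F \<Longrightarrow> \<exists>b \<beta>. \<forall>x. f x = inner b x + \<beta>"
  shows "convex {x. \<forall>f\<in>F. f x < 0}"
proof -
  have "convex {x. f x < 0}" if f: "f \<in> F" for f
  proof -
    obtain b \<beta> where "f x = inner b x + \<beta>" for x using aff[OF f] by blast
    then have "{x. f x < 0} = {x. inner b x < - \<beta>}" by auto
    then show ?thesis by (simp add: convex_halfspace_lt)
  qed
  then have "convex (\<Inter>f\<in>F. {x. f x < 0})" by (intro convex_INT) blast
  moreover have "(\<Inter>f\<in>F. {x. f x < 0}) = {x. \<forall>f\<in>F. f x < 0}" by blast
  ultimately show ?thesis by simp
qed

lemma triangle_subset_hull:
  fixes a b d :: "'a::real_vector"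
  assumes "a \<in> convex hull S" "b \<in> convex hull S" "d \<in> convex hull S"
    and "\<alpha> \<ge> 0" "\<beta> \<ge> 0" "\<alpha> + \<beta> \<le> 1"
  shows "a + \<alpha> *\<^sub>R (b - a) + \<beta> *\<^sub>R (d - a) \<in> convex hull S"
proof -
  have "a + \<alpha> *\<^sub>R (b - a) + \<beta> *\<^sub>R (d - a) \<in> convex hull {a, b, d}"
    unfolding convex_hull_3 mem_Collect_eq
    by (rule exI[of _ "1 - \<alpha> - \<beta>"], rule exI[of _ \<alpha>], rule exI[of _ \<beta>])
       (use assms in \<open>auto simp: algebra_simps\<close>)
  moreover have "convex hull {a, b, d} \<subseteq> convex hull S"
    using assms by (intro hull_minimal) auto
  ultimately show ?thesis by blast
qed

text \<open>A nonpositive affine function that vanishes inside a segment vanishes at both of its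
  ends. Two such functions with only one common zero leave no segment around that point.\<close>

lemma extreme_point_of_affine_face:
  fixes T :: "'a::euclidean_space set"
  assumes x: "x \<in> T"
    and f: "\<And>y. y \<in> T \<Longrightarrow> inner b y + \<beta> \<le> 0" "inner b x + \<beta> = 0"
    and g: "\<And>y. y \<in> T \<Longrightarrow> inner d y + \<gamma> \<le> 0" "inner d x + \<gamma> = 0"
    and uniq: "\<And>y. inner b y + \<beta> = 0 \<Longrightarrow> inner d y + \<gamma> = 0 \<Longrightarrow> y = x"
  shows "x extreme_point_of T"
  unfolding extreme_point_of_def
proof (intro conjI x ballI notI)
  fix p q assume pq: "p \<in> T" "q \<in> T" and "x \<in> open_segment p q"
  then obtain u where u: "0 < u" "u < 1" and xu: "x = (1 - u) *\<^sub>R p + u *\<^sub>R q" and ne: "p \<noteq> q"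
    by (auto simp: in_segment)
  have *: "inner k p + \<kappa> = 0 \<and> inner k q + \<kappa> = 0"
    if "inner k p + \<kappa> \<le> 0" "inner k q + \<kappa> \<le> 0" "inner k x + \<kappa> = 0" for k \<kappa>
  proof -
    have "(1 - u) * (inner k p + \<kappa>) + u * (inner k q + \<kappa>) = 0"
      using that(3) by (simp add: xu inner_add_right algebra_simps)
    moreover have "(1 - u) * (inner k p + \<kappa>) \<le> 0" "u * (inner k q + \<kappa>) \<le> 0"
      using u that by (auto intro: mult_nonneg_nonpos)
    ultimately have "(1 - u) * (inner k p + \<kappa>) = 0" "u * (inner k q + \<kappa>) = 0" by linarith+
    then show ?thesis using u by auto
  qed
  have "p = x" "q = x" using *[of b \<beta>] *[of d \<gamma>] f g pq uniq by blast+
  then show False using ne by simp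
qed

section \<open>Lattice coordinates on the hexagon\<close>

definition rhexnorm :: "real \<Rightarrow> real \<Rightarrow> real" where
  "rhexnorm s t = max \<bar>s\<bar> (max \<bar>t\<bar> \<bar>s + t\<bar>)"

lemma rhexnorm_le_iff: "rhexnorm s t \<le> r \<longleftrightarrow> \<bar>s\<bar> \<le> r \<and> \<bar>t\<bar> \<le> r \<and> \<bar>s + t\<bar> \<le> r"
  by (auto simp: rhexnorm_def)

lemma rhexnorm_less_iff: "rhexnorm s t < r \<longleftrightarrow> \<bar>s\<bar> < r \<and> \<bar>t\<bar> < r \<and> \<bar>s + t\<bar> < r"
  by (auto simp: rhexnorm_def)

lemma rhexnorm_of_int: "rhexnorm (of_int p) (of_int q) = of_int (hexnorm (p, q))"
  by (simp add: rhexnorm_def hexnorm_def of_int_max)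

text \<open>\<open>e1\<close> and \<open>e2\<close> are edge vectors of the mesh; \<open>b1\<close>
  and \<open>b2\<close> form the dual basis and are thus the gradients of the lattice coordinates.
  The Gram conditions encode equilateral triangles: dual vectors of equal length at an angle of 120
  degrees. \<open>v 6 = v 0\<close> closes the hexagon for the side that starts at
  \<open>v 5\<close>.\<close>

locale hexagon_mesh =
  fixes v :: "nat \<Rightarrow> real^2" and m :: nat and c e1 e2 b1 b2 :: "real^2" and \<rho> :: real
  assumes m: "m \<ge> 1"
    and dual: "inner b1 e1 = 1" "inner b1 e2 = 0" "inner b2 e1 = 0" "inner b2 e2 = 1"
    and expand: "\<And>y. y = inner b1 y *\<^sub>R e1 + inner b2 y *\<^sub>R e2"
    and gram: "inner b1 b1 = \<rho>" "inner b2 b2 = \<rho>" "inner b1 b2 = - \<rho> / 2"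
    and rho: "\<rho> > 0"
    and vertices: "v 0 = c + real m *\<^sub>R e1" "v 1 = c + real m *\<^sub>R e2"
      "v 2 = c + real m *\<^sub>R (e2 - e1)" "v 3 = c - real m *\<^sub>R e1" "v 4 = c - real m *\<^sub>R e2"
      "v 5 = c + real m *\<^sub>R (e1 - e2)" "v 6 = v 0"
begin

text \<open>Coordinates centred at \<open>c\<close> in units of the mesh width. The three families
  of lattice lines are the sets where \<open>sg\<close>, \<open>tu\<close> or \<open>sg + tu\<close>
  is a fixed integer.\<close>

definition sg :: "real^2 \<Rightarrow> real" where "sg x = inner b1 (x - c)"
definition tu :: "real^2 \<Rightarrow> real" where "tu x = inner b2 (x - c)"
definition pt :: "real \<Rightarrow> real \<Rightarrow> real^2" where "pt s t = c + s *\<^sub>R e1 + t *\<^sub>R e2"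
definition node :: "int \<times> int \<Rightarrow> real^2" where "node p = pt (of_int (fst p)) (of_int (snd p))"

lemma sg_pt [simp]: "sg (pt s t) = s" and tu_pt [simp]: "tu (pt s t) = t"
  by (simp_all add: sg_def tu_def pt_def inner_add_right dual algebra_simps)

lemma sg_affine: "sg x = inner b1 x + (- inner b1 c)" and tu_affine: "tu x = inner b2 x + (- inner b2 c)"
  by (simp_all add: sg_def tu_def inner_diff_right)

lemma pt_sg_tu: "pt (sg x) (tu x) = x"
proof -
  have "x - c = sg x *\<^sub>R e1 + tu x *\<^sub>R e2" unfolding sg_def tu_def by (rule expand)
  then show ?thesis by (simp add: pt_def algebra_simps)
qed

lemma coord_eqI: "sg x = sg y \<Longrightarrow> tu x = tu y \<Longrightarrow> x = y"
  by (metis pt_sg_tu)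

lemma sg_node [simp]: "sg (node p) = of_int (fst p)" and tu_node [simp]: "tu (node p) = of_int (snd p)"
  by (simp_all add: node_def)

lemma node_eq_iff [simp]: "node p = node q \<longleftrightarrow> p = q"
proof
  assume "node p = node q"
  then have "sg (node p) = sg (node q)" "tu (node p) = tu (node q)" by simp_all
  then show "p = q" by (simp add: prod_eq_iff)
qed simp

lemma continuous_on_sg [continuous_intros]: "continuous_on S sg"
  and continuous_on_tu [continuous_intros]: "continuous_on S tu"
  unfolding sg_def tu_def by (intro continuous_intros)+

lemma sg_add_scaleR: "sg (x + r *\<^sub>R y) = sg x + r * inner b1 y"
  and tu_add_scaleR: "tu (x + r *\<^sub>R y) = tu x + r * inner b2 y"
  by (simp_all add: sg_affine tu_affine inner_add_right)

lemma vertex_coords: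
  "sg (v 0) = m" "tu (v 0) = 0" "sg (v 1) = 0" "tu (v 1) = m" "sg (v 2) = - real m" "tu (v 2) = m"
  "sg (v 3) = - real m" "tu (v 3) = 0" "sg (v 4) = 0" "tu (v 4) = - real m"
  "sg (v 5) = m" "tu (v 5) = - real m"
  unfolding vertices sg_def tu_def by (simp_all add: inner_diff_right dual)

definition hex_open :: "(real^2) set" where "hex_open = {x. rhexnorm (sg x) (tu x) < real m}"
definition hex_closed :: "(real^2) set" where "hex_closed = {x. rhexnorm (sg x) (tu x) \<le> real m}"

definition hex_functionals :: "(real^2 \<Rightarrow> real) set" where
  "hex_functionals = {\<lambda>x. sg x - m, \<lambda>x. - sg x - m, \<lambda>x. tu x - m, \<lambda>x. - tu x - m,
     \<lambda>x. sg x + tu x - m, \<lambda>x. - (sg x + tu x) - m}"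

lemma affine_functionals:
  "\<exists>b \<beta>. \<forall>x. \<alpha> * sg x + \<gamma> * tu x + \<delta> = inner b x + \<beta>"
  by (intro exI[of _ "\<alpha> *\<^sub>R b1 + \<gamma> *\<^sub>R b2"] exI[of _ "- \<alpha> * inner b1 c - \<gamma> * inner b2 c + \<delta>"])
     (simp add: sg_affine tu_affine inner_add_left algebra_simps)

lemma hex_functionals_affine: "f \<in> hex_functionals \<Longrightarrow> \<exists>b \<beta>. \<forall>x. f x = inner b x + \<beta>"
  using affine_functionals[of 1 0 "- real m"] affine_functionals[of "-1" 0 "- real m"]
    affine_functionals[of 0 1 "- real m"] affine_functionals[of 0 "-1" "- real m"]
    affine_functionals[of 1 1 "- real m"] affine_functionals[of "-1" "-1" "- real m"]
  by (auto simp: hex_functionals_def)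

lemma hex_open_eq: "hex_open = {x. \<forall>f\<in>hex_functionals. f x < 0}"
  and hex_closed_eq: "hex_closed = {x. \<forall>f\<in>hex_functionals. f x \<le> 0}"
  by (auto simp: hex_open_def hex_closed_def hex_functionals_def rhexnorm_less_iff rhexnorm_le_iff)

lemma open_hex_open: "open hex_open"
  unfolding hex_open_eq
  by (rule open_strict_sublevel) (use hex_functionals_affine in \<open>auto simp: hex_functionals_def\<close>)

lemma convex_hex_open: "convex hex_open"
  unfolding hex_open_eq by (rule convex_strict_sublevel) (rule hex_functionals_affine)

lemma closure_hex_open: "closure hex_open = hex_closed"
  unfolding hex_open_eq hex_closed_eq
  by (rule closure_strict_affine_sublevel[of _ c])
     (use m hex_functionals_affine in \<open>auto simp: hex_functionals_def sg_def tu_def\<close>)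

lemma convex_hull_vertices: "convex hull (v ` {..<6}) = hex_closed"
proof
  have "convex hex_closed" using convex_hex_open closure_hex_open convex_closure by metis
  moreover have "v ` {..<6} \<subseteq> hex_closed"
  proof
    fix x assume "x \<in> v ` {..<6}"
    then obtain k where "x = v k" "k < 6" by auto
    then have "k = 0 \<or> k = 1 \<or> k = 2 \<or> k = 3 \<or> k = 4 \<or> k = 5" by linarith
    then show "x \<in> hex_closed"
      using \<open>x = v k\<close> by (elim disjE) (simp_all only: hex_closed_def mem_Collect_eq rhexnorm_le_iff vertex_coords, simp_all)
  qed
  ultimately show "convex hull (v ` {..<6}) \<subseteq> hex_closed" by (intro hull_minimal)
next
  let ?H = "convex hull (v ` {..<6})"
  have vH: "v k \<in> ?H" if "k < 6" for k using that by (intro hull_inc) auto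
  have "v 0 + (1/2) *\<^sub>R (v 3 - v 0) + 0 *\<^sub>R (v 3 - v 0) \<in> ?H"
    by (rule triangle_subset_hull) (auto intro: vH)
  also have "v 0 + (1/2) *\<^sub>R (v 3 - v 0) + 0 *\<^sub>R (v 3 - v 0) = c"
    by (simp add: vertices algebra_simps flip: scaleR_add_left)
  finally have cH: "c \<in> ?H" .
  show "hex_closed \<subseteq> ?H"
  proof
    fix x assume x: "x \<in> hex_closed"
    define s t where "s = sg x" and "t = tu x"
    have st: "\<bar>s\<bar> \<le> m" "\<bar>t\<bar> \<le> m" "\<bar>s + t\<bar> \<le> m"
      using x by (auto simp: hex_closed_def rhexnorm_le_iff s_def t_def)
    \<comment> \<open>In the sector between two adjacent vertices \<open>x\<close> is a convex
      combination of the centre and these vertices, with weights \<alpha> / m and \<beta> / m for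
      the latter.\<close>
    have sec: "x \<in> ?H"
      if "k < 6" "l < 6" "\<alpha> \<ge> 0" "\<beta> \<ge> 0" "\<alpha> + \<beta> \<le> real m"
        "m * s = \<alpha> * sg (v k) + \<beta> * sg (v l)" "m * t = \<alpha> * tu (v k) + \<beta> * tu (v l)" for k l \<alpha> \<beta>
    proof -
      have "c + (\<alpha> / m) *\<^sub>R (v k - c) + (\<beta> / m) *\<^sub>R (v l - c) \<in> ?H"
        using that m cH vH by (intro triangle_subset_hull) (auto simp: field_simps)
      also have "c + (\<alpha> / m) *\<^sub>R (v k - c) + (\<beta> / m) *\<^sub>R (v l - c) = x"
        by (rule coord_eqI; unfold sg_add_scaleR tu_add_scaleR sg_def[symmetric] tu_def[symmetric])
           (use that(6,7) m in \<open>simp_all add: field_simps s_def t_def sg_def[of c] tu_def[of c]\<close>)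
      finally show ?thesis .
    qed
    consider "s \<ge> 0" "t \<ge> 0" | "s \<le> 0" "t \<ge> 0" "s + t \<ge> 0" | "s \<le> 0" "t \<ge> 0" "s + t \<le> 0"
      | "s \<le> 0" "t \<le> 0" | "s \<ge> 0" "t \<le> 0" "s + t \<le> 0" | "s \<ge> 0" "t \<le> 0" "s + t \<ge> 0" by linarith
    then show "x \<in> ?H"
    proof cases
      case 1 show ?thesis by (rule sec[of 0 1 s t]) (use 1 st in \<open>simp_all only: vertex_coords, simp_all\<close>)
    next
      case 2 show ?thesis by (rule sec[of 1 2 "s + t" "- s"]) (use 2 st in \<open>simp_all only: vertex_coords, simp_all add: algebra_simps\<close>)
    next
      case 3 show ?thesis by (rule sec[of 2 3 t "- s - t"]) (use 3 st in \<open>simp_all only: vertex_coords, simp_all add: algebra_simps\<close>)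
    next
      case 4 show ?thesis by (rule sec[of 3 4 "- s" "- t"]) (use 4 st in \<open>simp_all only: vertex_coords, simp_all add: algebra_simps\<close>)
    next
      case 5 show ?thesis by (rule sec[of 4 5 "- s - t" s]) (use 5 st in \<open>simp_all only: vertex_coords, simp_all add: algebra_simps\<close>)
    next
      case 6 show ?thesis by (rule sec[of 5 0 "- t" "s + t"]) (use 6 st in \<open>simp_all only: vertex_coords, simp_all add: algebra_simps\<close>)
    qed
  qed
qed

lemma hex_domain_eq: "hex_domain v = hex_open"
  unfolding hex_domain_def convex_hull_vertices closure_hex_open[symmetric]
  using convex_interior_closure[OF convex_hex_open] open_hex_open by (simp add: interior_open)

lemma closure_hex_domain: "closure (hex_domain v) = hex_closed"
  by (simp add: hex_domain_eq closure_hex_open)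

lemma frontier_hex_domain: "frontier (hex_domain v) = hex_closed - hex_open"
  by (simp add: frontier_def hex_domain_eq closure_hex_open interior_open[OF open_hex_open])

text \<open>Refers to the lattice lines of the whole plane; inside the open hexagon these are
  precisely the drawn lines, by \<open>hex_minus_mesh_lines\<close>.\<close>

definition regular_pt :: "real^2 \<Rightarrow> bool" where
  "regular_pt x \<longleftrightarrow> sg x \<notin> \<int> \<and> tu x \<notin> \<int> \<and> sg x + tu x \<notin> \<int>"

lemma division_point_coords:
  assumes "q \<in> division_points v m"
  shows "sg q \<in> \<int> \<and> tu q \<in> \<int>"
proof -
  obtain k j where q: "q = v k + (real j / real m) *\<^sub>R (v (k + 1) - v k)" and "k < 6" "j \<le> m"
    using assms by (auto simp: division_points_def)
  have d: "sg q = sg (v k) + (j / m) * (sg (v (k + 1)) - sg (v k))"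
    "tu q = tu (v k) + (j / m) * (tu (v (k + 1)) - tu (v k))"
    by (simp_all add: q sg_affine tu_affine inner_add_right inner_diff_right)
  have "k = 0 \<or> k = 1 \<or> k = 2 \<or> k = 3 \<or> k = 4 \<or> k = 5" using \<open>k < 6\<close> by linarith
  then show ?thesis
    unfolding d using m
    by (elim disjE) (simp_all add: vertex_coords[simplified] vertices(7) numeral_2_eq_2[symmetric])
qed


lemma side_direction:
  assumes "k < 6"
  shows "inner b1 (v (k + 1) - v k) = 0 \<or> inner b2 (v (k + 1) - v k) = 0
    \<or> inner b1 (v (k + 1) - v k) + inner b2 (v (k + 1) - v k) = 0"
proof -
  have d: "inner b1 (v (k + 1) - v k) = sg (v (k + 1)) - sg (v k)"
    "inner b2 (v (k + 1) - v k) = tu (v (k + 1)) - tu (v k)"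
    by (simp_all add: sg_affine tu_affine inner_diff_right)
  have "k = 0 \<or> k = 1 \<or> k = 2 \<or> k = 3 \<or> k = 4 \<or> k = 5" using assms by linarith
  then show ?thesis
    unfolding d using m
    by (elim disjE) (simp_all add: vertex_coords[simplified] vertices(7) numeral_2_eq_2[symmetric])
qed

text \<open>Along each side direction one of the three coordinates is constant, and at a division
  point all of them are integers.\<close>

lemma mesh_line_not_regular:
  assumes "x \<in> \<Union>(mesh_lines v m)"
  shows "\<not> regular_pt x"
proof -
  obtain q k t where q: "q \<in> division_points v m" "k < 6" and x: "x = q + t *\<^sub>R (v (k + 1) - v k)"
    using assms unfolding mesh_lines_def by auto
  have xc: "sg x = sg q + t * inner b1 (v (k + 1) - v k)" "tu x = tu q + t * inner b2 (v (k + 1) - v k)"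
    unfolding x by (simp_all only: sg_add_scaleR tu_add_scaleR)
  have sum: "sg x + tu x = sg q + tu q + t * (inner b1 (v (k + 1) - v k) + inner b2 (v (k + 1) - v k))"
    unfolding xc by (simp add: algebra_simps)
  show ?thesis
    using side_direction[OF q(2)] division_point_coords[OF q(1)] unfolding regular_pt_def sum
    by (elim disjE) (simp_all only: xc mult_zero_right add_0_right Ints_add simp_thms)
qed

lemma on_side_parallel:
  assumes q: "q \<in> division_points v m" and "k < 6"
    and d: "sg (v (k + 1)) - sg (v k) = \<alpha>" "tu (v (k + 1)) - tu (v k) = \<beta>"
    and x: "sg x = sg q + r * \<alpha>" "tu x = tu q + r * \<beta>"
  shows "x \<in> \<Union>(mesh_lines v m)"
proof -
  have d': "inner b1 (v (k + 1) - v k) = \<alpha>" "inner b2 (v (k + 1) - v k) = \<beta>"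
    using d by (simp_all add: sg_affine tu_affine inner_diff_right)
  have "x = q + r *\<^sub>R (v (k + 1) - v k)"
    by (rule coord_eqI; unfold sg_add_scaleR tu_add_scaleR d') (use x in simp_all)
  then show ?thesis unfolding mesh_lines_def using q \<open>k < 6\<close> by blast
qed

lemma division_pointI:
  assumes "k < 6" "j \<le> m"
  obtains q where "q \<in> division_points v m"
    "sg q = sg (v k) + (j / m) * (sg (v (k + 1)) - sg (v k))"
    "tu q = tu (v k) + (j / m) * (tu (v (k + 1)) - tu (v k))"
proof
  show "v k + (real j / real m) *\<^sub>R (v (k + 1) - v k) \<in> division_points v m"
    unfolding division_points_def using assms by blast
qed (simp_all add: sg_affine tu_affine inner_add_right inner_diff_right)

text \<open>For each coordinate and each sign there is a side of the hexagon along which the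
  coordinate runs through all integers between 0 and m or -m. The line wanted passes through the
  right division point of that side, parallel to side 2, 1 or 0, on which \<open>sg\<close>,
  \<open>tu\<close> or \<open>sg + tu\<close> respectively is constant.\<close>

lemma not_regular_on_mesh_line:
  assumes x: "x \<in> hex_open" and "\<not> regular_pt x"
  shows "x \<in> \<Union>(mesh_lines v m)"
proof -
  have bd: "\<bar>sg x\<bar> < m" "\<bar>tu x\<bar> < m" "\<bar>sg x + tu x\<bar> < m"
    using x by (auto simp: hex_open_def rhexnorm_less_iff)
  have split: "\<exists>j\<le>m. y = real j \<or> y = - real j" if y: "y \<in> \<int>" "\<bar>y\<bar> < real m" for y :: real
  proof -
    obtain i where i: "y = of_int i" using y by (auto elim: Ints_cases)
    have "nat \<bar>i\<bar> \<le> m" "y = real (nat \<bar>i\<bar>) \<or> y = - real (nat \<bar>i\<bar>)" using y i by auto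
    then show ?thesis by blast
  qed
  have m0: "real m \<noteq> 0" using m by simp
  note vc = vertex_coords[simplified] vertices(7) numeral_2_eq_2[symmetric]
  from assms(2) consider "sg x \<in> \<int>" | "tu x \<in> \<int>" | "sg x + tu x \<in> \<int>"
    unfolding regular_pt_def by blast
  then show ?thesis
  proof cases
    case 1
    from split[OF 1 bd(1)] obtain j where j: "j \<le> m" "sg x = real j \<or> sg x = - real j" by blast
    from j(2) show ?thesis
    proof
      assume s: "sg x = real j"
      \<comment> \<open>From \<open>v 0\<close> to \<open>v 1\<close> the coordinate
        \<open>sg\<close> falls from m to 0, so the value j is taken at the division point with
        index m - j.\<close>
      obtain q where q: "q \<in> division_points v m" "sg q = sg (v 0) + (real (m - j) / m) * (sg (v (0 + 1)) - sg (v 0))"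
        by (rule division_pointI[of 0 "m - j"]) (use j in auto)
      have "sg q = sg x" using q(2) j m0 by (simp add: vc s of_nat_diff field_simps)
      then show ?thesis
        by (intro on_side_parallel[OF q(1), of 2 0 "- real m" x "(tu q - tu x) / m"]) (use m0 in \<open>simp_all add: vc\<close>)
    next
      assume s: "sg x = - real j"
      obtain q where q: "q \<in> division_points v m" "sg q = sg (v 1) + (real j / m) * (sg (v (1 + 1)) - sg (v 1))"
        by (rule division_pointI[of 1 j]) (use j in auto)
      have "sg q = sg x" using q(2) j m0 by (simp add: vc s field_simps)
      then show ?thesis
        by (intro on_side_parallel[OF q(1), of 2 0 "- real m" x "(tu q - tu x) / m"]) (use m0 in \<open>simp_all add: vc\<close>)
    qed
  next
    case 2
    from split[OF 2 bd(2)] obtain j where j: "j \<le> m" "tu x = real j \<or> tu x = - real j" by blast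
    from j(2) show ?thesis
    proof
      assume s: "tu x = real j"
      obtain q where q: "q \<in> division_points v m" "tu q = tu (v 0) + (real j / m) * (tu (v (0 + 1)) - tu (v 0))"
        by (rule division_pointI[of 0 j]) (use j in auto)
      have "tu q = tu x" using q(2) j m0 by (simp add: vc s field_simps)
      then show ?thesis
        by (intro on_side_parallel[OF q(1), of 1 "- real m" 0 x "(sg q - sg x) / m"]) (use m0 in \<open>simp_all add: vc\<close>)
    next
      assume s: "tu x = - real j"
      obtain q where q: "q \<in> division_points v m" "tu q = tu (v 3) + (real j / m) * (tu (v (3 + 1)) - tu (v 3))"
        by (rule division_pointI[of 3 j]) (use j in auto)
      have "tu q = tu x" using q(2) j m0 by (simp add: vc s field_simps)
      then show ?thesis
        by (intro on_side_parallel[OF q(1), of 1 "- real m" 0 x "(sg q - sg x) / m"]) (use m0 in \<open>simp_all add: vc\<close>)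
    qed
  next
    case 3
    from split[OF 3 bd(3)] obtain j where j: "j \<le> m" "sg x + tu x = real j \<or> sg x + tu x = - real j" by blast
    from j(2) show ?thesis
    proof
      assume s: "sg x + tu x = real j"
      obtain q where q: "q \<in> division_points v m"
        "sg q = sg (v 1) + (real (m - j) / m) * (sg (v (1 + 1)) - sg (v 1))"
        "tu q = tu (v 1) + (real (m - j) / m) * (tu (v (1 + 1)) - tu (v 1))"
        by (rule division_pointI[of 1 "m - j"]) (use j in auto)
      have "sg q + tu q = sg x + tu x" using q(2,3) j m0 by (simp add: vc s of_nat_diff)
      then show ?thesis
        by (intro on_side_parallel[OF q(1), of 0 "- real m" "real m" x "(sg q - sg x) / m"]) (use m0 in \<open>simp_all add: vc\<close>)
    next
      assume s: "sg x + tu x = - real j"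
      obtain q where q: "q \<in> division_points v m"
        "sg q = sg (v 2) + (real j / m) * (sg (v (2 + 1)) - sg (v 2))"
        "tu q = tu (v 2) + (real j / m) * (tu (v (2 + 1)) - tu (v 2))"
        by (rule division_pointI[of 2 j]) (use j in auto)
      have "sg q + tu q = sg x + tu x" using q(2,3) j m0 by (simp add: vc s)
      then show ?thesis
        by (intro on_side_parallel[OF q(1), of 0 "- real m" "real m" x "(sg q - sg x) / m"]) (use m0 in \<open>simp_all add: vc\<close>)
    qed
  qed
qed

lemma hex_minus_mesh_lines: "hex_domain v - \<Union>(mesh_lines v m) = {x \<in> hex_open. regular_pt x}"
  using mesh_line_not_regular not_regular_on_mesh_line by (auto simp: hex_domain_eq)

section \<open>Triangles cut out by the mesh lines\<close>

definition cell_functionals :: "real \<Rightarrow> int \<times> int \<Rightarrow> (real^2 \<Rightarrow> real) set" where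
  "cell_functionals e p = {\<lambda>x. - e * (sg x - of_int (fst p)), \<lambda>x. - e * (tu x - of_int (snd p)),
     \<lambda>x. e * (sg x + tu x - of_int (fst p) - of_int (snd p)) - 1}"

text \<open>\<open>e\<close> is a sign: for \<open>e = 1\<close> the open triangle with the corner
  \<open>p\<close> and edges \<open>e1\<close>, \<open>e2\<close>, for \<open>e = -1\<close> its
  point reflection in \<open>p\<close>. Both orientations of mesh triangles are thus treated by one
  formula.\<close>

definition cell :: "real \<Rightarrow> int \<times> int \<Rightarrow> (real^2) set" where
  "cell e p = {x. e * (sg x - of_int (fst p)) > 0 \<and> e * (tu x - of_int (snd p)) > 0 \<and> e * (sg x + tu x - of_int (fst p) - of_int (snd p)) < 1}"

definition ccell :: "real \<Rightarrow> int \<times> int \<Rightarrow> (real^2) set" where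
  "ccell e p = {x. e * (sg x - of_int (fst p)) \<ge> 0 \<and> e * (tu x - of_int (snd p)) \<ge> 0 \<and> e * (sg x + tu x - of_int (fst p) - of_int (snd p)) \<le> 1}"

lemma cell_eq: "cell e p = {x. \<forall>f\<in>cell_functionals e p. f x < 0}"
  and ccell_eq: "ccell e p = {x. \<forall>f\<in>cell_functionals e p. f x \<le> 0}"
  by (auto simp: cell_def ccell_def cell_functionals_def)

lemma cell_functionals_affine:
  assumes "f \<in> cell_functionals e p"
  shows "\<exists>b \<beta>. \<forall>x. f x = inner b x + \<beta>"
proof -
  have "f = (\<lambda>x. (- e) * sg x + 0 * tu x + e * of_int (fst p)) \<or> f = (\<lambda>x. 0 * sg x + (- e) * tu x + e * of_int (snd p))
     \<or> f = (\<lambda>x. e * sg x + e * tu x + (- e * of_int (fst p) - e * of_int (snd p) - 1))"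
    using assms by (auto simp: cell_functionals_def algebra_simps)
  then show ?thesis using affine_functionals by (elim disjE) (simp_all only:)
qed

lemma finite_cell_functionals: "finite (cell_functionals e p)"
  by (simp add: cell_functionals_def)

lemma open_cell: "open (cell e p)"
  unfolding cell_eq by (rule open_strict_sublevel[OF finite_cell_functionals cell_functionals_affine])

lemma convex_cell: "convex (cell e p)"
  unfolding cell_eq by (rule convex_strict_sublevel[OF cell_functionals_affine])

lemma cell_center: "e \<in> {1, -1} \<Longrightarrow> pt (of_int (fst p) + e / 3) (of_int (snd p) + e / 3) \<in> cell e p"
  by (auto simp: cell_def)

lemma closure_cell:
  assumes "e \<in> {1, -1}"
  shows "closure (cell e p) = ccell e p"
  using cell_center[OF assms, of p] unfolding cell_eq ccell_eq
  by (intro closure_strict_affine_sublevel cell_functionals_affine) auto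

lemma regular_cell: "e \<in> {1, -1} \<Longrightarrow> x \<in> cell e p \<Longrightarrow> regular_pt x"
proof -
  assume "e \<in> {1, -1}" "x \<in> cell e p"
  have no: "y \<notin> \<int>" if "of_int k < y" "y < of_int k + 1" for y :: real and k
  proof
    assume "y \<in> \<int>"
    then obtain i where "y = of_int i" by (auto elim: Ints_cases)
    with that have "k < i" "i < k + 1" by linarith+
    then show False by simp
  qed
  from \<open>e \<in> {1, -1}\<close> show "regular_pt x"
  proof
    assume "e = 1"
    then have "of_int (fst p) < sg x" "of_int (snd p) < tu x" "sg x + tu x < of_int (fst p) + of_int (snd p) + 1"
      using \<open>x \<in> cell e p\<close> by (auto simp: cell_def)
    then show ?thesis unfolding regular_pt_def
      using no[of "fst p" "sg x"] no[of "snd p" "tu x"] no[of "fst p + snd p" "sg x + tu x"] by simp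
  next
    assume "e \<in> {-1}"
    then have "sg x < of_int (fst p)" "tu x < of_int (snd p)" "sg x + tu x > of_int (fst p) + of_int (snd p) - 1"
      using \<open>x \<in> cell e p\<close> by (auto simp: cell_def)
    then show ?thesis unfolding regular_pt_def
      using no[of "fst p - 1" "sg x"] no[of "snd p - 1" "tu x"] no[of "fst p + snd p - 1" "sg x + tu x"] by simp
  qed
qed

text \<open>The integer parts of \<open>sg\<close> and \<open>tu\<close> select a unit
  parallelogram, and the diagonal, a line of the third family, splits it into two triangles.\<close>

lemma regular_in_cell:
  assumes "regular_pt x"
  obtains e p where "e \<in> {1, -1}" "x \<in> cell e p"
proof -
  define i j where "i = \<lfloor>sg x\<rfloor>" and "j = \<lfloor>tu x\<rfloor>"
  have ns: "sg x \<noteq> of_int i" "tu x \<noteq> of_int j" "sg x + tu x \<noteq> of_int (i + j + 1)"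
    using assms unfolding regular_pt_def by (metis Ints_of_int)+
  have b: "of_int i < sg x" "sg x < of_int i + 1" "of_int j < tu x" "tu x < of_int j + 1"
    using ns unfolding i_def j_def by linarith+
  show thesis
  proof (cases "sg x + tu x < of_int (i + j + 1)")
    case True
    then show thesis using b by (intro that[of 1 "(i, j)"]) (auto simp: cell_def)
  next
    case False
    \<comment> \<open>The triangle of the opposite orientation is attached to the far corner of the
      parallelogram.\<close>
    then show thesis using b ns(3) by (intro that[of "-1" "(i + 1, j + 1)"]) (auto simp: cell_def)
  qed
qed

text \<open>Sign and corner can be read off from any point of the triangle, which makes the triangle
  of a regular point unique.\<close>

lemma cell_floor:
  assumes "e \<in> {1, -1}" "x \<in> cell e p"
  shows "fst p = (if e = 1 then \<lfloor>sg x\<rfloor> else \<lfloor>sg x\<rfloor> + 1)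
    \<and> snd p = (if e = 1 then \<lfloor>tu x\<rfloor> else \<lfloor>tu x\<rfloor> + 1)
    \<and> e = (if sg x + tu x < of_int \<lfloor>sg x\<rfloor> + of_int \<lfloor>tu x\<rfloor> + 1 then 1 else -1)"
proof -
  from assms(1) consider "e = 1" | "e = -1" by blast
  then show ?thesis
  proof cases
    case 1
    then have b: "of_int (fst p) < sg x" "of_int (snd p) < tu x" "sg x + tu x < of_int (fst p) + of_int (snd p) + 1"
      using assms(2) by (simp_all add: cell_def)
    have "\<lfloor>sg x\<rfloor> = fst p" by (rule floor_unique) (use b in linarith)+
    moreover have "\<lfloor>tu x\<rfloor> = snd p" by (rule floor_unique) (use b in linarith)+
    ultimately show ?thesis using 1 b by simp
  next
    case 2
    then have b: "sg x < of_int (fst p)" "tu x < of_int (snd p)" "of_int (fst p) + of_int (snd p) - 1 < sg x + tu x"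
      using assms(2) by (simp_all add: cell_def)
    have "\<lfloor>sg x\<rfloor> = fst p - 1" by (rule floor_unique; unfold of_int_diff of_int_1; use b in linarith)
    moreover have "\<lfloor>tu x\<rfloor> = snd p - 1" by (rule floor_unique; unfold of_int_diff of_int_1; use b in linarith)
    ultimately show ?thesis using 2 b by simp
  qed
qed

lemma cell_unique:
  assumes "e \<in> {1, -1}" "e' \<in> {1, -1}" "x \<in> cell e p" "x \<in> cell e' p'"
  shows "e = e' \<and> p = p'"
proof -
  have e: "e = e'" using cell_floor[OF assms(1,3)] cell_floor[OF assms(2,4)] by metis
  have "fst p = fst p'" using cell_floor[OF assms(1,3)] cell_floor[OF assms(2,4)] e by metis
  moreover have "snd p = snd p'" using cell_floor[OF assms(1,3)] cell_floor[OF assms(2,4)] e by metis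
  ultimately show ?thesis using e by (simp add: prod_eq_iff)
qed

text \<open>On a triangle each of the three coordinates stays strictly between two consecutive
  integers, whereas the boundary of the hexagon sits at the integers m and -m. A triangle that meets
  the open hexagon is hence not cut by its boundary.\<close>

lemma cell_in_hex:
  assumes e: "e \<in> {1, -1}" and x: "x \<in> cell e p" "x \<in> hex_open" and y: "y \<in> cell e p"
  shows "y \<in> hex_open"
proof -
  have bd: "\<bar>sg x\<bar> < m" "\<bar>tu x\<bar> < m" "\<bar>sg x + tu x\<bar> < m"
    using x by (auto simp: hex_open_def rhexnorm_less_iff)
  have int: "\<bar>z\<bar> < m" if "of_int k < w" "w < of_int k + 1" "\<bar>w\<bar> < m" "of_int k < z" "z < of_int k + 1"
    for z w :: real and k
  proof -
    have "of_int k < real_of_int (int m)" "real_of_int (- int m) < of_int (k + 1)" using that by auto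
    then have "k < int m" "- int m < k + 1" by (simp_all only: of_int_less_iff)
    then have "k + 1 \<le> int m" "- int m \<le> k" by linarith+
    then have "real_of_int (k + 1) \<le> real_of_int (int m)" "real_of_int (- int m) \<le> real_of_int k"
      by (simp_all only: of_int_le_iff)
    then show ?thesis using that by simp
  qed
  from e show ?thesis
  proof
    assume "e = 1"
    then have "of_int (fst p) < sg x" "of_int (snd p) < tu x" "sg x + tu x < of_int (fst p) + of_int (snd p) + 1"
      "of_int (fst p) < sg y" "of_int (snd p) < tu y" "sg y + tu y < of_int (fst p) + of_int (snd p) + 1"
      using x y by (auto simp: cell_def)
    then show ?thesis using bd int[of "fst p" "sg x" "sg y"] int[of "snd p" "tu x" "tu y"]
        int[of "fst p + snd p" "sg x + tu x" "sg y + tu y"]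
      by (simp add: hex_open_def rhexnorm_less_iff)
  next
    assume "e \<in> {-1}"
    then have "sg x < of_int (fst p)" "tu x < of_int (snd p)" "sg x + tu x > of_int (fst p) + of_int (snd p) - 1"
      "sg y < of_int (fst p)" "tu y < of_int (snd p)" "sg y + tu y > of_int (fst p) + of_int (snd p) - 1"
      using x y by (auto simp: cell_def)
    then show ?thesis using bd int[of "fst p - 1" "sg x" "sg y"] int[of "snd p - 1" "tu x" "tu y"]
        int[of "fst p + snd p - 1" "sg x + tu x" "sg y + tu y"]
      by (simp add: hex_open_def rhexnorm_less_iff)
  qed
qed

text \<open>A decomposition into disjoint nonempty open connected sets is the decomposition into
  components; the triangles that meet the hexagon form one, since by \<open>cell_in_hex\<close> they
  lie wholly inside.\<close>

lemma components_hex_minus_lines: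
  "components (hex_domain v - \<Union>(mesh_lines v m))
     = {cell e p | e p. e \<in> {1, -1} \<and> cell e p \<subseteq> hex_open}" (is "_ = ?A")
proof (rule components_open_unique)
  show "pairwise disjnt ?A"
  proof (rule pairwiseI)
    fix X Y assume "X \<in> ?A" "Y \<in> ?A" "X \<noteq> Y"
    from \<open>X \<in> ?A\<close> obtain e p where X: "X = cell e p" "e \<in> {1, -1}" by blast
    from \<open>Y \<in> ?A\<close> obtain e' p' where Y: "Y = cell e' p'" "e' \<in> {1, -1}" by blast
    have "x \<notin> Y" if "x \<in> X" for x
    proof
      assume "x \<in> Y"
      then have "e = e' \<and> p = p'" using cell_unique[OF X(2) Y(2)] \<open>x \<in> X\<close> by (simp only: X(1) Y(1))
      then show False using \<open>X \<noteq> Y\<close> X(1) Y(1) by simp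
    qed
    then show "disjnt X Y" unfolding disjnt_iff by blast
  qed
  show "\<Union>?A = hex_domain v - \<Union>(mesh_lines v m)"
    unfolding hex_minus_mesh_lines
  proof (intro equalityI subsetI)
    fix x assume "x \<in> \<Union>?A"
    then obtain X where "X \<in> ?A" "x \<in> X" by (rule UnionE)
    from \<open>X \<in> ?A\<close> obtain e p where X: "X = cell e p" "e \<in> {1, -1}" "cell e p \<subseteq> hex_open" by blast
    then show "x \<in> {x \<in> hex_open. regular_pt x}" using regular_cell[OF X(2), of x p] \<open>x \<in> X\<close> by blast
  next
    fix x assume x: "x \<in> {x \<in> hex_open. regular_pt x}"
    then have xh: "x \<in> hex_open" and "regular_pt x" by simp_all
    from this(2) obtain e p where ep: "e \<in> {1, -1}" "x \<in> cell e p" by (rule regular_in_cell)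
    have "cell e p \<subseteq> hex_open" by (rule subsetI) (rule cell_in_hex[OF ep xh])
    then have "cell e p \<in> ?A" using ep(1) by blast
    then show "x \<in> \<Union>?A" using ep(2) by (rule UnionI)
  qed
  fix X assume "X \<in> ?A"
  then obtain e p where "X = cell e p" "e \<in> {1, -1}" by blast
  then show "open X \<and> connected X \<and> X \<noteq> {}"
    using open_cell[of e p] convex_connected[OF convex_cell[of e p]] cell_center[of e p] by blast
qed

lemma mesh_eq: "mesh v m = {ccell e p | e p. e \<in> {1, -1} \<and> cell e p \<subseteq> hex_open}"
proof (intro equalityI subsetI)
  fix T assume "T \<in> mesh v m"
  then obtain X where X: "X \<in> {cell e p | e p. e \<in> {1, -1} \<and> cell e p \<subseteq> hex_open}" and T: "T = closure X"
    unfolding mesh_def components_hex_minus_lines by (rule imageE)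
  from X obtain e p where "X = cell e p" and ep: "e \<in> {1, -1}" "cell e p \<subseteq> hex_open" by blast
  with T have "T = ccell e p" by (simp only: closure_cell)
  with ep show "T \<in> {ccell e p | e p. e \<in> {1, -1} \<and> cell e p \<subseteq> hex_open}" by blast
next
  fix T assume "T \<in> {ccell e p | e p. e \<in> {1, -1} \<and> cell e p \<subseteq> hex_open}"
  then obtain e p where T: "T = ccell e p" and ep: "e \<in> {1, -1}" "cell e p \<subseteq> hex_open" by blast
  have "T = closure (cell e p)" unfolding T closure_cell[OF ep(1)] ..
  moreover have "cell e p \<in> {cell e p | e p. e \<in> {1, -1} \<and> cell e p \<subseteq> hex_open}" using ep by blast
  ultimately show "T \<in> mesh v m"
    unfolding mesh_def components_hex_minus_lines by (rule image_eqI)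
qed

end

section \<open>Nodes and basis functions\<close>

text \<open>\<open>grad\<close> is defined by choice; uniqueness of one-dimensional derivatives
  determines it wherever the function is affine nearby.\<close>

lemma grad_locally_affine:
  assumes "open W" "x \<in> W" "\<And>y. y \<in> W \<Longrightarrow> f y = inner b y + \<beta>"
  shows "grad f x = b"
proof -
  have d: "has_partial_derivative f k (vec_nth b k) x" for k
  proof -
    obtain r where r: "r > 0" "ball x r \<subseteq> W" using assms(1,2) by (meson open_contains_ball_eq)
    have "((\<lambda>t. inner b (x + t *\<^sub>R axis k 1) + \<beta>) has_real_derivative vec_nth b k) (at 0)"
      by (auto intro!: derivative_eq_intros simp: inner_add_right inner_axis)
    then show ?thesis unfolding has_partial_derivative_def
    proof (rule has_field_derivative_transform_within_open[where S = "ball 0 r"])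
      fix t :: real assume "t \<in> ball 0 r"
      then have "x + t *\<^sub>R axis k 1 \<in> ball x r" by (simp add: dist_norm norm_axis_1)
      then show "inner b (x + t *\<^sub>R axis k 1) + \<beta> = f (x + t *\<^sub>R axis k 1)" using r assms(3) by auto
    qed (use r in auto)
  qed
  have "(SOME d. has_partial_derivative f k d x) = vec_nth b k" for k
  proof (rule some_equality)
    show "has_partial_derivative f k (vec_nth b k) x" by (rule d)
    show "e = vec_nth b k" if "has_partial_derivative f k e x" for e
      using DERIV_unique that d[of k] unfolding has_partial_derivative_def by blast
  qed
  then show ?thesis unfolding grad_def by (simp add: Finite_Cartesian_Product.vec_eq_iff)
qed

context hexagon_mesh
begin

text \<open>\<open>nb1\<close> and \<open>nb2\<close> give the corners of the triangle other than
  \<open>p\<close>. The case distinction turns the real sign \<open>e\<close> into an integer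
  shift.\<close>

definition nb1 :: "real \<Rightarrow> int \<times> int \<Rightarrow> int \<times> int" where
  "nb1 e p = (fst p + (if e = 1 then 1 else -1), snd p)"
definition nb2 :: "real \<Rightarrow> int \<times> int \<Rightarrow> int \<times> int" where
  "nb2 e p = (fst p, snd p + (if e = 1 then 1 else -1))"

lemma nb_coords:
  assumes "e \<in> {1, -1}"
  shows "real_of_int (fst (nb1 e p)) = of_int (fst p) + e" "snd (nb1 e p) = snd p"
    "fst (nb2 e p) = fst p" "real_of_int (snd (nb2 e p)) = of_int (snd p) + e"
  using assms by (auto simp: nb1_def nb2_def)

lemma vertices_in_ccell:
  assumes "e \<in> {1, -1}"
  shows "node p \<in> ccell e p" "node (nb1 e p) \<in> ccell e p" "node (nb2 e p) \<in> ccell e p"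
  using assms by (auto simp: ccell_def nb_coords)

lemma ccell_barycentric:
  assumes "e \<in> {1, -1}"
  shows "x = node p + (e * (sg x - of_int (fst p))) *\<^sub>R (node (nb1 e p) - node p)
           + (e * (tu x - of_int (snd p))) *\<^sub>R (node (nb2 e p) - node p)"
proof -
  have ee: "e * e = 1" using assms by auto
  have d: "node (nb1 e p) - node p = e *\<^sub>R e1" "node (nb2 e p) - node p = e *\<^sub>R e2"
    using assms by (simp_all add: node_def pt_def nb_coords algebra_simps)
  have x: "x = node p + (sg x - of_int (fst p)) *\<^sub>R e1 + (tu x - of_int (snd p)) *\<^sub>R e2"
    by (rule coord_eqI) (simp_all add: sg_add_scaleR tu_add_scaleR dual)
  have h: "(e * r) *\<^sub>R (e *\<^sub>R y) = r *\<^sub>R y" for r and y :: "real^2"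
    using ee by (simp add: mult.commute mult.left_commute)
  show ?thesis unfolding d h by (rule x)
qed

lemma ccell_subset_hull:
  assumes "e \<in> {1, -1}"
  shows "ccell e p \<subseteq> convex hull {node p, node (nb1 e p), node (nb2 e p)}"
proof
  fix x assume x: "x \<in> ccell e p"
  show "x \<in> convex hull {node p, node (nb1 e p), node (nb2 e p)}"
    by (subst ccell_barycentric[OF assms, of x p], rule triangle_subset_hull)
       (use x in \<open>auto simp: ccell_def hull_inc algebra_simps\<close>)
qed

lemma convex_ccell: "e \<in> {1, -1} \<Longrightarrow> convex (ccell e p)"
  using convex_closure[OF convex_cell[of e p]] by (simp only: closure_cell)

text \<open>The triangle is the convex hull of its corners, so it has no other extreme points;
  conversely each corner is the only common zero of two edge functionals.\<close>

lemma extreme_point_cell: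
  assumes e: "e \<in> {1, -1}"
  shows "x extreme_point_of ccell e p \<longleftrightarrow> x \<in> {node p, node (nb1 e p), node (nb2 e p)}"
proof
  assume x: "x extreme_point_of ccell e p"
  have "convex hull {node p, node (nb1 e p), node (nb2 e p)} \<subseteq> ccell e p"
    using vertices_in_ccell[OF e] convex_ccell[OF e] by (intro hull_minimal) blast+
  then have "ccell e p = convex hull {node p, node (nb1 e p), node (nb2 e p)}"
    using ccell_subset_hull[OF e] by (rule subset_antisym[rotated])
  with x show "x \<in> {node p, node (nb1 e p), node (nb2 e p)}"
    using extreme_point_of_convex_hull by metis
next
  have gen: "x extreme_point_of ccell e p"
    if "f \<in> cell_functionals e p" "g \<in> cell_functionals e p" and x: "x \<in> ccell e p" "f x = 0" "g x = 0"
      and uniq: "\<And>y. f y = 0 \<Longrightarrow> g y = 0 \<Longrightarrow> y = x" for f g x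
  proof -
    obtain b \<beta> where f: "\<forall>x. f x = inner b x + \<beta>" using cell_functionals_affine[OF \<open>f \<in> _\<close>] by blast
    obtain d \<gamma> where g: "\<forall>x. g x = inner d x + \<gamma>" using cell_functionals_affine[OF \<open>g \<in> _\<close>] by blast
    have "f y \<le> 0" "g y \<le> 0" if "y \<in> ccell e p" for y
      using that \<open>f \<in> _\<close> \<open>g \<in> _\<close> unfolding ccell_eq by blast+
    then show ?thesis
      using x uniq f g by (intro extreme_point_of_affine_face[of x _ b \<beta> d \<gamma>]) metis+
  qed
  assume "x \<in> {node p, node (nb1 e p), node (nb2 e p)}"
  then consider "x = node p" | "x = node (nb1 e p)" | "x = node (nb2 e p)" by blast
  then show "x extreme_point_of ccell e p"
  proof cases
    case 1
    show ?thesis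
    proof (rule gen)
      show "(\<lambda>x. - e * (sg x - of_int (fst p))) \<in> cell_functionals e p"
        "(\<lambda>x. - e * (tu x - of_int (snd p))) \<in> cell_functionals e p" by (simp_all add: cell_functionals_def)
      show "x \<in> ccell e p" using 1 vertices_in_ccell[OF e] by blast
    qed (use 1 e in \<open>auto intro: coord_eqI\<close>)
  next
    case 2
    show ?thesis
    proof (rule gen)
      show "(\<lambda>x. e * (sg x + tu x - of_int (fst p) - of_int (snd p)) - 1) \<in> cell_functionals e p"
        "(\<lambda>x. - e * (tu x - of_int (snd p))) \<in> cell_functionals e p" by (simp_all add: cell_functionals_def)
      show "x \<in> ccell e p" using 2 vertices_in_ccell[OF e] by blast
    qed (use 2 e in \<open>auto intro!: coord_eqI simp: nb_coords\<close>)
  next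
    case 3
    show ?thesis
    proof (rule gen)
      show "(\<lambda>x. e * (sg x + tu x - of_int (fst p) - of_int (snd p)) - 1) \<in> cell_functionals e p"
        "(\<lambda>x. - e * (sg x - of_int (fst p))) \<in> cell_functionals e p" by (simp_all add: cell_functionals_def)
      show "x \<in> ccell e p" using 3 vertices_in_ccell[OF e] by blast
    qed (use 3 e in \<open>auto intro!: coord_eqI simp: nb_coords\<close>)
  qed
qed

lemma node_in_hex_open_iff: "node p \<in> hex_open \<longleftrightarrow> p \<in> hex_lattice m"
proof -
  have "real_of_int (hexnorm p) < real_of_int (int m) \<longleftrightarrow> hexnorm p < int m" by (rule of_int_less_iff)
  then show ?thesis by (simp add: hex_open_def hex_lattice_def rhexnorm_of_int)
qed

lemma mesh_node_is_node:
  assumes "x \<in> mesh_nodes v m"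
  shows "x \<in> range node"
proof -
  obtain T where T: "T \<in> mesh v m" "x extreme_point_of T" using assms unfolding mesh_nodes_def by blast
  from T(1) obtain e p where "T = ccell e p" "e \<in> {1, -1}" unfolding mesh_eq by blast
  then show ?thesis using T(2) extreme_point_cell[of e x p] by blast
qed

lemma cell_vertex_mesh_node:
  assumes "e \<in> {1, -1}" "cell e p \<subseteq> hex_open"
  shows "node p \<in> mesh_nodes v m" "node (nb1 e p) \<in> mesh_nodes v m" "node (nb2 e p) \<in> mesh_nodes v m"
proof -
  have "ccell e p \<in> mesh v m" using assms unfolding mesh_eq by blast
  then have "x \<in> mesh_nodes v m" if "x \<in> {node p, node (nb1 e p), node (nb2 e p)}" for x
    using that extreme_point_cell[OF assms(1), of x p] unfolding mesh_nodes_def by blast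
  then show "node p \<in> mesh_nodes v m" "node (nb1 e p) \<in> mesh_nodes v m" "node (nb2 e p) \<in> mesh_nodes v m"
    by blast+
qed

text \<open>Inside the hexagon the three coordinates of \<open>p\<close> are at most m - 1 in
  absolute value, and a triangle at \<open>p\<close> changes each of them by less than 1. This
  single triangle suffices to recognise \<open>p\<close> as a mesh node.\<close>

lemma cell_at_lattice_point:
  assumes "p \<in> hex_lattice m"
  shows "cell 1 p \<subseteq> hex_open"
proof
  fix x assume "x \<in> cell 1 p"
  then have x: "of_int (fst p) < sg x" "of_int (snd p) < tu x" "sg x + tu x < of_int (fst p) + of_int (snd p) + 1"
    by (simp_all add: cell_def)
  have "hexnorm p \<le> int m - 1" using assms by (simp add: hex_lattice_def)
  then have "\<bar>fst p\<bar> \<le> int m - 1" "\<bar>snd p\<bar> \<le> int m - 1" "\<bar>fst p + snd p\<bar> \<le> int m - 1"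
    by (simp_all only: hexnorm_le_iff)
  then have "real_of_int \<bar>fst p\<bar> \<le> real_of_int (int m - 1)" "real_of_int \<bar>snd p\<bar> \<le> real_of_int (int m - 1)"
    "real_of_int \<bar>fst p + snd p\<bar> \<le> real_of_int (int m - 1)" by (simp_all only: of_int_le_iff)
  then have "\<bar>real_of_int (fst p)\<bar> \<le> real m - 1" "\<bar>real_of_int (snd p)\<bar> \<le> real m - 1"
    "\<bar>real_of_int (fst p) + real_of_int (snd p)\<bar> \<le> real m - 1" by simp_all
  then show "x \<in> hex_open" using x unfolding hex_open_def mem_Collect_eq rhexnorm_less_iff
    by (intro conjI) linarith+
qed

lemma internal_nodes_eq: "internal_nodes v m = node ` hex_lattice m"
proof (intro equalityI subsetI)
  fix x assume "x \<in> internal_nodes v m"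
  then have "x \<in> range node" "x \<in> hex_open"
    using mesh_node_is_node by (auto simp: internal_nodes_def hex_domain_eq)
  then show "x \<in> node ` hex_lattice m" using node_in_hex_open_iff by blast
next
  fix x assume "x \<in> node ` hex_lattice m"
  then obtain p where p: "x = node p" "p \<in> hex_lattice m" by blast
  then have "x \<in> mesh_nodes v m" using cell_vertex_mesh_node(1)[of 1 p] cell_at_lattice_point by simp
  then show "x \<in> internal_nodes v m"
    using p node_in_hex_open_iff by (simp add: internal_nodes_def hex_domain_eq)
qed

section \<open>Hat functions in lattice coordinates\<close>

definition phi :: "int \<times> int \<Rightarrow> real^2 \<Rightarrow> real" where
  "phi q x = max 0 (1 - rhexnorm (sg x - of_int (fst q)) (tu x - of_int (snd q)))"

lemma continuous_phi: "continuous_on S (phi q)"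
  unfolding phi_def rhexnorm_def by (intro continuous_intros)

text \<open>The right-hand sides are the barycentric coordinates of the triangle. Relative to a
  corner, the sign constraints on the triangle decide which absolute value attains the maximum in
  \<open>rhexnorm\<close>.\<close>

lemma phi_on_cell:
  assumes e: "e \<in> {1, -1}" and x: "x \<in> ccell e p"
  shows "phi p x = 1 - e * (sg x + tu x - of_int (fst p) - of_int (snd p))"
    and "phi (nb1 e p) x = e * (sg x - of_int (fst p))"
    and "phi (nb2 e p) x = e * (tu x - of_int (snd p))"
proof -
  define s t where "s = sg x - of_int (fst p)" and "t = tu x - of_int (snd p)"
  have st: "e * s \<ge> 0" "e * t \<ge> 0" "e * s + e * t \<le> 1"
    using x by (simp_all add: ccell_def s_def t_def algebra_simps)
  have r: "rhexnorm s t = e * s + e * t" "rhexnorm (s - e) t = 1 - e * s" "rhexnorm s (t - e) = 1 - e * t"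
    using e st by (auto simp: rhexnorm_def max_def)
  show "phi p x = 1 - e * (sg x + tu x - of_int (fst p) - of_int (snd p))"
    using r(1) st by (simp add: phi_def s_def[symmetric] t_def[symmetric]) (simp add: s_def t_def algebra_simps)
  have "sg x - of_int (fst (nb1 e p)) = s - e" "tu x - of_int (snd (nb2 e p)) = t - e"
    using e by (simp_all add: nb_coords s_def t_def)
  then show "phi (nb1 e p) x = e * (sg x - of_int (fst p))" "phi (nb2 e p) x = e * (tu x - of_int (snd p))"
    using r(2,3) st by (simp_all add: phi_def nb_coords(2,3)[OF e] s_def[symmetric] t_def[symmetric])
qed

text \<open>Unless \<open>q\<close> is a corner, one of the three coordinates relative to
  \<open>q\<close> ranges over a unit interval that misses (-1, 1), so the norm is at least 1. The
  offsets for which no coordinate does so are exactly those of the corners.\<close>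

lemma phi_off_cell:
  assumes e: "e \<in> {1, -1}" and x: "x \<in> ccell e p" and q: "q \<noteq> p" "q \<noteq> nb1 e p" "q \<noteq> nb2 e p"
  shows "phi q x = 0"
proof -
  define i j where "i = fst p - fst q" and "j = snd p - snd q"
  define s t where "s = sg x - of_int (fst q)" and "t = tu x - of_int (snd q)"
  have st: "e * (s - i) \<ge> 0" "e * (t - j) \<ge> 0" "e * ((s + t) - (i + j)) \<le> 1"
    using x by (simp_all add: ccell_def s_def t_def i_def j_def algebra_simps)
  have big: "\<bar>y\<bar> \<ge> 1" if "k \<ge> 1 \<or> k \<le> -2" "of_int k \<le> y" "y \<le> of_int k + 1" for y :: real and k :: int
  proof -
    from that(1) have "real_of_int k \<ge> 1 \<or> real_of_int k \<le> -2" by auto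
    then show ?thesis using that by auto
  qed
  have "1 \<le> \<bar>s\<bar> \<or> 1 \<le> \<bar>t\<bar> \<or> 1 \<le> \<bar>s + t\<bar>"
  proof (cases "e = 1")
    case True
    have "(i \<ge> 1 \<or> i \<le> -2) \<or> (j \<ge> 1 \<or> j \<le> -2) \<or> (i + j \<ge> 1 \<or> i + j \<le> -2)"
    proof (rule ccontr)
      assume "\<not> ?thesis"
      then have "(i, j) \<in> {(0,0), (-1,0), (0,-1)}" by auto
      then show False using q True by (auto simp: i_def j_def nb1_def nb2_def prod_eq_iff)
    qed
    then show ?thesis using st True big[of i s] big[of j t] big[of "i + j" "s + t"] by auto
  next
    case False
    then have [simp]: "e = -1" using e by simp
    \<comment> \<open>For \<open>e = -1\<close> the coordinates range over [i - 1, i], [j - 1, j]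
      and [i + j - 1, i + j], hence the shift by one.\<close>
    have "(i - 1 \<ge> 1 \<or> i - 1 \<le> -2) \<or> (j - 1 \<ge> 1 \<or> j - 1 \<le> -2) \<or> (i + j - 1 \<ge> 1 \<or> i + j - 1 \<le> -2)"
    proof (rule ccontr)
      assume "\<not> ?thesis"
      then have "(i, j) \<in> {(0,0), (1,0), (0,1)}" by auto
      then show False using q by (auto simp: i_def j_def nb1_def nb2_def prod_eq_iff)
    qed
    then show ?thesis using st big[of "i - 1" s] big[of "j - 1" t] big[of "i + j - 1" "s + t"] by auto
  qed
  then have "rhexnorm s t \<ge> 1" unfolding rhexnorm_def by linarith
  then show ?thesis by (simp add: phi_def s_def t_def)
qed

lemma phi_node: "phi q (node p) = (if p = q then 1 else 0)"
proof (cases "p = q")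
  case False
  then have "hexnorm (p - q) \<noteq> 0" by (simp add: hexnorm_eq_0_iff)
  then have "hexnorm (p - q) \<ge> 1" using hexnorm_nonneg[of "p - q"] by simp
  then have "real_of_int (hexnorm (p - q)) \<ge> 1" by simp
  moreover have "rhexnorm (sg (node p) - of_int (fst q)) (tu (node p) - of_int (snd q)) = of_int (hexnorm (p - q))"
    using rhexnorm_of_int[of "fst p - fst q" "snd p - snd q"] by (simp add: minus_prod_def)
  ultimately show ?thesis using False by (simp add: phi_def)
qed (simp add: phi_def rhexnorm_def)

lemma phi_outside:
  assumes q: "q \<in> hex_lattice m" and x: "x \<notin> hex_open"
  shows "phi q x = 0"
proof -
  have "hexnorm q \<le> int m - 1" using q by (simp add: hex_lattice_def)
  then have "\<bar>fst q\<bar> \<le> int m - 1" "\<bar>snd q\<bar> \<le> int m - 1" "\<bar>fst q + snd q\<bar> \<le> int m - 1"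
    by (simp_all only: hexnorm_le_iff)
  then have "real_of_int \<bar>fst q\<bar> \<le> real_of_int (int m - 1)" "real_of_int \<bar>snd q\<bar> \<le> real_of_int (int m - 1)"
    "real_of_int \<bar>fst q + snd q\<bar> \<le> real_of_int (int m - 1)" by (simp_all only: of_int_le_iff)
  then have q': "\<bar>real_of_int (fst q)\<bar> \<le> real m - 1" "\<bar>real_of_int (snd q)\<bar> \<le> real m - 1"
    "\<bar>real_of_int (fst q) + real_of_int (snd q)\<bar> \<le> real m - 1" by simp_all
  have "real m \<le> \<bar>sg x\<bar> \<or> real m \<le> \<bar>tu x\<bar> \<or> real m \<le> \<bar>sg x + tu x\<bar>"
    using x unfolding hex_open_def mem_Collect_eq rhexnorm_less_iff not_less[symmetric] by blast
  then have "1 \<le> \<bar>sg x - of_int (fst q)\<bar> \<or> 1 \<le> \<bar>tu x - of_int (snd q)\<bar>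
     \<or> 1 \<le> \<bar>sg x - of_int (fst q) + (tu x - of_int (snd q))\<bar>"
  proof (elim disjE)
    assume "real m \<le> \<bar>sg x\<bar>"
    then have "1 \<le> \<bar>sg x - of_int (fst q)\<bar>" using q'(1) by linarith
    then show ?thesis by blast
  next
    assume "real m \<le> \<bar>tu x\<bar>"
    then have "1 \<le> \<bar>tu x - of_int (snd q)\<bar>" using q'(2) by linarith
    then show ?thesis by blast
  next
    assume "real m \<le> \<bar>sg x + tu x\<bar>"
    then have "1 \<le> \<bar>sg x - of_int (fst q) + (tu x - of_int (snd q))\<bar>" using q'(3) by linarith
    then show ?thesis by blast
  qed
  then have "rhexnorm (sg x - of_int (fst q)) (tu x - of_int (snd q)) \<ge> 1" unfolding rhexnorm_def by linarith
  then show ?thesis by (simp add: phi_def)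
qed

lemma affine_coords_form:
  "\<alpha> * sg x + \<gamma> * tu x + \<delta> = inner (\<alpha> *\<^sub>R b1 + \<gamma> *\<^sub>R b2) x + (\<delta> - \<alpha> * inner b1 c - \<gamma> * inner b2 c)"
  by (simp add: sg_affine tu_affine inner_add_left algebra_simps)

text \<open>The gradients of the barycentric coordinates, which sum to zero over the three
  corners.\<close>

definition cell_grad :: "real \<Rightarrow> int \<times> int \<Rightarrow> int \<times> int \<Rightarrow> real^2" where
  "cell_grad e p q = (if q = p then (- e) *\<^sub>R b1 + (- e) *\<^sub>R b2 else if q = nb1 e p then e *\<^sub>R b1
     else if q = nb2 e p then e *\<^sub>R b2 else 0)"

lemma phi_affine_on_cell:
  assumes e: "e \<in> {1, -1}"
  shows "\<exists>\<beta>. \<forall>x\<in>ccell e p. phi q x = inner (cell_grad e p q) x + \<beta>"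
proof -
  have ne: "nb1 e p \<noteq> p" "nb2 e p \<noteq> p" "nb2 e p \<noteq> nb1 e p"
    by (auto simp: nb1_def nb2_def prod_eq_iff split: if_splits)
  consider "q = p" | "q = nb1 e p" | "q = nb2 e p" | "q \<noteq> p" "q \<noteq> nb1 e p" "q \<noteq> nb2 e p" by blast
  then show ?thesis
  proof cases
    case 1
    have "phi q x = (- e) * sg x + (- e) * tu x + (1 + e * of_int (fst p) + e * of_int (snd p))"
      if "x \<in> ccell e p" for x using phi_on_cell(1)[OF e that] 1 by (simp add: algebra_simps)
    then show ?thesis unfolding affine_coords_form using 1 unfolding cell_grad_def by auto
  next
    case 2
    have "phi q x = e * sg x + 0 * tu x + (- e * of_int (fst p))"
      if "x \<in> ccell e p" for x using phi_on_cell(2)[OF e that] 2 by (simp add: algebra_simps)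
    then show ?thesis unfolding affine_coords_form using 2 ne unfolding cell_grad_def by auto
  next
    case 3
    have "phi q x = 0 * sg x + e * tu x + (- e * of_int (snd p))"
      if "x \<in> ccell e p" for x using phi_on_cell(3)[OF e that] 3 by (simp add: algebra_simps)
    then show ?thesis unfolding affine_coords_form using 3 ne unfolding cell_grad_def by auto
  next
    case 4
    then show ?thesis using phi_off_cell[OF e] unfolding cell_grad_def by (intro exI[of _ 0]) simp
  qed
qed

lemma grad_phi:
  assumes "e \<in> {1, -1}" "x \<in> cell e p"
  shows "grad (phi q) x = cell_grad e p q"
proof -
  obtain \<beta> where "\<forall>x\<in>ccell e p. phi q x = inner (cell_grad e p q) x + \<beta>"
    using phi_affine_on_cell[OF assms(1)] by blast
  moreover have "cell e p \<subseteq> ccell e p" by (auto simp: cell_def ccell_def)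
  ultimately show ?thesis by (intro grad_locally_affine[OF open_cell assms(2), of _ _ \<beta>]) blast
qed

lemma phi_in_fe_space:
  assumes q: "q \<in> hex_lattice m"
  shows "phi q \<in> fe_space v m"
proof -
  have "\<exists>b \<beta>. \<forall>x\<in>T. phi q x = inner b x + \<beta>" if "T \<in> mesh v m" for T
  proof -
    obtain e p where "T = ccell e p" "e \<in> {1, -1}" using \<open>T \<in> mesh v m\<close> unfolding mesh_eq by blast
    then show ?thesis using phi_affine_on_cell[of e p q] by blast
  qed
  moreover have "phi q x = 0" if "x \<in> frontier (hex_domain v)" for x
    using that phi_outside[OF q] by (simp add: frontier_hex_domain)
  moreover have "phi q x = 0" if "x \<notin> closure (hex_domain v)" for x
    using that phi_outside[OF q, of x] closure_subset[of "hex_domain v"] unfolding hex_domain_eq by blast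
  ultimately show ?thesis unfolding fe_space_def using continuous_phi by blast
qed

end

section \<open>Stars of nodes and stiffness integrals\<close>

context hexagon_mesh
begin

lemma negligible_not_regular: "negligible {x. \<not> regular_pt x}"
proof -
  have b: "b1 \<noteq> 0" "b2 \<noteq> 0" "b1 + b2 \<noteq> 0"
  proof -
    show "b1 \<noteq> 0" "b2 \<noteq> 0" using gram rho by auto
    have "inner (b1 + b2) e1 = 1" by (simp add: inner_add_left dual)
    then show "b1 + b2 \<noteq> 0" by auto
  qed
  have "{x. \<not> regular_pt x} \<subseteq> (\<Union>i::int. {x. inner b1 x = of_int i + inner b1 c} \<union> {x. inner b2 x = of_int i + inner b2 c}
      \<union> {x. inner (b1 + b2) x = of_int i + inner b1 c + inner b2 c})"
  proof
    fix x assume "x \<in> {x. \<not> regular_pt x}"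
    then have "sg x \<in> \<int> \<or> tu x \<in> \<int> \<or> sg x + tu x \<in> \<int>" by (auto simp: regular_pt_def)
    then obtain i :: int where "sg x = of_int i \<or> tu x = of_int i \<or> sg x + tu x = of_int i"
      by (meson Ints_cases)
    then have "inner b1 x = of_int i + inner b1 c \<or> inner b2 x = of_int i + inner b2 c
        \<or> inner (b1 + b2) x = of_int i + inner b1 c + inner b2 c"
      unfolding sg_affine tu_affine inner_add_left by linarith
    then show "x \<in> (\<Union>i::int. {x. inner b1 x = of_int i + inner b1 c} \<union> {x. inner b2 x = of_int i + inner b2 c}
      \<union> {x. inner (b1 + b2) x = of_int i + inner b1 c + inner b2 c})" by blast
  qed
  moreover have "negligible (\<Union>i::int. {x. inner b1 x = of_int i + inner b1 c} \<union> {x. inner b2 x = of_int i + inner b2 c}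
      \<union> {x. inner (b1 + b2) x = of_int i + inner b1 c + inner b2 c})"
    using b by (intro negligible_countable_Union) (auto intro!: negligible_Un negligible_hyperplane)
  ultimately show ?thesis by (rule negligible_subset[rotated])
qed

lemma AE_regular: "AE x in lebesgue. regular_pt x"
  using negligible_not_regular
  by (auto simp: negligible_iff_null_sets intro!: AE_I'[of "{x. \<not> regular_pt x}"])

lemma closure_regular: "closure {x \<in> hex_open. regular_pt x} = hex_closed"
proof
  show "closure {x \<in> hex_open. regular_pt x} \<subseteq> hex_closed"
    unfolding closure_hex_open[symmetric] by (intro closure_mono) auto
  have "hex_open \<subseteq> closure {x \<in> hex_open. regular_pt x}"
  proof
    fix x assume x: "x \<in> hex_open"
    show "x \<in> closure {x \<in> hex_open. regular_pt x}"
      unfolding closure_iff_nhds_not_empty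
    proof (intro allI impI)
      fix A V assume "V \<subseteq> A" "open V" "x \<in> V"
      then have "open (V \<inter> hex_open)" "V \<inter> hex_open \<noteq> {}" using x open_hex_open by auto
      then have "\<not> negligible (V \<inter> hex_open)" by (rule open_not_negligible)
      then have "\<not> V \<inter> hex_open \<subseteq> {x. \<not> regular_pt x}"
        using negligible_not_regular negligible_subset by blast
      then show "{x \<in> hex_open. regular_pt x} \<inter> A \<noteq> {}" using \<open>V \<subseteq> A\<close> by blast
    qed
  qed
  then show "hex_closed \<subseteq> closure {x \<in> hex_open. regular_pt x}"
    unfolding closure_hex_open[symmetric] by (intro closure_minimal) auto
qed

text \<open>Three corner values determine an affine function on a triangle. Regular points are
  dense, so continuity extends the equality to the closed hexagon, and outside both functions
  vanish. This is the uniqueness behind the definite description in \<open>hat\<close>.\<close>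

lemma fe_space_unique:
  assumes f: "f \<in> fe_space v m" and g: "g \<in> fe_space v m"
    and eq: "\<And>q. q \<in> mesh_nodes v m \<Longrightarrow> f q = g q"
  shows "f = g"
proof
  fix x
  show "f x = g x"
  proof (cases "x \<in> hex_closed")
    case False
    then show ?thesis using f g by (simp add: fe_space_def closure_hex_domain)
  next
    case True
    have reg: "f x - g x = 0" if x: "x \<in> {x \<in> hex_open. regular_pt x}" for x
    proof -
      from x have xh: "x \<in> hex_open" and "regular_pt x" by simp_all
      from this(2) obtain e p where ep: "e \<in> {1, -1}" "x \<in> cell e p" by (rule regular_in_cell)
      have sub: "cell e p \<subseteq> hex_open" by (rule subsetI) (rule cell_in_hex[OF ep xh])
      then have T: "ccell e p \<in> mesh v m" using ep unfolding mesh_eq by blast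
      have xc: "x \<in> ccell e p" using ep by (auto simp: cell_def ccell_def)
      have val: "k x = k (node p) + (e * (sg x - of_int (fst p))) * (k (node (nb1 e p)) - k (node p))
          + (e * (tu x - of_int (snd p))) * (k (node (nb2 e p)) - k (node p))" if k: "k \<in> fe_space v m" for k
      proof -
        obtain b \<beta> where b: "\<forall>y\<in>ccell e p. k y = inner b y + \<beta>"
          using k T unfolding fe_space_def by blast
        have "inner b x = inner b (node p + (e * (sg x - of_int (fst p))) *\<^sub>R (node (nb1 e p) - node p)
           + (e * (tu x - of_int (snd p))) *\<^sub>R (node (nb2 e p) - node p))"
          by (rule arg_cong[OF ccell_barycentric[OF ep(1)]])
        then have "inner b x = inner b (node p) + (e * (sg x - of_int (fst p))) * (inner b (node (nb1 e p)) - inner b (node p))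
           + (e * (tu x - of_int (snd p))) * (inner b (node (nb2 e p)) - inner b (node p))"
          by (simp only: inner_add_right inner_diff_right inner_scaleR_right)
        moreover have "k x = inner b x + \<beta>" "k (node p) = inner b (node p) + \<beta>"
          "k (node (nb1 e p)) = inner b (node (nb1 e p)) + \<beta>" "k (node (nb2 e p)) = inner b (node (nb2 e p)) + \<beta>"
          using b xc vertices_in_ccell[OF ep(1)] by blast+
        ultimately show ?thesis by simp
      qed
      have "f (node p) = g (node p)" "f (node (nb1 e p)) = g (node (nb1 e p))" "f (node (nb2 e p)) = g (node (nb2 e p))"
        using eq cell_vertex_mesh_node[OF ep(1) sub] by blast+
      then show ?thesis unfolding val[OF f] val[OF g] by simp
    qed
    have "continuous_on hex_closed f" "continuous_on hex_closed g"
      using f g by (auto simp: fe_space_def closure_hex_domain)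
    then have "continuous_on (closure {x \<in> hex_open. regular_pt x}) (\<lambda>x. f x - g x)"
      unfolding closure_regular by (intro continuous_intros)
    from continuous_constant_on_closure[OF this reg] True
    show ?thesis unfolding closure_regular by simp
  qed
qed

lemma hat_eq_phi:
  assumes q: "q \<in> hex_lattice m"
  shows "hat v m (node q) = phi q"
  unfolding hat_def
proof (rule the_equality)
  have other: "phi q x = 0" if x: "x \<in> mesh_nodes v m - {node q}" for x
  proof -
    obtain p where "x = node p" using mesh_node_is_node x by blast
    then show ?thesis using x by (auto simp: phi_node)
  qed
  show "phi q \<in> fe_space v m \<and> phi q (node q) = 1 \<and> (\<forall>x\<in>mesh_nodes v m - {node q}. phi q x = 0)"
    using phi_in_fe_space[OF q] other by (simp add: phi_node)
  fix f assume f: "f \<in> fe_space v m \<and> f (node q) = 1 \<and> (\<forall>x\<in>mesh_nodes v m - {node q}. f x = 0)"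
  show "f = phi q"
  proof (rule fe_space_unique)
    fix x assume x: "x \<in> mesh_nodes v m"
    show "f x = phi q x"
      using f other[of x] x by (cases "x = node q") (auto simp: phi_node)
  qed (use f phi_in_fe_space[OF q] in auto)
qed

section \<open>Open stars and products of gradients\<close>

definition star :: "int \<times> int \<Rightarrow> (real^2) set" where "star q = {x. phi q x > 0}"

lemma open_star: "open (star q)"
  unfolding star_def by (intro open_Collect_less continuous_phi continuous_on_const)

lemma star_eq: "star q = {x. rhexnorm (sg x - of_int (fst q)) (tu x - of_int (snd q)) < 1}"
  by (auto simp: star_def phi_def)

lemma star_subset: "q \<in> hex_lattice m \<Longrightarrow> star q \<subseteq> hex_open"
  using phi_outside[of q] unfolding star_def by (metis (no_types, lifting) less_irrefl mem_Collect_eq subsetI)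

lemma star_on_cell:
  assumes "e \<in> {1, -1}" "x \<in> cell e p"
  shows "x \<in> star q \<longleftrightarrow> q = p \<or> q = nb1 e p \<or> q = nb2 e p"
proof -
  have x: "x \<in> ccell e p" using assms by (auto simp: cell_def ccell_def)
  have "phi p x > 0" "phi (nb1 e p) x > 0" "phi (nb2 e p) x > 0"
    unfolding phi_on_cell[OF assms(1) x] using assms(2) by (auto simp: cell_def)
  moreover have "x \<in> star q \<Longrightarrow> q = p \<or> q = nb1 e p \<or> q = nb2 e p"
    using phi_off_cell[OF assms(1) x, of q] unfolding star_def mem_Collect_eq by (metis less_irrefl)
  ultimately show ?thesis unfolding star_def mem_Collect_eq by blast
qed

text \<open>In an equilateral triangle the gradients of the barycentric coordinates have equal
  length and pairwise angles of 120 degrees, so two distinct ones have the inner product -\<rho> / 2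
  on every triangle that contains both nodes.\<close>

definition pair_coeff :: "int \<times> int \<Rightarrow> int \<times> int \<Rightarrow> real" where
  "pair_coeff q r = (if q = r then \<rho> else - \<rho> / 2)"

lemma grad_product:
  assumes "regular_pt x"
  shows "inner (grad (phi q) x) (grad (phi r) x) = pair_coeff q r * indicator (star q \<inter> star r) x"
proof -
  obtain e p where ep: "e \<in> {1, -1}" "x \<in> cell e p" using assms by (rule regular_in_cell)
  have ne: "nb1 e p \<noteq> p" "nb2 e p \<noteq> p" "nb2 e p \<noteq> nb1 e p"
    by (auto simp: nb1_def nb2_def prod_eq_iff split: if_splits)
  have ee: "e * e = 1" "\<And>r. e * (e * r) = r" using ep(1) by auto
  have g21: "inner b2 b1 = - \<rho> / 2" using gram(3) by (simp add: inner_commute)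
  have ip: "inner (cell_grad e p q) (cell_grad e p r)
     = (if (q = p \<or> q = nb1 e p \<or> q = nb2 e p) \<and> (r = p \<or> r = nb1 e p \<or> r = nb2 e p) then pair_coeff q r else 0)"
  proof (cases "(q = p \<or> q = nb1 e p \<or> q = nb2 e p) \<and> (r = p \<or> r = nb1 e p \<or> r = nb2 e p)")
    case False
    then have "cell_grad e p q = 0 \<or> cell_grad e p r = 0" unfolding cell_grad_def by metis
    then show ?thesis using False by auto
  next
    case True
    have cg: "cell_grad e p p = (- e) *\<^sub>R b1 + (- e) *\<^sub>R b2" "cell_grad e p (nb1 e p) = e *\<^sub>R b1"
      "cell_grad e p (nb2 e p) = e *\<^sub>R b2" using ne by (simp_all add: cell_grad_def)
    have pc: "pair_coeff s s = \<rho>" "s \<noteq> t \<Longrightarrow> pair_coeff s t = - \<rho> / 2" for s t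
      by (simp_all add: pair_coeff_def)
    have "inner (cell_grad e p q) (cell_grad e p r) = pair_coeff q r"
      using conjunct1[OF True] conjunct2[OF True]
      by (elim disjE; hypsubst)
         (simp_all only: cg pc ne ne[symmetric] not_False_eq_True inner_add_left inner_add_right inner_scaleR_left inner_scaleR_right gram g21
            mult_minus_left mult_minus_right ee minus_minus, simp_all add: ee)
    then show ?thesis using True by simp
  qed
  show ?thesis
    unfolding grad_phi[OF ep] ip indicator_def Int_iff star_on_cell[OF ep] by simp
qed

lemma bounded_coords: "bounded {x. \<bar>sg x\<bar> \<le> r \<and> \<bar>tu x\<bar> \<le> r}"
proof (rule boundedI)
  fix x assume x: "x \<in> {x. \<bar>sg x\<bar> \<le> r \<and> \<bar>tu x\<bar> \<le> r}"
  have "norm x = norm (c + sg x *\<^sub>R e1 + tu x *\<^sub>R e2)" using pt_sg_tu[of x] by (simp add: pt_def)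
  also have "\<dots> \<le> norm c + norm (sg x *\<^sub>R e1) + norm (tu x *\<^sub>R e2)"
    by (meson norm_triangle_ineq norm_triangle_le add_mono order_refl order_trans)
  also have "\<dots> \<le> norm c + r * norm e1 + r * norm e2"
    using x by (intro add_mono) (auto intro: mult_right_mono)
  finally show "norm x \<le> norm c + r * norm e1 + r * norm e2" .
qed

lemma bounded_hex_open: "bounded hex_open"
  by (rule bounded_subset[OF bounded_coords[of "real m"]]) (auto simp: hex_open_def rhexnorm_less_iff)

lemma bounded_star: "bounded (star q)"
proof (rule bounded_subset[OF bounded_coords[of "1 + \<bar>of_int (fst q)\<bar> + \<bar>of_int (snd q)\<bar>"]])
  show "star q \<subseteq> {x. \<bar>sg x\<bar> \<le> 1 + \<bar>of_int (fst q)\<bar> + \<bar>of_int (snd q)\<bar> \<and> \<bar>tu x\<bar> \<le> 1 + \<bar>of_int (fst q)\<bar> + \<bar>of_int (snd q)\<bar>}"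
    unfolding star_eq rhexnorm_less_iff by auto
qed

lemma lmeasurable_star_Int: "star q \<inter> star r \<in> lmeasurable"
  by (intro lmeasurable_open bounded_subset[OF bounded_star[of q]] open_Int open_star) auto

lemma lmeasurable_cell: "e \<in> {1, -1} \<Longrightarrow> cell e p \<in> lmeasurable"
proof (rule lmeasurable_open)
  assume e: "e \<in> {1, -1}"
  have "cell e p \<subseteq> star p" using star_on_cell[OF e, of _ p p] by blast
  then show "bounded (cell e p)" using bounded_star bounded_subset by blast
qed (rule open_cell)

text \<open>The product of gradients is constant on the common star and zero elsewhere, up to the
  null set of lattice lines, on which the value of \<open>grad\<close> may be arbitrary.\<close>

lemma stiffness_entry:
  assumes q: "q \<in> hex_lattice m" and r: "r \<in> hex_lattice m"
    and a: "set_integrable lebesgue (star q \<inter> star r) a"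
  shows "(LINT x:hex_domain v|lebesgue. a x * inner (grad (hat v m (node q)) x) (grad (hat v m (node r)) x))
     = pair_coeff q r * (LINT x:star q \<inter> star r|lebesgue. a x)"
proof -
  let ?F = "\<lambda>x. a x * inner (grad (phi q) x) (grad (phi r) x)"
  let ?G = "\<lambda>x. pair_coeff q r * (indicator (star q \<inter> star r) x * a x)"
  have sub: "star q \<inter> star r \<subseteq> hex_open" using star_subset[OF q] by blast
  have ind: "indicator hex_open x *\<^sub>R ?G x = pair_coeff q r * (indicator (star q \<inter> star r) x *\<^sub>R a x)" for x
    using sub by (auto simp: indicator_def)
  have Gi: "?G absolutely_integrable_on hex_open"
    using a unfolding set_integrable_def ind by (intro integrable_mult_right)
  have eq: "?F x = ?G x" if "x \<in> hex_open - {x. \<not> regular_pt x}" for x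
    using that grad_product[of x q r] by simp
  have Fi: "?F absolutely_integrable_on hex_open"
    by (rule absolutely_integrable_spike[OF Gi negligible_not_regular eq])
  have "(LINT x:hex_open|lebesgue. ?F x) = integral hex_open ?F"
    by (rule set_lebesgue_integral_eq_integral(2)[OF Fi])
  also have "\<dots> = integral hex_open ?G"
    by (rule integral_spike[OF negligible_not_regular]) (rule eq[symmetric])
  also have "\<dots> = (LINT x:hex_open|lebesgue. ?G x)"
    by (rule set_lebesgue_integral_eq_integral(2)[OF Gi, symmetric])
  also have "\<dots> = pair_coeff q r * (LINT x:star q \<inter> star r|lebesgue. a x)"
    unfolding set_lebesgue_integral_def ind by simp
  finally show ?thesis by (simp only: hat_eq_phi[OF q] hat_eq_phi[OF r] hex_domain_eq)
qed

text \<open>A common point forces a lattice distance below 2, and integrality lowers it to at most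
  1.\<close>

lemma star_disjoint:
  assumes "q \<noteq> r" "r - q \<notin> hex_nbrs"
  shows "star q \<inter> star r = {}"
proof (rule ccontr)
  assume "star q \<inter> star r \<noteq> {}"
  then obtain x where x: "rhexnorm (sg x - of_int (fst q)) (tu x - of_int (snd q)) < 1"
    "rhexnorm (sg x - of_int (fst r)) (tu x - of_int (snd r)) < 1" by (auto simp: star_eq)
  have "real_of_int \<bar>fst (r - q)\<bar> < real_of_int 2" "real_of_int \<bar>snd (r - q)\<bar> < real_of_int 2"
    "real_of_int \<bar>fst (r - q) + snd (r - q)\<bar> < real_of_int 2"
    using x unfolding rhexnorm_less_iff by (simp_all, linarith+)
  then have "\<bar>fst (r - q)\<bar> < 2" "\<bar>snd (r - q)\<bar> < 2" "\<bar>fst (r - q) + snd (r - q)\<bar> < 2"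
    by (simp_all only: of_int_less_iff)
  then have "hexnorm (r - q) \<le> 1" unfolding hexnorm_le_iff by linarith
  then have "hexnorm (r - q) = 0 \<or> hexnorm (r - q) = 1" using hexnorm_nonneg[of "r - q"] by linarith
  then show False using assms by (auto simp: hexnorm_eq_0_iff hexnorm_eq_1_iff)
qed

section \<open>Areas of triangles, stars and their intersections\<close>

lemma measure_cell:
  assumes "e \<in> {1, -1}"
  shows "measure lebesgue (cell e p) = measure lebesgue (cell 1 0)"
proof -
  have ee: "e * e = 1" "\<And>r. e * (e * r) = r" "\<bar>e\<bar> = 1" using assms by auto
  have co: "sg (e *\<^sub>R x + (node p - e *\<^sub>R c)) = e * sg x + of_int (fst p)"
    "tu (e *\<^sub>R x + (node p - e *\<^sub>R c)) = e * tu x + of_int (snd p)" for x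
  proof -
    have "e *\<^sub>R x + (node p - e *\<^sub>R c) = node p + e *\<^sub>R (x - c)" by (simp add: algebra_simps)
    then show "sg (e *\<^sub>R x + (node p - e *\<^sub>R c)) = e * sg x + of_int (fst p)"
      "tu (e *\<^sub>R x + (node p - e *\<^sub>R c)) = e * tu x + of_int (snd p)"
      by (simp_all only: sg_add_scaleR tu_add_scaleR sg_node tu_node) (simp_all add: sg_def tu_def)
  qed
  have mem: "e *\<^sub>R x + (node p - e *\<^sub>R c) \<in> cell e p \<longleftrightarrow> x \<in> cell 1 0" for x
  proof -
    have h: "e * (e * sg x + f - f) = sg x" "e * (e * tu x + g - g) = tu x" for f g by (simp_all add: ee)
    have h2: "e * (e * sg x + f + (e * tu x + g) - f - g) = sg x + tu x" for f g
    proof -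
      have "e * (e * sg x + f + (e * tu x + g) - f - g) = (e * e) * (sg x + tu x)" by (simp add: algebra_simps)
      then show ?thesis by (simp add: ee)
    qed
    show ?thesis unfolding cell_def mem_Collect_eq co h h2 by simp
  qed
  have "cell e p = (\<lambda>x. e *\<^sub>R x + (node p - e *\<^sub>R c)) ` cell 1 0"
  proof (intro equalityI subsetI)
    fix y assume y: "y \<in> cell e p"
    define x where "x = e *\<^sub>R (y - (node p - e *\<^sub>R c))"
    have "y = e *\<^sub>R x + (node p - e *\<^sub>R c)" by (simp add: x_def ee)
    then show "y \<in> (\<lambda>x. e *\<^sub>R x + (node p - e *\<^sub>R c)) ` cell 1 0" using mem[of x] y by blast
  qed (use mem in blast)
  then show ?thesis using measure_lebesgue_affine[of e "node p - e *\<^sub>R c" "cell 1 0"] by (simp add: ee)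
qed

definition tri_area :: real where "tri_area = measure lebesgue (cell 1 0)"

lemma tri_area_pos: "tri_area > 0"
proof -
  have "\<not> negligible (cell 1 0)" using open_not_negligible[OF open_cell] cell_center[of 1 0] by blast
  then have "measure lebesgue (cell 1 0) \<noteq> 0"
    using lmeasurable_cell[of 1 0] by (simp add: negligible_iff_measure)
  then show ?thesis unfolding tri_area_def using measure_nonneg[of lebesgue "cell 1 0"] by linarith
qed

text \<open>Adjacent nodes share the two triangles on either side of their edge; \<open>r1\<close>
  is the corner of the one with sign 1 and \<open>r2\<close> that of the one with sign -1. Three of
  the six directions are enough, as the others exchange the two nodes.\<close>

lemma star_Int_two_cells:
  fixes q d :: "int \<times> int"
  assumes "regular_pt x" "d \<in> {(1,0), (0,1), (-1,1)}"
  defines "r1 \<equiv> (if d = (-1,1) then (fst q - 1, snd q) else q)"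
    and "r2 \<equiv> (if d = (1,0) then (fst q + 1, snd q) else (fst q, snd q + 1))"
  shows "x \<in> star q \<inter> star (q + d) \<longleftrightarrow> x \<in> cell 1 r1 \<union> cell (-1) r2"
proof -
  obtain e p where ep: "e \<in> {1, -1}" "x \<in> cell e p" using assms(1) by (rule regular_in_cell)
  have "x \<in> cell e' p' \<longleftrightarrow> e = e' \<and> p = p'" if "e' \<in> {1, -1}" for e' p'
    using cell_unique[OF ep(1) that ep(2), of p'] ep(2) by blast
  then have cells: "x \<in> cell 1 r1 \<union> cell (-1) r2 \<longleftrightarrow> (e = 1 \<and> p = r1) \<or> (e = -1 \<and> p = r2)" by simp
  obtain p1 p2 q1 q2 where pq: "p = (p1, p2)" "q = (q1, q2)" by (metis prod.exhaust)
  from ep(1) have "e = 1 \<or> e = -1" by blast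
  then show ?thesis using assms(2) unfolding cells unfolding Int_iff star_on_cell[OF ep] r1_def r2_def pq nb1_def nb2_def
    by (elim insertE emptyE disjE; hypsubst) (simp_all, presburger+)
qed

lemma measure_star_Int:
  assumes "d \<in> hex_nbrs"
  shows "measure lebesgue (star q \<inter> star (q + d)) = 2 * tri_area"
proof -
  have main: "measure lebesgue (star q \<inter> star (q + d)) = 2 * tri_area"
    if d: "d \<in> {(1,0), (0,1), (-1,1)}" for q d
  proof -
    define r1 where "r1 = (if d = (-1,1) then (fst q - 1, snd q) else q)"
    define r2 where "r2 = (if d = (1,0) then (fst q + 1, snd q) else (fst q, snd q + 1))"
    have "measure lebesgue (star q \<inter> star (q + d)) = measure lebesgue (cell 1 r1 \<union> cell (-1) r2)"
    proof (rule measure_eq_AE)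
      show "AE x in lebesgue. x \<in> star q \<inter> star (q + d) \<longleftrightarrow> x \<in> cell 1 r1 \<union> cell (-1) r2"
        using AE_regular by eventually_elim (unfold r1_def r2_def, rule star_Int_two_cells[OF _ d])
    qed (use lmeasurable_star_Int lmeasurable_cell in \<open>auto intro!: fmeasurableD\<close>)
    also have "\<dots> = measure lebesgue (cell 1 r1) + measure lebesgue (cell (-1) r2)"
    proof (rule measure_Un2[THEN trans])
      have "cell (-1) r2 - cell 1 r1 = cell (-1) r2" using cell_unique[of 1 "-1"] by fastforce
      then show "measure lebesgue (cell 1 r1) + measure lebesgue (cell (-1) r2 - cell 1 r1)
         = measure lebesgue (cell 1 r1) + measure lebesgue (cell (-1) r2)" by simp
    qed (use lmeasurable_cell in auto)
    finally show ?thesis using measure_cell[of 1 r1] measure_cell[of "-1" r2] unfolding tri_area_def by simp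
  qed
  show ?thesis
  proof (cases "d \<in> {(1,0), (0,1), (-1,1)}")
    case True
    then show ?thesis by (rule main)
  next
    case False
    \<comment> \<open>The same edge seen from its other end.\<close>
    then have "- d \<in> {(1,0), (0,1), (-1,1)}" using assms by (auto simp: hex_nbrs_def)
    from main[OF this, of "q + d"] show ?thesis by (simp add: Int_commute)
  qed
qed

text \<open>A triangle in the star of \<open>q\<close> has two corners besides \<open>q\<close>, so
  it is counted twice.\<close>

lemma sum_star_Int:
  assumes "regular_pt x"
  shows "(\<Sum>d\<in>hex_nbrs. indicator (star q \<inter> star (q + d)) x) = (2 * indicator (star q) x :: real)"
proof -
  obtain e p where ep: "e \<in> {1, -1}" "x \<in> cell e p" using assms by (rule regular_in_cell)
  have i: "indicator (star r) x = (if r = p \<or> r = nb1 e p \<or> r = nb2 e p then 1 else 0 :: real)" for r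
    unfolding indicator_def star_on_cell[OF ep] by simp
  have "(\<Sum>d\<in>hex_nbrs. indicator (star (q + d)) x) = (2 :: real)" if "x \<in> star q"
  proof -
    have "q = p \<or> q = nb1 e p \<or> q = nb2 e p" using that star_on_cell[OF ep] by simp
    moreover obtain p1 p2 where "p = (p1, p2)" by (cases p)
    moreover have "e = 1 \<or> e = -1" using ep(1) by simp
    ultimately show ?thesis
      unfolding i hex_nbrs_def by (elim disjE) (simp_all add: nb1_def nb2_def zero_prod_def)
  qed
  then show ?thesis
    by (cases "x \<in> star q") (simp_all add: indicator_inter_arith)
qed

lemma integral_star_split:
  fixes f :: "real^2 \<Rightarrow> real"
  assumes "set_integrable lebesgue (star q) f"
  shows "2 * (LINT x:star q|lebesgue. f x) = (\<Sum>d\<in>hex_nbrs. LINT x:star q \<inter> star (q + d)|lebesgue. f x)"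
proof -
  have int: "set_integrable lebesgue (star q \<inter> star (q + d)) f" for d
    by (rule set_integrable_subset[OF assms]) (use lmeasurable_star_Int in \<open>auto intro!: fmeasurableD\<close>)
  have "(\<Sum>d\<in>hex_nbrs. LINT x:star q \<inter> star (q + d)|lebesgue. f x)
      = (LINT x|lebesgue. (\<Sum>d\<in>hex_nbrs. indicator (star q \<inter> star (q + d)) x *\<^sub>R f x))"
    unfolding set_lebesgue_integral_def
    by (rule Bochner_Integration.integral_sum[symmetric]) (use int in \<open>simp add: set_integrable_def\<close>)
  also have "\<dots> = (LINT x|lebesgue. 2 * (indicator (star q) x *\<^sub>R f x))"
  proof (rule integral_cong_AE)
    show "AE x in lebesgue. (\<Sum>d\<in>hex_nbrs. indicator (star q \<inter> star (q + d)) x *\<^sub>R f x) = 2 * (indicator (star q) x *\<^sub>R f x)"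
      using AE_regular
    proof eventually_elim
      case (elim x)
      show ?case using sum_star_Int[OF elim, of q]
        by (simp add: sum_distrib_right[symmetric])
    qed
    show "(\<lambda>x. \<Sum>d\<in>hex_nbrs. indicator (star q \<inter> star (q + d)) x *\<^sub>R f x) \<in> borel_measurable lebesgue"
      using int unfolding set_integrable_def by (intro borel_measurable_sum borel_measurable_integrable)
    show "(\<lambda>x. 2 * (indicator (star q) x *\<^sub>R f x)) \<in> borel_measurable lebesgue"
      using assms unfolding set_integrable_def by (intro borel_measurable_times borel_measurable_const borel_measurable_integrable)
  qed
  also have "\<dots> = 2 * (LINT x:star q|lebesgue. f x)" unfolding set_lebesgue_integral_def by simp
  finally show ?thesis by simp
qed

lemma measure_star: "measure lebesgue (star q) = 6 * tri_area"
proof -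
  have fin: "star q \<in> lmeasurable" using lmeasurable_star_Int[of q q] by simp
  have m: "(LINT x:A|lebesgue. 1) = measure lebesgue A" if "A \<in> lmeasurable" for A :: "(real^2) set"
    using that by (simp add: set_lebesgue_integral_def)
  have "set_integrable lebesgue (star q) (\<lambda>_. 1 :: real)"
    using fin by (simp add: set_integrable_def lmeasurable_iff_integrable)
  from integral_star_split[OF this]
  have "2 * measure lebesgue (star q) = (\<Sum>d\<in>hex_nbrs. 2 * tri_area)"
    unfolding m[OF fin] m[OF lmeasurable_star_Int] by (simp add: measure_star_Int)
  then show ?thesis by (simp add: card_hex_nbrs)
qed

end

section \<open>Averages of the coefficient\<close>

lemma set_integrable_continuous_bounded:
  fixes f :: "'a::euclidean_space \<Rightarrow> real"
  assumes D: "open D" "D \<in> lmeasurable" and f: "continuous_on D f" and B: "\<And>x. x \<in> D \<Longrightarrow> \<bar>f x\<bar> \<le> B"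
  shows "set_integrable lebesgue D f"
proof (rule measurable_bounded_by_integrable_imp_absolutely_integrable)
  show "D \<in> sets lebesgue" using D(2) by (rule fmeasurableD)
  then show "f \<in> borel_measurable (lebesgue_on D)"
    by (rule continuous_imp_measurable_on_sets_lebesgue[OF f])
  show "(\<lambda>_. B) integrable_on D" using D(2) by (rule integrable_on_const)
qed (use B in simp)

text \<open>The gap is half the square of sqrt x - sqrt y, and this difference is at most |x - y| /
  (2 sqrt a0). So the gap is quadratic in the difference of the arguments.\<close>

lemma geometric_arithmetic_gap:
  assumes "a0 > 0" "x \<ge> a0" "y \<ge> (a0::real)"
  shows "\<bar>(x + y) / 2 - sqrt x * sqrt y\<bar> \<le> (x - y)\<^sup>2 / (8 * a0)"
proof -
  define s t where "s = sqrt x" and "t = sqrt y"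
  have st: "x = s\<^sup>2" "y = t\<^sup>2" "s \<ge> sqrt a0" "t \<ge> sqrt a0" using assms by (auto simp: s_def t_def)
  have "sqrt a0 > 0" using assms by simp
  have "(2 * sqrt a0)\<^sup>2 \<le> (s + t)\<^sup>2" using st \<open>sqrt a0 > 0\<close> by (intro power_mono) auto
  then have a: "4 * a0 \<le> (s + t)\<^sup>2" using assms by (simp add: power_mult_distrib)
  have "(s - t)\<^sup>2 * (4 * a0) \<le> (s - t)\<^sup>2 * (s + t)\<^sup>2" by (intro mult_left_mono a) simp
  also have "\<dots> = (x - y)\<^sup>2" unfolding st by (simp add: power2_eq_square algebra_simps)
  finally have "(s - t)\<^sup>2 / 2 \<le> (x - y)\<^sup>2 / (8 * a0)" using assms(1) by (simp add: field_simps)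
  moreover have "(x + y) / 2 - sqrt x * sqrt y = (s - t)\<^sup>2 / 2"
    unfolding s_def[symmetric] t_def[symmetric] unfolding st by (simp add: power2_eq_square field_simps)
  moreover have "(s - t)\<^sup>2 / 2 \<ge> 0" by simp
  ultimately show ?thesis by linarith
qed

text \<open>Prepared for \<open>mean_gap\<close>: \<open>b\<close> is the edge average,
  \<open>w\<close> the value at the midpoint, \<open>p'\<close> and \<open>r'\<close> the values at
  the nodes, \<open>p\<close> and \<open>r\<close> the star averages, \<open>s\<close> their
  geometric mean.\<close>

lemma abs_diff_chain:
  fixes b w p r p' r' s :: real
  assumes "\<bar>b - w\<bar> \<le> e1" "\<bar>p - p'\<bar> \<le> e1" "\<bar>r - r'\<bar> \<le> e1" "\<bar>p' + r' - 2 * w\<bar> \<le> e2"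
    "\<bar>(p + r) / 2 - s\<bar> \<le> e3"
  shows "\<bar>b - s\<bar> \<le> e1 + e2 / 2 + e1 + e3"
proof (rule abs_leI)
  note D = abs_le_D1[OF assms(1)] abs_le_D1[OF assms(2)] abs_le_D1[OF assms(3)] abs_le_D1[OF assms(4)] abs_le_D1[OF assms(5)]
    abs_le_D2[OF assms(1)] abs_le_D2[OF assms(2)] abs_le_D2[OF assms(3)] abs_le_D2[OF assms(4)] abs_le_D2[OF assms(5)]
  show "b - s \<le> e1 + e2 / 2 + e1 + e3" "- (b - s) \<le> e1 + e2 / 2 + e1 + e3"
    using D by (simp_all add: field_simps)
qed

lemma mat_inverse_mat_diag:
  fixes f :: "nat \<Rightarrow> 'a::field"
  assumes "\<And>i. i < n \<Longrightarrow> f i \<noteq> 0"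
  shows "mat_inverse (mat_diag n f) = Some (mat_diag n (\<lambda>i. inverse (f i)))"
proof -
  let ?X = "mat_diag n f" and ?Y = "mat_diag n (\<lambda>i. inverse (f i))"
  have one: "mat_diag n (\<lambda>i. f i * inverse (f i)) = 1\<^sub>m n" "mat_diag n (\<lambda>i. inverse (f i) * f i) = 1\<^sub>m n"
    using assms by (auto simp: mat_diag_def intro!: eq_matI)
  have XY: "?X * ?Y = 1\<^sub>m n" "?Y * ?X = 1\<^sub>m n" by (simp_all add: one)
  have "?X \<in> Units (ring_mat TYPE('a) n n)"
  proof -
    have "\<exists>x\<in>carrier_mat n n. x * ?X = 1\<^sub>m n \<and> ?X * x = 1\<^sub>m n"
      by (rule bexI[of _ ?Y]) (use XY in \<open>blast, simp\<close>)
    then show ?thesis unfolding Units_def ring_mat_def by simp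
  qed
  then obtain B where B: "mat_inverse ?X = Some B"
    using mat_inverse(1)[OF mat_diag_dim, where b = n] by (cases "mat_inverse ?X") auto
  from mat_inverse(2)[OF mat_diag_dim B] have b: "B * ?X = 1\<^sub>m n" "B \<in> carrier_mat n n" by auto
  have "B = B * (?X * ?Y)" using XY b by simp
  also have "\<dots> = B * ?X * ?Y" by (rule assoc_mult_mat[symmetric, OF b(2) mat_diag_dim mat_diag_dim])
  also have "\<dots> = ?Y" unfolding b(1) by (rule left_mult_one_mat) (rule mat_diag_dim)
  finally show ?thesis using B by simp
qed

section \<open>Stiffness entries as averages times the lattice Laplacian\<close>

context hexagon_mesh
begin

text \<open>For \<open>q = r\<close> the average over the star of \<open>q\<close>. For distinct
  nodes that are not adjacent it is 0 / 0 = 0, and there the factor \<open>hex_laplacian q r\<close>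
  vanishes as well.\<close>

definition mean :: "(real^2 \<Rightarrow> real) \<Rightarrow> int \<times> int \<Rightarrow> int \<times> int \<Rightarrow> real" where
  "mean a q r = (LINT x:star q \<inter> star r|lebesgue. a x) / measure lebesgue (star q \<inter> star r)"

text \<open>On the diagonal \<open>pair_coeff\<close> times the area is \<rho> times six triangles,
  and for an edge -\<rho> / 2 times two triangles: in both cases this number times the entry 6 or -1
  of the lattice Laplacian.\<close>

definition stiff :: real where "stiff = \<rho> * tri_area"

lemma stiff_pos: "stiff > 0" using rho tri_area_pos by (simp add: stiff_def)

lemma measure_pair_pos: "r = q \<or> r - q \<in> hex_nbrs \<Longrightarrow> measure lebesgue (star q \<inter> star r) > 0"
  using measure_star[of q] measure_star_Int[of "r - q" q] tri_area_pos by auto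

lemma stiffness_entry_mean:
  assumes "q \<in> hex_lattice m" "r \<in> hex_lattice m" "set_integrable lebesgue (star q \<inter> star r) a"
  shows "(LINT x:hex_domain v|lebesgue. a x * inner (grad (hat v m (node q)) x) (grad (hat v m (node r)) x))
     = stiff * hex_laplacian q r * mean a q r"
proof -
  consider "q = r" | "q \<noteq> r" "r - q \<in> hex_nbrs" | "q \<noteq> r" "r - q \<notin> hex_nbrs" by blast
  then show ?thesis
  proof cases
    case 1
    then show ?thesis unfolding stiffness_entry[OF assms] using tri_area_pos
      by (simp add: pair_coeff_def stiff_def hex_laplacian_def mean_def measure_star)
  next
    case 2
    then have "measure lebesgue (star q \<inter> star r) = 2 * tri_area"
      using measure_star_Int[of "r - q" q] by simp
    then show ?thesis unfolding stiffness_entry[OF assms] using 2 tri_area_pos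
      by (simp add: pair_coeff_def stiff_def hex_laplacian_def mean_def)
  next
    case 3
    then show ?thesis unfolding stiffness_entry[OF assms]
      by (simp add: star_disjoint hex_laplacian_def set_lebesgue_integral_def)
  qed
qed

lemma norm_diff_le:
  assumes "norm e1 \<le> h" "norm e2 \<le> h"
  shows "norm (x - y) \<le> (\<bar>sg x - sg y\<bar> + \<bar>tu x - tu y\<bar>) * h"
proof -
  have "x - y = pt (sg x) (tu x) - pt (sg y) (tu y)" by (simp add: pt_sg_tu)
  also have "\<dots> = (sg x - sg y) *\<^sub>R e1 + (tu x - tu y) *\<^sub>R e2" by (simp add: pt_def algebra_simps)
  finally have "norm (x - y) \<le> \<bar>sg x - sg y\<bar> * norm e1 + \<bar>tu x - tu y\<bar> * norm e2"
    using norm_triangle_ineq[of "(sg x - sg y) *\<^sub>R e1" "(tu x - tu y) *\<^sub>R e2"] by simp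
  also have "\<dots> \<le> \<bar>sg x - sg y\<bar> * h + \<bar>tu x - tu y\<bar> * h" using assms by (intro add_mono mult_left_mono) auto
  finally show ?thesis by (simp add: distrib_right)
qed

end

locale hexagon_mesh_coeff = hexagon_mesh +
  fixes a :: "real^2 \<Rightarrow> real" and a0 B M h :: real
  assumes cont_a: "continuous_on hex_open a" and a0: "a0 > 0"
    and a_ge: "\<And>x. x \<in> hex_open \<Longrightarrow> a x \<ge> a0" and a_le: "\<And>x. x \<in> hex_open \<Longrightarrow> a x \<le> B"
    and M: "M \<ge> 0" and Lip: "\<And>x y. x \<in> hex_open \<Longrightarrow> y \<in> hex_open \<Longrightarrow> \<bar>a x - a y\<bar> \<le> M * norm (x - y)"
    and diff2: "\<And>x y. x + y \<in> hex_open \<Longrightarrow> x - y \<in> hex_open \<Longrightarrow> \<bar>a (x + y) + a (x - y) - 2 * a x\<bar> \<le> M * (norm y)\<^sup>2"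
    and h: "norm e1 \<le> h" "norm e2 \<le> h"
begin

lemma h_nonneg: "h \<ge> 0" using h(1) norm_ge_zero order_trans by blast

lemma pair_subset: "q \<in> hex_lattice m \<Longrightarrow> star q \<inter> star r \<subseteq> hex_open"
  using star_subset by blast

lemma integrable_a: "q \<in> hex_lattice m \<Longrightarrow> set_integrable lebesgue (star q \<inter> star r) a"
proof (rule set_integrable_continuous_bounded)
  assume q: "q \<in> hex_lattice m"
  show "open (star q \<inter> star r)" by (intro open_Int open_star)
  show "continuous_on (star q \<inter> star r) a" using cont_a pair_subset[OF q] by (rule continuous_on_subset)
  show "\<bar>a x\<bar> \<le> B" if "x \<in> star q \<inter> star r" for x
    using a_ge[of x] a_le[of x] a0 that pair_subset[OF q] by fastforce
qed (rule lmeasurable_star_Int)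

text \<open>The common star is centrally symmetric about the midpoint of the two nodes, so
  \<open>symmetric_mean_approx\<close> applies; the case of a single star is included. Points of the
  set are within 2 h of the midpoint, and M (2 h)^2 / 2 gives the constant.\<close>

lemma mean_approx:
  assumes q: "q \<in> hex_lattice m" and r: "r = q \<or> r - q \<in> hex_nbrs"
  shows "\<bar>mean a q r - a ((1/2) *\<^sub>R (node q + node r))\<bar> \<le> 2 * M * h\<^sup>2"
proof -
  define w where "w = (1/2) *\<^sub>R (node q + node r)"
  let ?D = "star q \<inter> star r"
  have w2: "2 *\<^sub>R w = node q + node r" by (simp add: w_def)
  have refl: "sg (2 *\<^sub>R w - x) = of_int (fst q) + of_int (fst r) - sg x"
    "tu (2 *\<^sub>R w - x) = of_int (snd q) + of_int (snd r) - tu x" for x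
  proof -
    have "2 *\<^sub>R w - x = node q + 1 *\<^sub>R (node r - x)" by (simp add: w2)
    then have "sg (2 *\<^sub>R w - x) = sg (node q) + inner b1 (node r - x)"
      "tu (2 *\<^sub>R w - x) = tu (node q) + inner b2 (node r - x)"
      by (simp_all only: sg_add_scaleR tu_add_scaleR mult_1)
    moreover have "inner b1 (node r - x) = sg (node r) - sg x" "inner b2 (node r - x) = tu (node r) - tu x"
      by (simp_all add: sg_affine tu_affine inner_diff_right)
    ultimately show "sg (2 *\<^sub>R w - x) = of_int (fst q) + of_int (fst r) - sg x"
      "tu (2 *\<^sub>R w - x) = of_int (snd q) + of_int (snd r) - tu x" by simp_all
  qed
  have wc: "sg w = (of_int (fst q) + of_int (fst r)) / 2" "tu w = (of_int (snd q) + of_int (snd r)) / 2"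
    using refl[of w] by (simp_all add: scaleR_2)
  have sym: "2 *\<^sub>R w - x \<in> ?D" if "x \<in> ?D" for x
    using that unfolding star_eq Int_iff mem_Collect_eq rhexnorm_less_iff refl by (auto simp: abs_less_iff)
  have bound: "\<bar>a x + a (2 *\<^sub>R w - x) - 2 * a w\<bar> \<le> M * (2 * h)\<^sup>2" if x: "x \<in> ?D" for x
  proof -
    have eq: "w + (x - w) = x" "w - (x - w) = 2 *\<^sub>R w - x" by (simp_all add: scaleR_2)
    have "\<bar>a x + a (2 *\<^sub>R w - x) - 2 * a w\<bar> \<le> M * (norm (x - w))\<^sup>2"
      using diff2[of w "x - w"] x sym[OF x] pair_subset[OF q, of r] unfolding eq by blast
    also have "\<dots> \<le> M * (2 * h)\<^sup>2"
    proof (intro mult_left_mono power_mono M)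
      have "\<bar>sg x - of_int (fst q)\<bar> < 1" "\<bar>sg x - of_int (fst r)\<bar> < 1"
        "\<bar>tu x - of_int (snd q)\<bar> < 1" "\<bar>tu x - of_int (snd r)\<bar> < 1"
        using x unfolding star_eq Int_iff mem_Collect_eq rhexnorm_less_iff by blast+
      then have "\<bar>sg x - sg w\<bar> \<le> 1" "\<bar>tu x - tu w\<bar> \<le> 1"
        unfolding wc by (auto simp: abs_le_iff abs_less_iff field_simps)
      then have "(\<bar>sg x - sg w\<bar> + \<bar>tu x - tu w\<bar>) * h \<le> 2 * h" using h_nonneg by (intro mult_right_mono) auto
      then show "norm (x - w) \<le> 2 * h" using norm_diff_le[OF h, of x w] by linarith
    qed simp
    finally show ?thesis .
  qed
  have pos: "measure lebesgue ?D > 0" by (rule measure_pair_pos[OF r])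
  have "\<bar>(LINT x:?D|lebesgue. a x) - measure lebesgue ?D * a w\<bar> \<le> measure lebesgue ?D * (M * (2 * h)\<^sup>2 / 2)"
    by (rule symmetric_mean_approx[OF _ lmeasurable_star_Int sym _ integrable_a[OF q] bound])
       (use continuous_on_subset[OF cont_a pair_subset[OF q]] in \<open>simp_all add: open_Int open_star\<close>)
  then have "\<bar>(LINT x:?D|lebesgue. a x) - measure lebesgue ?D * a w\<bar> / measure lebesgue ?D \<le> M * (2 * h)\<^sup>2 / 2"
    using pos by (simp add: pos_divide_le_eq mult.commute)
  also have "\<bar>(LINT x:?D|lebesgue. a x) - measure lebesgue ?D * a w\<bar> / measure lebesgue ?D
      = \<bar>((LINT x:?D|lebesgue. a x) - measure lebesgue ?D * a w) / measure lebesgue ?D\<bar>" using pos by simp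
  also have "((LINT x:?D|lebesgue. a x) - measure lebesgue ?D * a w) / measure lebesgue ?D = mean a q r - a w"
    using pos by (simp add: mean_def diff_divide_distrib)
  finally show ?thesis by (simp add: w_def power_mult_distrib)
qed

lemma mean_ge:
  assumes q: "q \<in> hex_lattice m" and r: "r = q \<or> r - q \<in> hex_nbrs"
  shows "mean a q r \<ge> a0"
proof -
  let ?D = "star q \<inter> star r"
  have "measure lebesgue ?D * a0 = (LINT x:?D|lebesgue. a0)"
    using lmeasurable_star_Int[of q r] by (simp add: set_lebesgue_integral_def)
  also have "\<dots> \<le> (LINT x:?D|lebesgue. a x)"
  proof (rule set_integral_mono)
    show "set_integrable lebesgue ?D (\<lambda>_. a0)"
      by (rule set_integrable_continuous_bounded[OF _ lmeasurable_star_Int, where B = a0])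
         (use a0 in \<open>auto intro!: open_Int open_star continuous_on_const\<close>)
    show "set_integrable lebesgue ?D a" by (rule integrable_a[OF q])
    show "a0 \<le> a x" if "x \<in> ?D" for x using that by (intro a_ge subsetD[OF pair_subset[OF q]])
  qed
  finally show ?thesis using measure_pair_pos[OF r] by (simp add: mean_def pos_le_divide_eq mult.commute)
qed

text \<open>Each triangle of the star lies over two of its six edges. On the whole lattice the
  weighted Laplacian therefore annihilates constants.\<close>

lemma mean_self_eq_sum:
  assumes q: "q \<in> hex_lattice m"
  shows "6 * mean a q q = (\<Sum>d\<in>hex_nbrs. mean a q (q + d))"
proof -
  have "(\<Sum>d\<in>hex_nbrs. mean a q (q + d)) = (\<Sum>d\<in>hex_nbrs. (LINT x:star q \<inter> star (q + d)|lebesgue. a x) / (2 * tri_area))"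
    by (intro sum.cong refl) (simp add: mean_def measure_star_Int)
  also have "\<dots> = 2 * (LINT x:star q|lebesgue. a x) / (2 * tri_area)"
    using integral_star_split[of q a] integrable_a[OF q, of q] by (simp add: sum_divide_distrib)
  also have "\<dots> = 6 * mean a q q" using tri_area_pos by (simp add: mean_def measure_star)
  finally show ?thesis ..
qed

lemma mean_commute: "mean a q r = mean a r q"
  by (simp add: mean_def Int_commute)

text \<open>Up to the factor \<open>stiff\<close> these are the row sums of A(a) - a0 A(1). They
  would vanish on the whole lattice, and leaving out neighbours at the boundary drops only
  nonpositive terms.\<close>

lemma weighted_laplacian_row_sum:
  assumes q: "q \<in> hex_lattice m"
  shows "(\<Sum>r\<in>hex_lattice m. hex_laplacian q r * (mean a q r - a0)) \<ge> 0"
proof -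
  have "mean a q (q + d) - a0 \<ge> 0" if "d \<in> hex_nbrs" for d
    using mean_ge[OF q, of "q + d"] that by simp
  from hex_laplacian_ge[where w = "\<lambda>r. mean a q r - a0", OF q this]
  have "6 * (mean a q q - a0) - (\<Sum>d\<in>hex_nbrs. mean a q (q + d) - a0)
      \<le> (\<Sum>r\<in>hex_lattice m. hex_laplacian q r * (mean a q r - a0))" .
  moreover have "6 * (mean a q q - a0) - (\<Sum>d\<in>hex_nbrs. mean a q (q + d) - a0) = 0"
    using mean_self_eq_sum[OF q] by (simp add: sum_subtractf card_hex_nbrs)
  ultimately show ?thesis by simp
qed

text \<open>Edge average, midpoint value, mean of the nodal values and mean of the star averages
  successively differ by O(h^2). Star averages of adjacent nodes differ only by O(h), so by
  \<open>geometric_arithmetic_gap\<close> the passage to the geometric mean again costs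
  O(h^2).\<close>

lemma mean_gap:
  assumes q: "q \<in> hex_lattice m" and r: "r \<in> hex_lattice m" "r - q \<in> hex_nbrs"
  shows "\<bar>mean a q r - sqrt (mean a q q) * sqrt (mean a r r)\<bar> \<le> (5 * M + (2 * M + 4 * M * h)\<^sup>2 / (8 * a0)) * h\<^sup>2"
proof -
  define w where "w = (1/2) *\<^sub>R (node q + node r)"
  have half: "(1/2) *\<^sub>R (node p + node p) = node p" for p
    by (simp add: scaleR_add_right flip: scaleR_add_left)
  have qr: "\<bar>mean a q q - a (node q)\<bar> \<le> 2 * M * h\<^sup>2" "\<bar>mean a r r - a (node r)\<bar> \<le> 2 * M * h\<^sup>2"
    using mean_approx[OF q, of q] mean_approx[OF r(1), of r] unfolding half by simp_all
  have b: "\<bar>mean a q r - a w\<bar> \<le> 2 * M * h\<^sup>2"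
    unfolding w_def by (rule mean_approx[OF q]) (use r in simp)
  have in_hex: "node q \<in> hex_open" "node r \<in> hex_open" using q r node_in_hex_open_iff by blast+
  have d: "norm (node q - node r) \<le> 2 * h"
  proof -
    have "\<bar>fst q - fst r\<bar> \<le> 1" "\<bar>snd q - snd r\<bar> \<le> 1"
      using r(2) by (auto simp: hex_nbrs_def prod_eq_iff)
    then have "\<bar>real_of_int (fst q - fst r)\<bar> \<le> 1" "\<bar>real_of_int (snd q - snd r)\<bar> \<le> 1" by linarith+
    then have "(\<bar>sg (node q) - sg (node r)\<bar> + \<bar>tu (node q) - tu (node r)\<bar>) * h \<le> 2 * h"
      using h_nonneg by (intro mult_right_mono) auto
    then show ?thesis using norm_diff_le[OF h, of "node q" "node r"] by linarith
  qed
  define y where "y = (1/2) *\<^sub>R (node q - node r)"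
  have wy: "w + y = node q" "w - y = node r"
    unfolding w_def y_def by (simp_all add: Finite_Cartesian_Product.vec_eq_iff field_simps)
  have "(norm y)\<^sup>2 \<le> h\<^sup>2" using d by (intro power_mono) (simp_all add: y_def)
  then have mid: "\<bar>a (node q) + a (node r) - 2 * a w\<bar> \<le> M * h\<^sup>2"
    using diff2[of w y] in_hex M unfolding wy by (meson mult_left_mono order_trans)
  have lip: "\<bar>a (node q) - a (node r)\<bar> \<le> 2 * M * h"
  proof -
    have "\<bar>a (node q) - a (node r)\<bar> \<le> M * norm (node q - node r)" by (rule Lip[OF in_hex])
    also have "\<dots> \<le> M * (2 * h)" using d M by (rule mult_left_mono)
    finally show ?thesis by simp
  qed
  have "\<bar>mean a q q - mean a r r\<bar> \<le> 2 * M * h + 4 * M * h\<^sup>2" using qr lip by linarith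
  also have "\<dots> = (2 * M + 4 * M * h) * h" by (simp add: power2_eq_square algebra_simps)
  finally have "(mean a q q - mean a r r)\<^sup>2 \<le> ((2 * M + 4 * M * h) * h)\<^sup>2"
    using M h_nonneg by (intro power2_le_iff_abs_le[THEN iffD2]) auto
  then have "(mean a q q - mean a r r)\<^sup>2 / (8 * a0) \<le> (2 * M + 4 * M * h)\<^sup>2 / (8 * a0) * h\<^sup>2"
    using a0 by (simp add: power_mult_distrib divide_right_mono)
  with geometric_arithmetic_gap[OF a0 mean_ge[OF q, of q] mean_ge[OF r(1), of r]]
  have g: "\<bar>(mean a q q + mean a r r) / 2 - sqrt (mean a q q) * sqrt (mean a r r)\<bar>
      \<le> (2 * M + 4 * M * h)\<^sup>2 / (8 * a0) * h\<^sup>2" by simp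
  have "\<bar>mean a q r - sqrt (mean a q q) * sqrt (mean a r r)\<bar>
      \<le> 2 * M * h\<^sup>2 + (M * h\<^sup>2) / 2 + 2 * M * h\<^sup>2 + (2 * M + 4 * M * h)\<^sup>2 / (8 * a0) * h\<^sup>2"
    using abs_diff_chain[OF b qr mid g] by simp
  \<comment> \<open>The terms without square sum to 9/2 M h^2 and are rounded up.\<close>
  also have "\<dots> \<le> (5 * M + (2 * M + 4 * M * h)\<^sup>2 / (8 * a0)) * h\<^sup>2"
    using M by (simp add: distrib_right)
  finally show ?thesis .
qed

end

section \<open>The stiffness matrix and the preconditioner\<close>

context hexagon_mesh_coeff
begin

lemma scaled_hex_laplacian_stiffness:
  assumes \<nu>: "bij_betw \<nu> {..<card (internal_nodes v m)} (internal_nodes v m)"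
    and K: "(5 * M + (2 * M + 4 * M * h)\<^sup>2 / (8 * a0)) * h\<^sup>2 \<le> K / (real m)\<^sup>2"
  shows "\<exists>z \<alpha>. scaled_hex_laplacian m (card (internal_nodes v m)) z stiff a0 K \<alpha>
    (stiffness_matrix v m \<nu> (\<lambda>_. 1)) (stiffness_matrix v m \<nu> a) (preconditioner v m \<nu> a)"
proof -
  define n where "n = card (internal_nodes v m)"
  define z where "z i = the_inv_into (hex_lattice m) node (\<nu> i)" for i
  define \<alpha> where "\<alpha> i = mean a (z i) (z i)" for i
  have inj: "inj_on node (hex_lattice m)" by (simp add: inj_on_def)
  have bij: "bij_betw node (hex_lattice m) (internal_nodes v m)"
    using inj by (simp add: bij_betw_def internal_nodes_eq)
  have z: "bij_betw z {..<n} (hex_lattice m)"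
    using bij_betw_trans[OF \<nu>[folded n_def] bij_betw_the_inv_into[OF bij]] by (simp add: z_def comp_def cong: bij_betw_cong)
  have zin: "z i \<in> hex_lattice m" if "i < n" for i using z that by (auto simp: bij_betw_def)
  have \<nu>z: "\<nu> i = node (z i)" if "i < n" for i
  proof -
    have "\<nu> i \<in> node ` hex_lattice m" using \<nu> that by (auto simp: bij_betw_def n_def internal_nodes_eq)
    then show ?thesis by (simp add: z_def f_the_inv_into_f[OF inj])
  qed
  let ?A1 = "stiffness_matrix v m \<nu> (\<lambda>_. 1)" and ?A = "stiffness_matrix v m \<nu> a"
  have car: "?A1 \<in> carrier_mat n n" "?A \<in> carrier_mat n n"
    by (simp_all add: stiffness_matrix_def n_def Let_def)
  have A: "?A $$ (i,j) = stiff * hex_laplacian (z i) (z j) * mean a (z i) (z j)" if "i < n" "j < n" for i j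
  proof -
    have "?A $$ (i,j) = stiff * hex_laplacian (z j) (z i) * mean a (z j) (z i)"
      using that stiffness_entry_mean[OF zin[OF that(2)] zin[OF that(1)] integrable_a[OF zin[OF that(2)]]]
      by (simp add: stiffness_matrix_def Let_def n_def[symmetric] \<nu>z)
    then show ?thesis by (simp only: hex_laplacian_sym[of "z j"] mean_commute[of "z j"])
  qed
  have A1: "?A1 $$ (i,j) = stiff * hex_laplacian (z i) (z j)" if ij: "i < n" "j < n" for i j
  proof -
    have int: "set_integrable lebesgue (star q \<inter> star r) (\<lambda>_. 1 :: real)" for q r
      by (rule set_integrable_continuous_bounded[OF _ lmeasurable_star_Int, where B = 1])
         (auto intro!: open_Int open_star continuous_on_const)
    have "?A1 $$ (i,j) = stiff * hex_laplacian (z j) (z i) * mean (\<lambda>_. 1) (z j) (z i)"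
      using that stiffness_entry_mean[OF zin[OF that(2)] zin[OF that(1)] int]
      by (simp add: stiffness_matrix_def Let_def n_def[symmetric] \<nu>z)
    moreover have "hex_laplacian (z j) (z i) = 0 \<or> mean (\<lambda>_. 1) (z j) (z i) = 1"
    proof (cases "z i = z j \<or> z i - z j \<in> hex_nbrs")
      case True
      then have "measure lebesgue (star (z j) \<inter> star (z i)) > 0" by (intro measure_pair_pos)
      then show ?thesis using lmeasurable_star_Int[of "z j" "z i"] by (simp add: mean_def set_lebesgue_integral_def)
    qed (auto simp: hex_laplacian_def)
    ultimately have "?A1 $$ (i,j) = stiff * hex_laplacian (z j) (z i)" by auto
    then show ?thesis by (simp only: hex_laplacian_sym[of "z j"])
  qed
  have diag1: "hex_laplacian x x = 6" for x by (simp add: hex_laplacian_def)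
  have "diag_part ?A1 = mat_diag n (\<lambda>i. 6 * stiff)"
    unfolding diag_part_def using car by (auto simp: mat_diag_def A1 diag1 intro!: eq_matI)
  then have inv: "the (mat_inverse (diag_part ?A1)) = mat_diag n (\<lambda>i. inverse (6 * stiff))"
    using mat_inverse_mat_diag[of n "\<lambda>_. 6 * stiff"] stiff_pos by simp
  have dA: "diag_part ?A = mat_diag n (\<lambda>i. 6 * stiff * \<alpha> i)"
    unfolding diag_part_def using car by (auto simp: mat_diag_def A diag1 \<alpha>_def intro!: eq_matI)
  \<comment> \<open>The factor 6 \<open>stiff\<close> cancels: the scaling consists of the star
    averages of the coefficient.\<close>
  have sc: "scaling_matrix v m \<nu> a = mat_diag n \<alpha>"
    unfolding scaling_matrix_def inv dA using stiff_pos by (simp add: field_simps)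
  have ds: "diag_sqrt (scaling_matrix v m \<nu> a) = mat_diag n (\<lambda>i. sqrt (\<alpha> i))"
    unfolding sc diag_sqrt_def by (auto simp: mat_diag_def intro!: eq_matI)
  have P: "preconditioner v m \<nu> a = Matrix.mat n n (\<lambda>(i,j). sqrt (\<alpha> i) * ?A1 $$ (i,j) * sqrt (\<alpha> j))"
  proof -
    have "mat_diag n (\<lambda>i. sqrt (\<alpha> i)) * ?A1 = Matrix.mat n n (\<lambda>(i,j). sqrt (\<alpha> i) * ?A1 $$ (i,j))"
      by (rule mat_diag_mult_left[OF car(1)])
    then show ?thesis unfolding preconditioner_def ds
      by (subst mat_diag_mult_right[of _ n n]) (auto intro!: eq_matI)
  qed
  have "scaled_hex_laplacian m n z stiff a0 K \<alpha> ?A1 ?A (preconditioner v m \<nu> a)"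
  proof
    show "m \<ge> 1" by (rule m)
    show "bij_betw z {..<n} (hex_lattice m)" by (rule z)
    show "stiff > 0" by (rule stiff_pos)
    show "a0 > 0" by (rule a0)
    have "0 \<le> (5 * M + (2 * M + 4 * M * h)\<^sup>2 / (8 * a0)) * h\<^sup>2" using M a0 by simp
    then have "0 \<le> K / (real m)\<^sup>2" using K by linarith
    then show "K \<ge> 0" using m by (simp add: zero_le_divide_iff)
    show "\<alpha> i \<ge> a0" if "i < n" for i unfolding \<alpha>_def by (rule mean_ge[OF zin[OF that]]) simp
    show "?A1 \<in> carrier_mat n n" "?A \<in> carrier_mat n n" by (rule car)+
    show "preconditioner v m \<nu> a \<in> carrier_mat n n" by (simp add: P)
    fix i j assume ij: "i < n" "j < n"
    show "?A1 $$ (i,j) = stiff * hex_laplacian (z i) (z j)" by (rule A1[OF ij])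
    show "?A $$ (i,j) = ?A $$ (j,i)"
      unfolding A[OF ij] A[OF ij(2,1)] by (simp only: hex_laplacian_sym[of "z i"] mean_commute[of "z i"])
    show Pij: "preconditioner v m \<nu> a $$ (i,j) = sqrt (\<alpha> i) * ?A1 $$ (i,j) * sqrt (\<alpha> j)"
      unfolding P using ij by simp
    have eq: "?A $$ (i,j) - preconditioner v m \<nu> a $$ (i,j)
       = stiff * hex_laplacian (z i) (z j) * (mean a (z i) (z j) - sqrt (mean a (z i) (z i)) * sqrt (mean a (z j) (z j)))"
      unfolding Pij A[OF ij] A1[OF ij] by (simp add: \<alpha>_def algebra_simps)
    show "\<bar>?A $$ (i,j) - preconditioner v m \<nu> a $$ (i,j)\<bar>
       \<le> (if z j - z i \<in> hex_nbrs then stiff * K / (real m)\<^sup>2 else 0)"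
    proof (cases "z j - z i \<in> hex_nbrs")
      case True
      then have "hex_laplacian (z i) (z j) = -1" using zero_notin_hex_nbrs by (auto simp: hex_laplacian_def)
      then have "\<bar>?A $$ (i,j) - preconditioner v m \<nu> a $$ (i,j)\<bar>
         = stiff * \<bar>mean a (z i) (z j) - sqrt (mean a (z i) (z i)) * sqrt (mean a (z j) (z j))\<bar>"
        unfolding eq using stiff_pos by (simp add: abs_mult)
      also have "\<dots> \<le> stiff * (K / (real m)\<^sup>2)"
        using mean_gap[OF zin[OF ij(1)] zin[OF ij(2)] True] K stiff_pos by (intro mult_left_mono) auto
      finally show ?thesis using True by simp
    next
      case False
      \<comment> \<open>On the diagonal the product of the two square roots is the star average
        itself, so the entries agree exactly; all other entries in this case are zero in both
        matrices.\<close>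
      have "mean a (z i) (z i) \<ge> a0" by (rule mean_ge[OF zin[OF ij(1)]]) simp
      then have "z i = z j \<or> hex_laplacian (z i) (z j) = 0" "mean a (z i) (z i) \<ge> 0"
        using False a0 by (auto simp: hex_laplacian_def)
      then have "?A $$ (i,j) - preconditioner v m \<nu> a $$ (i,j) = 0" unfolding eq by auto
      then show ?thesis using False by simp
    qed
  next
    fix u :: "real Matrix.vec" assume u: "u \<in> carrier_vec n"
    \<comment> \<open>The matrix A(a) - a0 A(1) has nonpositive off-diagonal entries and nonnegative
      row sums. The constant 1 is then a supersolution with c = 0, and the form is
      nonnegative.\<close>
    have "0 * (\<Sum>i\<in>{..<n}. (vec_index u i)\<^sup>2) \<le> (\<Sum>i\<in>{..<n}. \<Sum>j\<in>{..<n}.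
        (stiff * (hex_laplacian (z i) (z j) * (mean a (z i) (z j) - a0))) * (vec_index u i * vec_index u j))"
    proof (rule Z_matrix_form_lower_bound[where w = "\<lambda>_. 1"])
      fix i j assume ij: "i \<in> {..<n}" "j \<in> {..<n}"
      show "stiff * (hex_laplacian (z i) (z j) * (mean a (z i) (z j) - a0)) = stiff * (hex_laplacian (z j) (z i) * (mean a (z j) (z i) - a0))"
        by (simp only: hex_laplacian_sym[of "z i"] mean_commute[of "z i"])
      assume "i \<noteq> j"
      then have ne: "z i \<noteq> z j" using z ij by (auto simp: bij_betw_def dest: inj_onD)
      show "stiff * (hex_laplacian (z i) (z j) * (mean a (z i) (z j) - a0)) \<le> 0"
      proof (cases "z j - z i \<in> hex_nbrs")
        case True
        then have "mean a (z i) (z j) - a0 \<ge> 0" using mean_ge[of "z i" "z j"] zin ij by simp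
        then show ?thesis using hex_laplacian_off_diag[OF ne] stiff_pos
          by (intro mult_nonneg_nonpos mult_nonpos_nonneg) auto
      qed (use ne in \<open>simp add: hex_laplacian_def\<close>)
    next
      fix i assume i: "i \<in> {..<n}"
      have "(\<Sum>j<n. hex_laplacian (z i) (z j) * (mean a (z i) (z j) - a0)) \<ge> 0"
        using weighted_laplacian_row_sum[OF zin, of i] i
          sum.reindex_bij_betw[OF z, of "\<lambda>r. hex_laplacian (z i) r * (mean a (z i) r - a0)"] by simp
      then show "0 * (1::real) \<le> (\<Sum>j\<in>{..<n}. stiff * (hex_laplacian (z i) (z j) * (mean a (z i) (z j) - a0)) * 1)"
        using stiff_pos by (simp add: sum_distrib_left[symmetric])
    qed simp
    also have "\<dots> = scalar_prod u (?A *\<^sub>v u) - a0 * scalar_prod u (?A1 *\<^sub>v u)"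
      unfolding quadratic_form_sum[OF car(1) u] quadratic_form_sum[OF car(2) u] sum_distrib_left sum_subtractf[symmetric]
      by (intro sum.cong refl) (simp add: A A1 algebra_simps)
    finally show "a0 * scalar_prod u (?A1 *\<^sub>v u) \<le> scalar_prod u (?A *\<^sub>v u)" by simp
  qed
  then show ?thesis unfolding n_def by blast
qed

end

section \<open>The edge vectors of a regular hexagon\<close>

definition unit_dir :: "real \<Rightarrow> real^2" where "unit_dir t = vector [cos t, sin t]"

text \<open>Rotation by 60 degrees is multiplication by a primitive sixth root of unity, which
  satisfies z^2 = z - 1. This recursion yields all vertices from two of them.\<close>

lemma unit_dir_rec: "unit_dir (t + 2 * (pi / 3)) = unit_dir (t + pi / 3) - unit_dir t"
proof -
  have "cos (2 * (pi / 3)) = - (1 / 2)" "sin (2 * (pi / 3)) = sqrt 3 / 2"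
    unfolding cos_double sin_double cos_60 sin_60 by (simp_all add: power2_eq_square)
  then show ?thesis
    by (simp add: unit_dir_def Finite_Cartesian_Product.vec_eq_iff forall_2 cos_add sin_add cos_60 sin_60 algebra_simps)
qed

lemma unit_dir_add_60:
  "unit_dir (t + pi / 3) = (1/2) *\<^sub>R unit_dir t + (sqrt 3 / 2) *\<^sub>R vector [- sin t, cos t]"
  by (simp add: unit_dir_def Finite_Cartesian_Product.vec_eq_iff forall_2 cos_add sin_add cos_60 sin_60 algebra_simps)

lemma inner_unit_dir: "inner (unit_dir t) (unit_dir t) = 1" "inner (unit_dir (t + pi / 3)) (unit_dir (t + pi / 3)) = 1"
  "inner (unit_dir t) (unit_dir (t + pi / 3)) = 1 / 2"
proof -
  have sc: "(cos t)\<^sup>2 + (sin t)\<^sup>2 = 1" for t :: real by simp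
  show "inner (unit_dir t) (unit_dir t) = 1" "inner (unit_dir (t + pi / 3)) (unit_dir (t + pi / 3)) = 1"
    using sc[of t] sc[of "t + pi / 3"] by (simp_all add: unit_dir_def inner_vec_def sum_2 power2_eq_square)
  have "inner (unit_dir t) (vector [- sin t, cos t]) = 0"
    by (simp add: unit_dir_def inner_vec_def sum_2)
  then show "inner (unit_dir t) (unit_dir (t + pi / 3)) = 1 / 2"
    unfolding unit_dir_add_60 using \<open>inner (unit_dir t) (unit_dir t) = 1\<close> by (simp add: inner_add_right)
qed

text \<open>Two unit vectors at 60 degrees have the Gram matrix with rows (1, 1/2) and (1/2, 1),
  whose inverse is 4/3 times the one with rows (1, -1/2) and (-1/2, 1). This gives the dual basis,
  rescaled by m / L because the edges have length L / m.\<close>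

lemma regular_hexagon_mesh:
  assumes v: "\<And>k. v k = c + L *\<^sub>R vector [cos (\<theta> + real k * pi / 3), sin (\<theta> + real k * pi / 3)]"
    and L: "L > 0" and m: "m \<ge> 1"
  defines "e1 \<equiv> (L / m) *\<^sub>R unit_dir \<theta>" and "e2 \<equiv> (L / m) *\<^sub>R unit_dir (\<theta> + pi / 3)"
    and "b1 \<equiv> (m / L * (4/3)) *\<^sub>R (unit_dir \<theta> - (1/2) *\<^sub>R unit_dir (\<theta> + pi / 3))"
    and "b2 \<equiv> (m / L * (4/3)) *\<^sub>R (unit_dir (\<theta> + pi / 3) - (1/2) *\<^sub>R unit_dir \<theta>)"
  shows "hexagon_mesh v m c e1 e2 b1 b2 ((m / L)\<^sup>2 * (4/3))"
proof -
  define u w where "u = unit_dir \<theta>" and "w = unit_dir (\<theta> + pi / 3)"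
  have ip: "inner u u = 1" "inner w w = 1" "inner u w = 1/2" "inner w u = 1/2"
    using inner_unit_dir[of \<theta>] by (simp_all add: u_def w_def inner_commute)
  have mL: "real m / L * (L / real m) = 1" "real m > 0" using m L by simp_all
  define d where "d k = unit_dir (\<theta> + real k * pi / 3)" for k
  have vd: "v k = c + L *\<^sub>R d k" for k by (simp add: v d_def unit_dir_def)
  have d0: "d 0 = u" "d 1 = w" by (simp_all add: d_def u_def w_def)
  have rec: "d (k + 2) = d (k + 1) - d k" for k
  proof -
    have "\<theta> + real (k + 2) * pi / 3 = \<theta> + real k * pi / 3 + 2 * (pi / 3)"
      "\<theta> + real (k + 1) * pi / 3 = \<theta> + real k * pi / 3 + pi / 3" by (simp_all add: field_simps)
    then show ?thesis unfolding d_def by (simp only: unit_dir_rec)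
  qed
  have ds: "d 2 = w - u" "d 3 = - u" "d 4 = - w" "d 5 = u - w" "d 6 = u"
    using rec[of 0] rec[of 1] rec[of 2] rec[of 3] rec[of 4] d0 by (simp_all add: eval_nat_numeral)
  have Lm: "real m *\<^sub>R (L / real m) *\<^sub>R x = L *\<^sub>R x" for x :: "real^2" using mL by simp
  \<comment> \<open>The expansion is verified in the orthonormal frame of \<open>u\<close> and its
    rotation \<open>q\<close> by 90 degrees.\<close>
  have exp3: "y = (4/3) *\<^sub>R (inner (u - (1/2) *\<^sub>R w) y *\<^sub>R u + inner (w - (1/2) *\<^sub>R u) y *\<^sub>R w)" for y
  proof -
    define q where "q = (vector [- sin \<theta>, cos \<theta>] :: real^2)"
    have w: "w = (1/2) *\<^sub>R u + (sqrt 3 / 2) *\<^sub>R q" unfolding w_def u_def q_def by (rule unit_dir_add_60)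
    have yq: "y = inner u y *\<^sub>R u + inner q y *\<^sub>R q"
    proof -
      have cs: "cos \<theta> * (cos \<theta> * r) + sin \<theta> * (sin \<theta> * r) = r" for r
      proof -
        have "cos \<theta> * (cos \<theta> * r) + sin \<theta> * (sin \<theta> * r) = ((sin \<theta>)\<^sup>2 + (cos \<theta>)\<^sup>2) * r"
          by (simp only: power2_eq_square distrib_right mult.assoc add.commute)
        then show ?thesis by simp
      qed
      show ?thesis
        unfolding u_def q_def unit_dir_def
        by (simp add: Finite_Cartesian_Product.vec_eq_iff forall_2 inner_vec_def sum_2)
           (simp add: algebra_simps cs)
    qed
    define s t where "s = inner u y" and "t = inner q y"
    have i: "inner (u - (1/2) *\<^sub>R w) y = 3/4 * s - sqrt 3 / 4 * t" "inner (w - (1/2) *\<^sub>R u) y = sqrt 3 / 2 * t"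
      unfolding w by (simp_all add: s_def t_def inner_diff_left inner_add_left field_simps)
    have "(4/3) *\<^sub>R ((3/4 * s - sqrt 3 / 4 * t) *\<^sub>R u + (sqrt 3 / 2 * t) *\<^sub>R w) = s *\<^sub>R u + t *\<^sub>R q"
    proof -
      have "(4/3) *\<^sub>R ((3/4 * s - sqrt 3 / 4 * t) *\<^sub>R u + (sqrt 3 / 2 * t) *\<^sub>R w)
         = (4/3 * (3/4 * s - sqrt 3 / 4 * t) + 4/3 * (sqrt 3 / 2 * t * (1/2))) *\<^sub>R u + (4/3 * (sqrt 3 / 2 * t * (sqrt 3 / 2))) *\<^sub>R q"
        unfolding w by (simp add: scaleR_add_right scaleR_add_left)
      moreover have "4/3 * (3/4 * s - sqrt 3 / 4 * t) + 4/3 * (sqrt 3 / 2 * t * (1/2)) = s" by (simp add: field_simps)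
      moreover have "4/3 * (sqrt 3 / 2 * t * (sqrt 3 / 2)) = t" by simp
      ultimately show ?thesis by simp
    qed
    then show ?thesis using yq unfolding i s_def[symmetric] t_def[symmetric] by simp
  qed
  note defs = e1_def e2_def b1_def b2_def u_def[symmetric] w_def[symmetric]
  show ?thesis
  proof
    show "m \<ge> 1" by (rule m)
    show "inner b1 e1 = 1" "inner b1 e2 = 0" "inner b2 e1 = 0" "inner b2 e2 = 1"
      unfolding defs using mL L by (simp_all add: inner_diff_left ip)
    show "y = inner b1 y *\<^sub>R e1 + inner b2 y *\<^sub>R e2" for y
    proof -
      have "inner b1 y *\<^sub>R e1 + inner b2 y *\<^sub>R e2
         = (4/3) *\<^sub>R (inner (u - (1/2) *\<^sub>R w) y *\<^sub>R u + inner (w - (1/2) *\<^sub>R u) y *\<^sub>R w)"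
        unfolding defs using mL L by (simp add: scaleR_add_right)
      then show ?thesis using exp3[of y] by simp
    qed
    show "inner b1 b1 = (m / L)\<^sup>2 * (4/3)" "inner b2 b2 = (m / L)\<^sup>2 * (4/3)" "inner b1 b2 = - ((m / L)\<^sup>2 * (4/3)) / 2"
      unfolding defs by (simp_all add: inner_diff_left inner_diff_right ip power2_eq_square field_simps)
    show "0 < (m / L)\<^sup>2 * (4/3)" using mL L by simp
    show "v 0 = c + real m *\<^sub>R e1" "v 1 = c + real m *\<^sub>R e2" "v 2 = c + real m *\<^sub>R (e2 - e1)"
      "v 3 = c - real m *\<^sub>R e1" "v 4 = c - real m *\<^sub>R e2" "v 5 = c + real m *\<^sub>R (e1 - e2)" "v 6 = v 0"
      unfolding defs vd scaleR_diff_right[of "real m"] Lm ds d0 by (simp_all add: scaleR_diff_right)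
  qed
qed

theorem theorem3p4:
  fixes v :: "nat \<Rightarrow> real^2"
    and a :: "real^2 \<Rightarrow> real"
    and a0 :: real
    and \<nu> :: "nat \<Rightarrow> nat \<Rightarrow> real^2"
  assumes "regular_hexagon v"
    and "C2_closure (hex_domain v) a"
    and "a0 > 0"
    and "\<And>x. x \<in> closure (hex_domain v) \<Longrightarrow> a x \<ge> a0"
    and "\<And>m. m \<ge> 1 \<Longrightarrow>
           bij_betw (\<nu> m) {..<card (internal_nodes v m)} (internal_nodes v m)"
  shows "(\<forall>m\<ge>1. sym_pos_def (card (internal_nodes v m)) (stiffness_matrix v m (\<nu> m) a) \<and>
                sym_pos_def (card (internal_nodes v m)) (preconditioner v m (\<nu> m) a)) \<and>
         (\<forall>\<epsilon>>0. \<exists>C::nat. \<forall>m\<ge>1.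
            eigenvalues_outside (preconditioned_matrix v m (\<nu> m) a)
              (complex_of_real ` {1 - \<epsilon><..<1 + \<epsilon>}) \<le> C) \<and>
         (\<exists>d D::real. 0 < d \<and> d \<le> D \<and>
            (\<forall>m\<ge>1. spectrum (preconditioned_matrix v m (\<nu> m) a) \<subseteq> complex_of_real ` {d..D}))"
proof -
  let ?\<Omega> = "hex_domain v"
  obtain c \<theta> L where L: "L > 0"
    and v: "\<And>k. v k = c + L *\<^sub>R vector [cos (\<theta> + real k * pi / 3), sin (\<theta> + real k * pi / 3)]"
    using assms(1) unfolding regular_hexagon_def by blast
  define e1 e2 b1 b2 where "e1 m = (L / real m) *\<^sub>R unit_dir \<theta>" and "e2 m = (L / real m) *\<^sub>R unit_dir (\<theta> + pi / 3)"
    and "b1 m = (real m / L * (4/3)) *\<^sub>R (unit_dir \<theta> - (1/2) *\<^sub>R unit_dir (\<theta> + pi / 3))"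
    and "b2 m = (real m / L * (4/3)) *\<^sub>R (unit_dir (\<theta> + pi / 3) - (1/2) *\<^sub>R unit_dir \<theta>)" for m :: nat
  have mesh: "hexagon_mesh v m c (e1 m) (e2 m) (b1 m) (b2 m) ((real m / L)\<^sup>2 * (4/3))" if "m \<ge> 1" for m
    unfolding e1_def e2_def b1_def b2_def by (rule regular_hexagon_mesh[OF v L that])
  \<comment> \<open>Openness, convexity and boundedness concern the hexagon alone; the coarsest mesh
    supplies them.\<close>
  interpret M1: hexagon_mesh v 1 c "e1 1" "e2 1" "b1 1" "b2 1" "(real 1 / L)\<^sup>2 * (4/3)" by (rule mesh) simp
  have \<Omega>: "open ?\<Omega>" "convex ?\<Omega>" "bounded ?\<Omega>"
    unfolding M1.hex_domain_eq by (rule M1.open_hex_open M1.convex_hex_open M1.bounded_hex_open)+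
  obtain M where M: "M \<ge> 0" "\<And>x y. x \<in> ?\<Omega> \<Longrightarrow> y \<in> ?\<Omega> \<Longrightarrow> \<bar>a x - a y\<bar> \<le> M * norm (x - y)"
    "\<And>x y. x + y \<in> ?\<Omega> \<Longrightarrow> x - y \<in> ?\<Omega> \<Longrightarrow> \<bar>a (x + y) + a (x - y) - 2 * a x\<bar> \<le> M * (norm y)\<^sup>2"
    using C2_closure_bounds[OF \<Omega> assms(2)] by blast
  have cont: "continuous_on (closure ?\<Omega>) a" using assms(2) by (simp add: C2_closure_def)
  have "compact (a ` closure ?\<Omega>)" using \<Omega>(3) by (intro compact_continuous_image cont) (simp add: compact_closure)
  then have "bdd_above (a ` closure ?\<Omega>)" by (intro bounded_imp_bdd_above compact_imp_bounded)
  then obtain B where B: "\<And>x. x \<in> closure ?\<Omega> \<Longrightarrow> a x \<le> B" unfolding bdd_above_def by blast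
  \<comment> \<open>The constant of \<open>mean_gap\<close> with the mesh width L / m replaced by
    its largest value L; the remaining factor (L / m)^2 supplies L^2 here and the m^-2 of the
    consistency estimate.\<close>
  define K where "K = (5 * M + (2 * M + 4 * M * L)\<^sup>2 / (8 * a0)) * L\<^sup>2"
  have sub: "?\<Omega> \<subseteq> closure ?\<Omega>" by (rule closure_subset)
  have core: "\<exists>z \<kappa> \<alpha>. scaled_hex_laplacian m (card (internal_nodes v m)) z \<kappa> a0 K \<alpha>
      (stiffness_matrix v m (\<nu> m) (\<lambda>_. 1)) (stiffness_matrix v m (\<nu> m) a) (preconditioner v m (\<nu> m) a)"
    if m: "m \<ge> 1" for m
  proof -
    interpret hexagon_mesh v m c "e1 m" "e2 m" "b1 m" "b2 m" "(real m / L)\<^sup>2 * (4/3)" by (rule mesh[OF m])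
    have nu: "norm (unit_dir t) = 1" for t using inner_unit_dir(1)[of t] by (simp add: norm_eq_1)
    interpret hexagon_mesh_coeff v m c "e1 m" "e2 m" "b1 m" "b2 m" "(real m / L)\<^sup>2 * (4/3)" a a0 B M "L / real m"
    proof
      show "continuous_on hex_open a" using continuous_on_subset[OF cont sub] unfolding hex_domain_eq .
      show "a x \<ge> a0" "a x \<le> B" if "x \<in> hex_open" for x
        using that assms(4) B sub unfolding hex_domain_eq by blast+
      show "norm (e1 m) \<le> L / real m" "norm (e2 m) \<le> L / real m"
        using L by (simp_all add: e1_def e2_def nu)
    qed (use M assms(3) in \<open>simp_all add: hex_domain_eq\<close>)
    have "L / real m \<le> L" using L m by (simp add: pos_divide_le_eq)
    then have "(2 * M + 4 * M * (L / real m))\<^sup>2 \<le> (2 * M + 4 * M * L)\<^sup>2"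
      using M(1) L m by (intro power_mono add_mono mult_left_mono order_refl) auto
    then have "(5 * M + (2 * M + 4 * M * (L / real m))\<^sup>2 / (8 * a0)) * (L / real m)\<^sup>2
        \<le> (5 * M + (2 * M + 4 * M * L)\<^sup>2 / (8 * a0)) * (L / real m)\<^sup>2"
      using assms(3) by (intro mult_right_mono add_left_mono divide_right_mono) auto
    also have "\<dots> = K / (real m)\<^sup>2" by (simp add: K_def power_divide)
    finally show ?thesis using scaled_hex_laplacian_stiffness[OF assms(5)[OF m]] by blast
  qed
  have pre: "\<exists>H. mat_inverse (preconditioner v m (\<nu> m) a) = Some H" if m: "m \<ge> 1" for m
  proof -
    obtain z \<kappa> \<alpha> where "scaled_hex_laplacian m (card (internal_nodes v m)) z \<kappa> a0 K \<alpha>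
      (stiffness_matrix v m (\<nu> m) (\<lambda>_. 1)) (stiffness_matrix v m (\<nu> m) a) (preconditioner v m (\<nu> m) a)"
      using core[OF m] by blast
    from sym_pos_def_imp_inverse[OF scaled_hex_laplacian.spd_P[OF this]] show ?thesis by blast
  qed
  have spd: "sym_pos_def (card (internal_nodes v m)) (stiffness_matrix v m (\<nu> m) a)"
    "sym_pos_def (card (internal_nodes v m)) (preconditioner v m (\<nu> m) a)" if "m \<ge> 1" for m
    using core[OF that] scaled_hex_laplacian.spd_A scaled_hex_laplacian.spd_P by blast+
  have spec: "spectrum (preconditioned_matrix v m (\<nu> m) a) \<subseteq> complex_of_real ` {1 / (1 + K / a0)..1 + K / a0}"
    if m: "m \<ge> 1" for m
  proof -
    obtain H where H: "mat_inverse (preconditioner v m (\<nu> m) a) = Some H" using pre[OF m] by blast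
    obtain z \<kappa> \<alpha> where S: "scaled_hex_laplacian m (card (internal_nodes v m)) z \<kappa> a0 K \<alpha>
      (stiffness_matrix v m (\<nu> m) (\<lambda>_. 1)) (stiffness_matrix v m (\<nu> m) a) (preconditioner v m (\<nu> m) a)"
      using core[OF m] by blast
    show ?thesis using scaled_hex_laplacian.spectrum_subset[OF S H]
      by (simp only: preconditioned_matrix_def H option.sel)
  qed
  have clus: "real (eigenvalues_outside (preconditioned_matrix v m (\<nu> m) a) (complex_of_real ` {1 - \<epsilon><..<1 + \<epsilon>})) * \<epsilon>\<^sup>2
      \<le> 1296000 * K\<^sup>2 / a0\<^sup>2" if m: "m \<ge> 1" and "\<epsilon> > 0" for m \<epsilon>
  proof -
    obtain H where H: "mat_inverse (preconditioner v m (\<nu> m) a) = Some H" using pre[OF m] by blast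
    obtain z \<kappa> \<alpha> where S: "scaled_hex_laplacian m (card (internal_nodes v m)) z \<kappa> a0 K \<alpha>
      (stiffness_matrix v m (\<nu> m) (\<lambda>_. 1)) (stiffness_matrix v m (\<nu> m) a) (preconditioner v m (\<nu> m) a)"
      using core[OF m] by blast
    show ?thesis using scaled_hex_laplacian.eigenvalues_outside_bound[OF S H \<open>\<epsilon> > 0\<close>]
      by (simp only: preconditioned_matrix_def H option.sel)
  qed
  have K0: "K / a0 \<ge> 0" using M(1) assms(3) L by (simp add: K_def)
  show ?thesis
  proof (intro conjI allI impI)
    fix \<epsilon> :: real assume e: "\<epsilon> > 0"
    \<comment> \<open>The squared Frobenius bound divided by \<epsilon>^2 and rounded up;
      \<open>m\<close> does not occur in it.\<close>
    define C where "C = nat \<lceil>1296000 * K\<^sup>2 / a0\<^sup>2 / \<epsilon>\<^sup>2\<rceil>"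
    have "eigenvalues_outside (preconditioned_matrix v m (\<nu> m) a) (complex_of_real ` {1 - \<epsilon><..<1 + \<epsilon>}) \<le> C"
      if "m \<ge> 1" for m
    proof -
      have "real (eigenvalues_outside (preconditioned_matrix v m (\<nu> m) a) (complex_of_real ` {1 - \<epsilon><..<1 + \<epsilon>}))
         \<le> 1296000 * K\<^sup>2 / a0\<^sup>2 / \<epsilon>\<^sup>2"
        by (rule mult_imp_le_div_pos[OF _ clus[OF that e]]) (use e in simp)
      also have "\<dots> \<le> real C" unfolding C_def by (rule real_nat_ceiling_ge)
      finally show ?thesis by simp
    qed
    then show "\<exists>C::nat. \<forall>m\<ge>1. eigenvalues_outside (preconditioned_matrix v m (\<nu> m) a) (complex_of_real ` {1 - \<epsilon><..<1 + \<epsilon>}) \<le> C"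
      by blast
  next
    have "1 / (1 + K / a0) \<le> 1" "1 \<le> 1 + K / a0" "0 < 1 / (1 + K / a0)" using K0 by (simp_all add: divide_le_eq)
    then have "0 < 1 / (1 + K / a0) \<and> 1 / (1 + K / a0) \<le> 1 + K / a0" by linarith
    then show "\<exists>d D::real. 0 < d \<and> d \<le> D \<and>
        (\<forall>m\<ge>1. spectrum (preconditioned_matrix v m (\<nu> m) a) \<subseteq> complex_of_real ` {d..D})"
      using spec by blast
  qed (use spd in blast)+
qed

end
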